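(* There exists a finitely generated Magnus nilpotent group $G$, not relatively free, such that $\mathcal{L}_{\mathbb{Q}}(G)$ is not isomorphic to $L_{\mathbb{Q}}(G)$ as Lie algebras over $\mathbb{Q}$.
   Context: Group commutators are $(a,b)=a^{-1}b^{-1}ab$; $\gamma_i$ denotes lower central series terms. A group $G$ is a Magnus group if every $\gamma_i(G)/\gamma_{i+1}(G)$ is torsion-free and $\bigcap_{i\ge1}\gamma_i(G)=\{1\}$. A group is relatively free if it is a free group of some variety of groups. For a torsion-free finitely generated nilpotent group $G$: $\tau_i(G)=\{g\in G:g^m\in\gamma_i(G)\text{ for some integer }m\ge1\}$, and $L_{\mathbb{Q}}(G)=\bigoplus_{i\ge1}\mathbb{Q}\otimes_{\mathbb{Z}}\bigl(\tau_i(G)/\tau_{i+1}(G)\bigr)$ with bracket extended bilinearly from $[a\tau_{i+1}(G),b\tau_{j+1}(G)]=(a,b)\tau_{i+j+1}(G)$ for $a\in\tau_i(G)$, $b\in\tau_j(G)$. Let $\Delta$ be the augmentation ideal of $\mathbb{Q}G$, $\Delta^*$ its completion with respect to the powers $\Delta^i$, and $\log g=\sum_{k\ge1}(-1)^{k+1}(g-1)^k/k\in\Delta^*$. Then $\mathcal{L}_{\mathbb{Q}}(G)$ is the $\mathbb{Q}$-span of $\{\log g:g\in G\}$ in $\Delta^*$, known to be a finite-dimensional nilpotent Lie algebra under $[x,y]=xy-yx$. *)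

theory Defs
  imports
    "HOL-Algebra.Free_Abelian_Groups"
    "HOL-Algebra.Ideal_Product"
    "HOL-Algebra.QuotRing"
    "HOL-Algebra.Module"
begin

section \<open>Lower central series and Magnus groups\<close>

definition commutator :: "('a, 'b) monoid_scheme \<Rightarrow> 'a \<Rightarrow> 'a \<Rightarrow> 'a" where
  "commutator G a b = inv\<^bsub>G\<^esub> a \<otimes>\<^bsub>G\<^esub> inv\<^bsub>G\<^esub> b \<otimes>\<^bsub>G\<^esub> a \<otimes>\<^bsub>G\<^esub> b"

text \<open>The series starts at index 1; the value at 0 is a dummy that is never used.\<close>

fun lower_central :: "('a, 'b) monoid_scheme \<Rightarrow> nat \<Rightarrow> 'a set" where
  "lower_central G 0 = carrier G"
| "lower_central G (Suc 0) = carrier G"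
| "lower_central G (Suc (Suc i)) =
     generate G {commutator G a b | a b. a \<in> lower_central G (Suc i) \<and> b \<in> carrier G}"

definition nilpotent_group :: "('a, 'b) monoid_scheme \<Rightarrow> bool" where
  "nilpotent_group G \<longleftrightarrow> (\<exists>i\<ge>1. lower_central G i = {\<one>\<^bsub>G\<^esub>})"

definition finitely_generated_group :: "('a, 'b) monoid_scheme \<Rightarrow> bool" where
  "finitely_generated_group G \<longleftrightarrow> (\<exists>S. finite S \<and> S \<subseteq> carrier G \<and> generate G S = carrier G)"

definition torsion_free_group :: "('a, 'b) monoid_scheme \<Rightarrow> bool" where
  "torsion_free_group G \<longleftrightarrow>
     (\<forall>x\<in>carrier G. \<forall>m::nat. m \<ge> 1 \<longrightarrow> x [^]\<^bsub>G\<^esub> m = \<one>\<^bsub>G\<^esub> \<longrightarrow> x = \<one>\<^bsub>G\<^esub>)"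

definition Magnus_group :: "('a, 'b) monoid_scheme \<Rightarrow> bool" where
  "Magnus_group G \<longleftrightarrow>
     (\<forall>i\<ge>1. torsion_free_group
        ((G\<lparr>carrier := lower_central G i\<rparr>) Mod lower_central G (Suc i))) \<and>
     (\<Inter>i\<in>{1..}. lower_central G i) = {\<one>\<^bsub>G\<^esub>}"


section \<open>Relatively free groups\<close>

text \<open>
  Group words are lists of letters \<open>(x, e)\<close>, standing for \<open>x\<close> if \<open>e = False\<close> and for
  the inverse of \<open>x\<close> if \<open>e = True\<close>.  The free group consists of the reduced words.
\<close>

definition reduced_word :: "('x \<times> bool) list \<Rightarrow> bool" where
  "reduced_word w \<longleftrightarrow> successively (\<lambda>(x, e) (y, d). \<not> (x = y \<and> e \<noteq> d)) w"

fun cons_letter :: "'x \<times> bool \<Rightarrow> ('x \<times> bool) list \<Rightarrow> ('x \<times> bool) list" where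
  "cons_letter l [] = [l]"
| "cons_letter (x, e) ((y, d) # w) = (if x = y \<and> e \<noteq> d then w else (x, e) # (y, d) # w)"

definition free_group :: "'x set \<Rightarrow> ('x \<times> bool) list monoid" where
  "free_group X =
     \<lparr>carrier = {w. reduced_word w \<and> fst ` set w \<subseteq> X},
      monoid.mult = foldr cons_letter, one = []\<rparr>"

definition word_value ::
  "('a, 'b) monoid_scheme \<Rightarrow> ('x \<Rightarrow> 'a) \<Rightarrow> ('x \<times> bool) list \<Rightarrow> 'a" where
  "word_value H f w =
     foldr (\<lambda>(x, e) h. (if e then inv\<^bsub>H\<^esub> f x else f x) \<otimes>\<^bsub>H\<^esub> h) w \<one>\<^bsub>H\<^esub>"

text \<open>
  A variety is the class of all groups that satisfy the laws \<open>w = 1\<close> for the words \<open>w\<close> of some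
  set \<open>W\<close> of words in countably many variables.  Its free group on \<open>X\<close> is \<open>F/W(F)\<close>, with \<open>F\<close>
  the free group on \<open>X\<close> and \<open>W(F)\<close> the subgroup generated by all values in \<open>F\<close> of words of \<open>W\<close>.
\<close>

definition verbal_subgroup ::
  "(nat \<times> bool) list set \<Rightarrow> ('a, 'b) monoid_scheme \<Rightarrow> 'a set" where
  "verbal_subgroup W H =
     generate H {word_value H f w | f w. w \<in> W \<and> f \<in> UNIV \<rightarrow> carrier H}"

definition variety_free_group ::
  "(nat \<times> bool) list set \<Rightarrow> 'x set \<Rightarrow> ('x \<times> bool) list set monoid" where
  "variety_free_group W X = free_group X Mod verbal_subgroup W (free_group X)"

text \<open>
  Taking the free generators in the element type of \<open>G\<close> is no restriction: they embed into \<open>G\<close>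
  unless the variety, and hence \<open>G\<close>, is trivial, and then \<open>X = {}\<close> will do.
\<close>

definition relatively_free :: "('a, 'b) monoid_scheme \<Rightarrow> bool" where
  "relatively_free G \<longleftrightarrow>
     (\<exists>W (X::'a set). W \<subseteq> carrier (free_group UNIV) \<and> G \<cong> variety_free_group W X)"


section \<open>Lie algebras over the rationals\<close>

record 'v rat_lie_algebra = "'v partial_object" +
  lie_zero :: 'v
  lie_add :: "'v \<Rightarrow> 'v \<Rightarrow> 'v"
  lie_scale :: "rat \<Rightarrow> 'v \<Rightarrow> 'v"
  lie_bracket :: "'v \<Rightarrow> 'v \<Rightarrow> 'v"

definition lie_iso :: "'v rat_lie_algebra \<Rightarrow> 'w rat_lie_algebra \<Rightarrow> ('v \<Rightarrow> 'w) set" where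
  "lie_iso L M = {f. bij_betw f (carrier L) (carrier M) \<and>
     (\<forall>x\<in>carrier L. \<forall>y\<in>carrier L. f (lie_add L x y) = lie_add M (f x) (f y)) \<and>
     (\<forall>q. \<forall>x\<in>carrier L. f (lie_scale L q x) = lie_scale M q (f x)) \<and>
     (\<forall>x\<in>carrier L. \<forall>y\<in>carrier L. f (lie_bracket L x y) = lie_bracket M (f x) (f y))}"

definition lie_isomorphic :: "'v rat_lie_algebra \<Rightarrow> 'w rat_lie_algebra \<Rightarrow> bool" where
  "lie_isomorphic L M \<longleftrightarrow> lie_iso L M \<noteq> {}"


section \<open>The graded Lie algebra\<close>

definition isolator :: "('a, 'b) monoid_scheme \<Rightarrow> nat \<Rightarrow> 'a set" where
  "isolator G i = {g \<in> carrier G. \<exists>m::nat. m \<ge> 1 \<and> g [^]\<^bsub>G\<^esub> m \<in> lower_central G i}"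

definition isolator_quotient :: "('a, 'b) monoid_scheme \<Rightarrow> nat \<Rightarrow> 'a set monoid" where
  "isolator_quotient G i = (G\<lparr>carrier := isolator G i\<rparr>) Mod isolator G (Suc i)"

text \<open>
  The tensor product of the rationals with an abelian group \<open>A\<close> over the integers, as the free
  abelian group on symbols \<open>(q, a)\<close> modulo biadditivity.
\<close>

abbreviation tensor_free ::
  "('c, 'd) monoid_scheme \<Rightarrow> (rat \<times> 'c \<Rightarrow>\<^sub>0 int) monoid" where
  "tensor_free A \<equiv> free_Abelian_group (UNIV \<times> carrier A)"

definition tensor_relations :: "('c, 'd) monoid_scheme \<Rightarrow> (rat \<times> 'c \<Rightarrow>\<^sub>0 int) set" where
  "tensor_relations A = generate (tensor_free A)
     ({frag_of (q + r, a) - frag_of (q, a) - frag_of (r, a) | q r a. a \<in> carrier A} \<union>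
      {frag_of (q, a \<otimes>\<^bsub>A\<^esub> b) - frag_of (q, a) - frag_of (q, b) | q a b.
         a \<in> carrier A \<and> b \<in> carrier A})"

definition rat_tensor ::
  "('c, 'd) monoid_scheme \<Rightarrow> (rat \<times> 'c \<Rightarrow>\<^sub>0 int) set monoid" where
  "rat_tensor A = tensor_free A Mod tensor_relations A"

abbreviation tensor_class ::
  "('c, 'd) monoid_scheme \<Rightarrow> (rat \<times> 'c \<Rightarrow>\<^sub>0 int) \<Rightarrow> (rat \<times> 'c \<Rightarrow>\<^sub>0 int) set" where
  "tensor_class A t \<equiv> tensor_relations A #>\<^bsub>tensor_free A\<^esub> t"

text \<open>
  As in the library's \<^const>\<open>rcoset_mult\<close>, operations on cosets are unions over representatives;
  all the cosets united are equal.
\<close>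

definition tensor_scale ::
  "('c, 'd) monoid_scheme \<Rightarrow> rat \<Rightarrow> (rat \<times> 'c \<Rightarrow>\<^sub>0 int) set \<Rightarrow> (rat \<times> 'c \<Rightarrow>\<^sub>0 int) set" where
  "tensor_scale A q T =
     (\<Union>t\<in>T. tensor_class A (frag_extend (\<lambda>(r, a). frag_of (q * r, a)) t))"

definition coset_commutator ::
  "('a, 'b) monoid_scheme \<Rightarrow> nat \<Rightarrow> nat \<Rightarrow> 'a set \<Rightarrow> 'a set \<Rightarrow> 'a set" where
  "coset_commutator G i j A B =
     (\<Union>a\<in>A. \<Union>b\<in>B. isolator G (Suc (i + j)) #>\<^bsub>G\<^esub> commutator G a b)"

text \<open>The bilinear map with \<open>(q \<otimes> A, r \<otimes> B) \<mapsto> q r \<otimes> (A, B)\<close> from degrees \<open>i\<close>, \<open>j\<close> to \<open>i + j\<close>.\<close>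

definition homogeneous_bracket ::
  "('a, 'b) monoid_scheme \<Rightarrow> nat \<Rightarrow> nat \<Rightarrow> (rat \<times> 'a set \<Rightarrow>\<^sub>0 int) set \<Rightarrow>
    (rat \<times> 'a set \<Rightarrow>\<^sub>0 int) set \<Rightarrow> (rat \<times> 'a set \<Rightarrow>\<^sub>0 int) set" where
  "homogeneous_bracket G i j S T =
     (\<Union>s\<in>S. \<Union>t\<in>T. tensor_class (isolator_quotient G (i + j))
        (frag_extend (\<lambda>(q, A). frag_extend
           (\<lambda>(r, B). frag_of (q * r, coset_commutator G i j A B)) t) s))"

definition graded_lie_algebra ::
  "('a, 'b) monoid_scheme \<Rightarrow> (nat \<Rightarrow> (rat \<times> 'a set \<Rightarrow>\<^sub>0 int) set) rat_lie_algebra" where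
  "graded_lie_algebra G =
     (let V = (\<lambda>i. rat_tensor (isolator_quotient G i)); L = sum_group {1..} V in
      \<lparr>carrier = carrier L,
       lie_zero = \<one>\<^bsub>L\<^esub>,
       lie_add = monoid.mult L,
       lie_scale = (\<lambda>q x. \<lambda>n\<in>{1..}. tensor_scale (isolator_quotient G n) q (x n)),
       lie_bracket = (\<lambda>x y. \<lambda>n\<in>{1..}.
         finprod (V n) (\<lambda>i. homogeneous_bracket G i (n - i) (x i) (y (n - i))) {1..<n})\<rparr>)"


section \<open>The Lie algebra spanned by the logarithms\<close>

definition group_algebra :: "('a, 'b) monoid_scheme \<Rightarrow> (rat, 'a \<Rightarrow>\<^sub>0 rat) module" where
  "group_algebra G =
     \<lparr>carrier = {x. Poly_Mapping.keys x \<subseteq> carrier G},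
      monoid.mult = (\<lambda>x y. \<Sum>a\<in>Poly_Mapping.keys x. \<Sum>b\<in>Poly_Mapping.keys y.
        Poly_Mapping.single (a \<otimes>\<^bsub>G\<^esub> b) (Poly_Mapping.lookup x a * Poly_Mapping.lookup y b)),
      one = Poly_Mapping.single \<one>\<^bsub>G\<^esub> 1,
      zero = 0,
      add = (+),
      smult = (\<lambda>q. Poly_Mapping.map ((*) q))\<rparr>"

definition augmentation_ideal :: "('a, 'b) monoid_scheme \<Rightarrow> ('a \<Rightarrow>\<^sub>0 rat) set" where
  "augmentation_ideal G = {x \<in> carrier (group_algebra G).
     (\<Sum>a\<in>Poly_Mapping.keys x. Poly_Mapping.lookup x a) = 0}"

fun augmentation_power :: "('a, 'b) monoid_scheme \<Rightarrow> nat \<Rightarrow> ('a \<Rightarrow>\<^sub>0 rat) set" where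
  "augmentation_power G 0 = carrier (group_algebra G)"
| "augmentation_power G (Suc n) =
     ideal_prod (group_algebra G) (augmentation_power G n) (augmentation_ideal G)"

text \<open>
  The completion of the group algebra is the inverse limit of its quotients by the powers of the
  augmentation ideal; compatibility of a family of cosets is inclusion.  The completion of the
  augmentation ideal consists of the families with all components represented in that ideal.
\<close>

definition completed_group_algebra ::
  "('a, 'b) monoid_scheme \<Rightarrow> (rat, nat \<Rightarrow> ('a \<Rightarrow>\<^sub>0 rat) set) module" where
  "completed_group_algebra G =
     (let R = group_algebra G; Q = (\<lambda>n. R Quot augmentation_power G n) in
      \<lparr>carrier = {x. \<forall>n. x n \<in> carrier (Q n) \<and> x (Suc n) \<subseteq> x n},
       monoid.mult = (\<lambda>x y n. x n \<otimes>\<^bsub>Q n\<^esub> y n),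
       one = (\<lambda>n. \<one>\<^bsub>Q n\<^esub>),
       zero = (\<lambda>n. \<zero>\<^bsub>Q n\<^esub>),
       add = (\<lambda>x y n. x n \<oplus>\<^bsub>Q n\<^esub> y n),
       smult = (\<lambda>q x n. \<Union>a\<in>x n. augmentation_power G n +>\<^bsub>R\<^esub> (q \<odot>\<^bsub>R\<^esub> a))\<rparr>)"

definition completed_augmentation_ideal ::
  "('a, 'b) monoid_scheme \<Rightarrow> (nat \<Rightarrow> ('a \<Rightarrow>\<^sub>0 rat) set) set" where
  "completed_augmentation_ideal G = {x \<in> carrier (completed_group_algebra G).
     \<forall>n. \<exists>d\<in>augmentation_ideal G. x n = augmentation_power G n +>\<^bsub>group_algebra G\<^esub> d}"

definition log_partial_sum :: "('a, 'b) monoid_scheme \<Rightarrow> 'a \<Rightarrow> nat \<Rightarrow> ('a \<Rightarrow>\<^sub>0 rat)" where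
  "log_partial_sum G g N = (\<Sum>k=1..N. ((-1) ^ (k + 1) / of_nat k) \<odot>\<^bsub>group_algebra G\<^esub>
     ((Poly_Mapping.single g 1 - \<one>\<^bsub>group_algebra G\<^esub>) [^]\<^bsub>group_algebra G\<^esub> k))"

text \<open>
  The sum of the logarithm series is its limit for the inverse limit topology: each component of
  the partial sums is eventually constant.
\<close>

definition group_log :: "('a, 'b) monoid_scheme \<Rightarrow> 'a \<Rightarrow> (nat \<Rightarrow> ('a \<Rightarrow>\<^sub>0 rat) set)" where
  "group_log G g = (THE x. x \<in> completed_augmentation_ideal G \<and>
     (\<forall>n. eventually (\<lambda>N.
        augmentation_power G n +>\<^bsub>group_algebra G\<^esub> log_partial_sum G g N = x n) sequentially))"

inductive_set rat_span :: "(rat, 'v, 'm) module_scheme \<Rightarrow> 'v set \<Rightarrow> 'v set"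
  for M :: "(rat, 'v, 'm) module_scheme" and S :: "'v set" where
  zero: "\<zero>\<^bsub>M\<^esub> \<in> rat_span M S"
| base: "s \<in> S \<Longrightarrow> s \<in> rat_span M S"
| add: "x \<in> rat_span M S \<Longrightarrow> y \<in> rat_span M S \<Longrightarrow> x \<oplus>\<^bsub>M\<^esub> y \<in> rat_span M S"
| scale: "x \<in> rat_span M S \<Longrightarrow> q \<odot>\<^bsub>M\<^esub> x \<in> rat_span M S"

definition log_lie_algebra ::
  "('a, 'b) monoid_scheme \<Rightarrow> (nat \<Rightarrow> ('a \<Rightarrow>\<^sub>0 rat) set) rat_lie_algebra" where
  "log_lie_algebra G =
     (let M = completed_group_algebra G in
      \<lparr>carrier = rat_span M (group_log G ` carrier G),
       lie_zero = \<zero>\<^bsub>M\<^esub>,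
       lie_add = add M,
       lie_scale = smult M,
       lie_bracket = (\<lambda>x y. x \<otimes>\<^bsub>M\<^esub> y \<ominus>\<^bsub>M\<^esub> y \<otimes>\<^bsub>M\<^esub> x)\<rparr>)"

end

theory Submission
  imports Defs "HOL-Computational_Algebra.Polynomial"
begin

text \<open>
  Let \<open>G\<close> be the group of unitriangular integer \<open>4 \<times> 4\<close> matrices with equal entries at \<open>(1,2)\<close> and
  \<open>(2,3)\<close>.  It has class 3 and Hirsch length 5, and \<open>\<gamma>\<^sub>2/\<gamma>\<^sub>3\<close> is infinite cyclic, so that an
  endomorphism of \<open>G\<close> multiplies the commutator form on \<open>G/\<gamma>\<^sub>2\<close>, which has rank 2 on a lattice of rank
  3, by an integer; exchanging and killing free generators then shows that \<open>G\<close> is not relatively free.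

  The generator with entry 1 at \<open>(1,3)\<close> has degree 1, but it commutes with everything modulo \<open>\<gamma>\<^sub>3\<close>.  It
  therefore becomes central in the graded algebra, whose centre has codimension at most 3.  In the
  logarithmic algebra, on the other hand, no nonzero combination of the logarithms of the
  elements with a 1 at \<open>(1,2)\<close>, \<open>(3,4)\<close>, \<open>(2,4)\<close> or \<open>(1,3)\<close> is central, because of the relation \<open>[log a, log b] = log c\<close> whenever \<open>c = (a, b)\<close>
  commutes with \<open>a\<close> and \<open>b\<close>, and because the matrix entry \<open>(1,4)\<close> vanishes on the fourth power of the
  augmentation ideal.
\<close>

section \<open>Truncated logarithms in filtered algebras\<close>

text \<open>Making the entries (1,2) and (2,3) equal removes the commutator that would produce the
  entry (1,3): it would be e12 g * e23 h - e12 h * e23 g, which now vanishes. The (1,3) direction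
  therefore has degree 1, but it still behaves like one of second order: its commutator with the
  generator at (3,4) lies in degree 3 rather than the expected 2. The graded bracket forgets this
  commutator, the logarithms keep it.

  The centres are compared without bases or dimensions. Four elements against three linear
  conditions always give a nontrivial combination that is central on the graded side, and an
  isomorphism carries this back. On the logarithmic side the obstacle is the bracket of the first
  two generators, which would call for higher Baker-Campbell-Hausdorff terms. Each combination is
  therefore tested against a partner for which this bracket does not occur, so that the class two
  formula is enough.\<close>

lemma power_one_plus:
  fixes u :: "'a::ring_1"
  assumes "i \<le> K"
  shows "(1 + u) ^ i = (\<Sum>k\<le>K. of_nat (i choose k) * u ^ k)"
  using assms
proof (induction i)
  case 0
  have "(\<Sum>k\<le>K. of_nat (0 choose k) * u ^ k) = (\<Sum>k\<le>K. if k = 0 then 1 else 0)"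
    by (intro sum.cong) (auto simp: binomial_eq_0)
  then show ?case by simp
next
  case (Suc i)
  then obtain L where L: "K = Suc L" "i \<le> L" by (cases K) auto
  have IH: "(1 + u) ^ i = (\<Sum>k\<le>K. of_nat (i choose k) * u ^ k)" using Suc by simp
  \<comment> \<open>The last binomial coefficient vanishes because i < K; the shorter sum is the one
    that matches Pascal's rule after the index shift.\<close>
  have IH': "(1 + u) ^ i = (\<Sum>k\<le>L. of_nat (i choose k) * u ^ k)"
    using L Suc.IH Suc.prems by simp (auto simp: binomial_eq_0)
  have "(1 + u) ^ Suc i = (1 + u) ^ i + (1 + u) ^ i * u"
    by (simp add: power_Suc2 algebra_simps del: power_Suc)
  also have "(1 + u) ^ i * u = (\<Sum>k\<le>L. of_nat (i choose k) * u ^ Suc k)"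
    unfolding IH' by (simp add: sum_distrib_right power_Suc2 mult.assoc del: power_Suc)
  also have "(1 + u) ^ i = 1 + (\<Sum>k\<le>L. of_nat (i choose Suc k) * u ^ Suc k)"
    unfolding IH L by (subst sum.atMost_Suc_shift) simp
  also have "1 + (\<Sum>k\<le>L. of_nat (i choose Suc k) * u ^ Suc k) + (\<Sum>k\<le>L. of_nat (i choose k) * u ^ Suc k)
      = 1 + (\<Sum>k\<le>L. of_nat (Suc i choose Suc k) * u ^ Suc k)"
    by (simp add: sum.distrib algebra_simps)
  also have "\<dots> = (\<Sum>k\<le>K. of_nat (Suc i choose k) * u ^ k)"
    unfolding L by (subst sum.atMost_Suc_shift) simp
  finally show ?case .
qed

section \<open>Binomial coefficients as polynomials, and interpolation\<close>

fun binom_poly :: "nat \<Rightarrow> rat poly" where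
  "binom_poly 0 = 1"
| "binom_poly (Suc k) = smult (1 / of_nat (Suc k)) ([:- of_nat k, 1:] * binom_poly k)"

lemma poly_binom_poly_gbinomial: "poly (binom_poly k) x = x gchoose k"
proof (induction k)
  case (Suc k)
  have "of_nat (Suc k) * (x gchoose Suc k) = (x - of_nat k) * (x gchoose k)"
    using gbinomial_mult_1[of x k] by (simp add: algebra_simps)
  then have "x gchoose Suc k = (x - of_nat k) * (x gchoose k) / of_nat (Suc k)"
    by (simp add: field_simps del: of_nat_Suc)
  with Suc show ?case by (simp add: left_diff_distrib del: of_nat_Suc)
qed simp

lemma poly_binom_poly: "poly (binom_poly k) (of_nat i) = of_nat (i choose k)"
  by (simp add: poly_binom_poly_gbinomial binomial_gbinomial)

lemma degree_binom_poly: "degree (binom_poly k) \<le> k"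
proof (induction k)
  case (Suc k)
  have "degree ([:- of_nat k, 1:] * binom_poly k) \<le> degree [:- of_nat k, 1::rat:] + degree (binom_poly k)"
    by (rule degree_mult_le)
  with Suc show ?case by (simp del: of_nat_Suc)
qed simp

lemma coeff_0_binom_poly: "coeff (binom_poly k) 0 = (if k = 0 then 1 else 0)"
  using poly_binom_poly[of k 0] by (auto simp: poly_0_coeff_0 binomial_eq_0)

text \<open>Removing the factor x from x(x-1)...(x-k+1)/k! and setting x = 0 leaves the coefficient
  of the logarithm series. This is how log(1 + u) arises from the powers (1 + u)^i.\<close>

lemma coeff_1_binom_poly: "coeff (binom_poly k) 1 = (if k = 0 then 0 else (-1) ^ (k + 1) / of_nat k)"
proof (induction k)
  case (Suc k)
  have "coeff (binom_poly (Suc k)) 1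
     = (1 / of_nat (Suc k)) * (coeff (binom_poly k) 0 - of_nat k * coeff (binom_poly k) 1)"
    by (simp del: of_nat_Suc add: coeff_pCons)
  then show ?case unfolding Suc coeff_0_binom_poly by (auto simp del: of_nat_Suc)
qed simp

text \<open>Lagrange interpolation at \<open>0, \<dots>, N\<close> turns the linear coefficient into a combination of values.\<close>

lemma linear_coeff_from_values:
  obtains c :: "nat \<Rightarrow> rat" where
    "\<And>p. degree p \<le> N \<Longrightarrow> (\<Sum>i\<le>N. c i * poly p (of_nat i)) = coeff p 1"
proof -
  define B :: "nat \<Rightarrow> rat poly" where
    "B i = (\<Prod>j\<in>{..N} - {i}. smult (1 / (of_nat i - of_nat j)) [:- of_nat j, 1:])" for i
  have B_value: "poly (B i) (of_nat j) = (if i = j then 1 else 0)" if "i \<le> N" "j \<le> N" for i j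
  proof (cases "i = j")
    case True
    have "poly (B i) (of_nat i) = (\<Prod>j\<in>{..N} - {i}. 1)"
      unfolding B_def poly_prod poly_smult by (intro prod.cong) (auto simp: divide_eq_eq)
    with True show ?thesis by simp
  next
    case False
    then show ?thesis using that unfolding B_def poly_prod by (auto intro!: prod_zero)
  qed
  have B_degree: "degree (B i) \<le> N" if "i \<le> N" for i
  proof -
    have "degree (B i) \<le> (\<Sum>j\<in>{..N} - {i}. degree (smult (1 / (of_nat i - of_nat j)) [:- of_nat j, 1::rat:]))"
      unfolding B_def by (rule order_trans[OF degree_prod_sum_le]) (auto simp: o_def)
    also have "\<dots> \<le> (\<Sum>j\<in>{..N} - {i}. 1)" by (intro sum_mono) auto
    finally show ?thesis using that by simp
  qed
  show thesis
  proof (rule that)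
    fix p :: "rat poly" assume p: "degree p \<le> N"
    have "p = (\<Sum>i\<le>N. smult (poly p (of_nat i)) (B i))" (is "_ = ?q")
    proof (rule poly_eqI_degree)
      fix x assume "x \<in> (of_nat ` {..N} :: rat set)"
      then obtain j where j: "j \<le> N" "x = of_nat j" by auto
      have "poly ?q x = (\<Sum>i\<le>N. poly p (of_nat i) * poly (B i) (of_nat j))"
        by (simp add: poly_sum j)
      also have "\<dots> = (\<Sum>i\<le>N. if i = j then poly p (of_nat i) else 0)"
        by (intro sum.cong) (auto simp: B_value j)
      finally show "poly p x = poly ?q x" using j by simp
    next
      have card: "card (of_nat ` {..N} :: rat set) = Suc N" by (simp add: card_image inj_on_def)
      show "degree p < card (of_nat ` {..N} :: rat set)" using p card by simp
      have "degree ?q \<le> N"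
        by (intro degree_sum_le) (auto intro: order_trans[OF degree_smult_le] B_degree)
      then show "degree ?q < card (of_nat ` {..N} :: rat set)" using card by simp
    qed
    then have "coeff p 1 = coeff ?q 1" by simp
    then show "(\<Sum>i\<le>N. coeff (B i) 1 * poly p (of_nat i)) = coeff p 1"
      by (simp add: coeff_sum mult.commute)
  qed
qed

text \<open>The weights, applied in i and in j, extract the coefficient of ij. For r >= 1 the
  polynomial \<open>i * j choose r\<close> is divisible by ij, so only the constant terms of the
  other two binomials can contribute, and these vanish unless k = l = 0. The bound on k + l + r
  keeps the degrees in i and in j within the range of the interpolation.\<close>

lemma linear_coeff_monomial:
  fixes c :: "nat \<Rightarrow> rat"
  assumes c: "\<And>p. degree p \<le> N \<Longrightarrow> (\<Sum>i\<le>N. c i * poly p (of_nat i)) = coeff p 1"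
    and r: "1 \<le> r" "k + l + r \<le> N"
  shows "(\<Sum>i\<le>N. \<Sum>j\<le>N. c i * c j * (of_nat (j choose k) * of_nat (i choose l) * of_nat (i * j choose r)))
    = (if k = 0 \<and> l = 0 then (-1) ^ (r + 1) / of_nat r else 0)" (is "?S = _")
proof -
  define K :: rat where "K = (-1) ^ (r + 1) / of_nat r"
  have inner: "(\<Sum>i\<le>N. c i * (of_nat (i choose l) * of_nat (i * j choose r)))
     = (if l = 0 then of_nat j * K else 0)" for j
  proof -
    let ?q = "pcompose (binom_poly r) [:0, of_nat j:]"
    let ?p = "binom_poly l * ?q"
    have "degree ?q \<le> r * 1"
      using degree_binom_poly[of r] by (intro order_trans[OF degree_pcompose_le] mult_le_mono) auto
    then have "degree ?p \<le> N"
      using degree_binom_poly[of l] degree_mult_le[of "binom_poly l" ?q] r by linarith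
    from c[OF this] have "(\<Sum>i\<le>N. c i * poly ?p (of_nat i)) = coeff ?p 1" .
    moreover have "poly ?p (of_nat i) = of_nat (i choose l) * of_nat (i * j choose r)" for i
    proof -
      have "poly ?q (of_nat i) = poly (binom_poly r) (of_nat (i * j))" by (simp add: poly_pcompose)
      then show ?thesis by (simp only: poly_mult poly_binom_poly)
    qed
    moreover have "coeff ?q 0 = 0" "coeff ?q 1 = of_nat j * K"
      using r coeff_0_binom_poly[of r] coeff_1_binom_poly[of r] K_def
      by (auto simp: coeff_pcompose_linear poly_0_coeff_0)
    ultimately show ?thesis
      by (simp add: coeff_mult coeff_0_binom_poly)
  qed
  have "?S = (\<Sum>j\<le>N. c j * of_nat (j choose k) * (\<Sum>i\<le>N. c i * (of_nat (i choose l) * of_nat (i * j choose r))))"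
    by (subst sum.swap) (simp add: sum_distrib_left mult_ac)
  also have "\<dots> = (if l = 0 then (\<Sum>j\<le>N. c j * (of_nat (j choose k) * of_nat j)) * K else 0)"
    unfolding inner by (auto simp: sum_distrib_right mult.assoc intro!: sum.cong)
  also have "(\<Sum>j\<le>N. c j * (of_nat (j choose k) * of_nat j)) = (if k = 0 then 1 else 0)"
  proof -
    let ?p = "binom_poly k * [:0, 1:]"
    have "degree ?p \<le> N"
      using degree_binom_poly[of k] degree_mult_le[of "binom_poly k" "[:0, 1:]"] r by simp
    from c[OF this] have "(\<Sum>i\<le>N. c i * poly ?p (of_nat i)) = coeff ?p 1" .
    moreover have "coeff ?p 1 = coeff (binom_poly k) 0" by (simp add: coeff_pCons)
    ultimately show ?thesis by (simp add: poly_binom_poly coeff_0_binom_poly mult.commute cong: if_cong)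
  qed
  finally show ?thesis by (auto simp: K_def)
qed

text \<open>Scalars enter as central ring elements \<open>s q\<close>, so that a scalar multiple is
  an ordinary product. In the group algebra \<open>s q\<close> is q times the identity of the
  group.\<close>

locale rational_scalars =
  fixes s :: "rat \<Rightarrow> 'a::ring_1"
  assumes s_add: "s (x + y) = s x + s y"
    and s_mult: "s (x * y) = s x * s y"
    and s_1 [simp]: "s 1 = 1"
    and s_commute: "s x * a = a * s x"
begin

lemma s_0 [simp]: "s 0 = 0"
  using s_add[of 0 0] by simp

lemma s_of_nat [simp]: "s (of_nat n) = of_nat n"
  by (induction n) (auto simp: s_add)

lemma s_sum: "s (sum f A) = (\<Sum>x\<in>A. s (f x))"
  by (induction A rule: infinite_finite_induct) (auto simp: s_add)

lemma s_left_commute: "a * (s x * b) = s x * (a * b)"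
  by (metis mult.assoc s_commute)

lemma s_mult_left: "s x * (s y * b) = s (x * y) * b"
  by (simp add: s_mult mult.assoc)

lemma s_mult_mult: "(s x * a) * (s y * b) = s (x * y) * (a * b)"
  by (simp only: mult.assoc s_left_commute[of a] s_mult_left)

definition truncated_log :: "nat \<Rightarrow> 'a \<Rightarrow> 'a" where
  "truncated_log N x = (\<Sum>k=1..N. s ((-1) ^ (k + 1) / of_nat k) * x ^ k)"

text \<open>Expanding (1 + u)^i and exchanging the sums, the weights replace each
  \<open>i choose k\<close> by its linear coefficient. The identity is exact: both sides are the
  same polynomial in u of degree at most N.\<close>

lemma truncated_log_power_combination:
  assumes c: "\<And>p. degree p \<le> N \<Longrightarrow> (\<Sum>i\<le>N. c i * poly p (of_nat i)) = coeff p 1"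
  shows "truncated_log N u = (\<Sum>i\<le>N. s (c i) * (1 + u) ^ i)"
proof -
  have "(\<Sum>i\<le>N. s (c i) * (1 + u) ^ i) = (\<Sum>i\<le>N. s (c i) * (\<Sum>k\<le>N. of_nat (i choose k) * u ^ k))"
    by (intro sum.cong refl arg_cong2[where f = "(*)"] power_one_plus) auto
  also have "\<dots> = (\<Sum>k\<le>N. \<Sum>i\<le>N. s (c i * poly (binom_poly k) (of_nat i)) * u ^ k)"
    unfolding sum_distrib_left
    by (subst sum.swap) (simp add: poly_binom_poly s_mult mult.assoc)
  also have "\<dots> = (\<Sum>k\<le>N. s (coeff (binom_poly k) 1) * u ^ k)"
  proof (intro sum.cong refl)
    fix k assume "k \<in> {..N}"
    then have "degree (binom_poly k) \<le> N" using degree_binom_poly[of k] by simp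
    from c[OF this] show "(\<Sum>i\<le>N. s (c i * poly (binom_poly k) (of_nat i)) * u ^ k)
        = s (coeff (binom_poly k) 1) * u ^ k"
      by (simp flip: sum_distrib_right s_sum)
  qed
  also have "\<dots> = (\<Sum>k=1..N. s (coeff (binom_poly k) 1) * u ^ k)"
    by (intro sum.mono_neutral_right) (auto simp: coeff_1_binom_poly[unfolded One_nat_def] not_le)
  also have "\<dots> = truncated_log N u"
    unfolding truncated_log_def by (intro sum.cong) (auto simp: coeff_1_binom_poly[unfolded One_nat_def])
  finally show ?thesis ..
qed

end

text \<open>Each passage of one b across a^i costs c^i, and c commutes with everything involved.
  Stated for monoids because it is applied to ring elements 1 + u.\<close>

lemma class_two_power_commute:
  fixes a b c :: "'a::monoid_mult"
  assumes "a * b = b * a * c" "c * a = a * c" "c * b = b * c"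
  shows "a ^ i * b ^ j = b ^ j * a ^ i * c ^ (i * j)"
proof -
  have ca: "c ^ n * a ^ m = a ^ m * c ^ n" and cb: "c ^ n * b ^ m = b ^ m * c ^ n" for n m
    using assms by (metis power_commuting_commutes)+
  have one: "a ^ i * b = b * a ^ i * c ^ i" for i
  proof (induction i)
    case (Suc i)
    have "a ^ Suc i * b = a * (b * a ^ i * c ^ i)" by (simp add: Suc mult.assoc)
    also have "\<dots> = b * a * c * a ^ i * c ^ i" by (simp add: assms(1) flip: mult.assoc)
    also have "\<dots> = b * a * (c ^ 1 * a ^ i) * c ^ i" by (simp add: mult.assoc)
    also have "\<dots> = b * a ^ Suc i * c ^ Suc i" unfolding ca by (simp add: mult.assoc)
    finally show ?case .
  qed simp
  show ?thesis
  proof (induction j)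
    case (Suc j)
    have "a ^ i * b ^ Suc j = b ^ j * a ^ i * (c ^ (i * j) * b ^ 1)"
      using Suc by (simp add: power_Suc2 mult.assoc del: power_Suc flip: mult.assoc)
    also have "\<dots> = b ^ j * (a ^ i * b) * c ^ (i * j)" unfolding cb by (simp add: mult.assoc)
    also have "\<dots> = b ^ j * b * a ^ i * (c ^ i * c ^ (i * j))" unfolding one by (simp add: mult.assoc)
    also have "\<dots> = b ^ Suc j * a ^ i * c ^ (i * Suc j)"
      by (simp add: power_Suc2 del: power_Suc flip: power_add)
    finally show ?case .
  qed simp
qed

text \<open>Modelled on the powers of the augmentation ideal. Identities between convergent series
  are treated as congruences modulo \<open>I n\<close>.\<close>

locale filtered_rational_algebra = rational_scalars +
  fixes I :: "nat \<Rightarrow> 'a set"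
  assumes I_0: "I 0 = UNIV"
    and zero_I [simp]: "0 \<in> I n"
    and add_I: "x \<in> I n \<Longrightarrow> y \<in> I n \<Longrightarrow> x + y \<in> I n"
    and scale_I: "x \<in> I n \<Longrightarrow> s q * x \<in> I n"
    and mult_I: "x \<in> I m \<Longrightarrow> y \<in> I n \<Longrightarrow> x * y \<in> I (m + n)"
    and I_antimono: "m \<le> n \<Longrightarrow> I n \<subseteq> I m"
begin

lemma sum_I: "(\<And>x. x \<in> A \<Longrightarrow> f x \<in> I n) \<Longrightarrow> sum f A \<in> I n"
  by (induction A rule: infinite_finite_induct) (auto intro: add_I)

lemma power_I: "x \<in> I 1 \<Longrightarrow> x ^ k \<in> I k"
proof (induction k)
  case (Suc k)
  then show ?case using mult_I[of x 1 "x ^ k" k] by simp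
qed (simp add: I_0)

text \<open>
  The logarithm is the linear coefficient of the polynomial function \<open>i \<mapsto> a\<^sup>i\<close>.  As
  \<open>a\<^sup>i b\<^sup>j - b\<^sup>j a\<^sup>i = b\<^sup>j a\<^sup>i (c\<^bsup>ij\<^esup> - 1)\<close>, the commutator of the logarithms of \<open>a\<close> and \<open>b\<close> is
  the coefficient of \<open>ij\<close> on the right, that is, the logarithm of \<open>c\<close>.
\<close>

lemma truncated_log_commutator:
  assumes u: "u \<in> I 1" and v: "v \<in> I 1" and w: "w \<in> I 1"
    and "(1 + u) * (1 + v) = (1 + v) * (1 + u) * (1 + w)"
    and "w * u = u * w" "w * v = v * w"
  shows "truncated_log N u * truncated_log N v - truncated_log N v * truncated_log N u
    - truncated_log N w \<in> I (Suc N)"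
proof -
  obtain c :: "nat \<Rightarrow> rat" where
    c: "\<And>p. degree p \<le> N \<Longrightarrow> (\<Sum>i\<le>N. c i * poly p (of_nat i)) = coeff p 1"
    by (rule linear_coeff_from_values[of N]) blast
  \<comment> \<open>Bounds all exponents i * j of 1 + w, so that one index range serves every
    pair.\<close>
  let ?M = "N * N"
  \<comment> \<open>\<open>m k l r\<close> is the coefficient of v^k u^l w^r in the commutator of
    the two logarithms, \<open>h k l r\<close> the one in the logarithm of 1 + w.\<close>
  define m where "m k l r = (\<Sum>i\<le>N. \<Sum>j\<le>N. c i * c j *
    (of_nat (j choose k) * of_nat (i choose l) * of_nat (i * j choose r)))" for k l r
  define h where "h k l r = (if k = 0 \<and> l = 0 \<and> r \<le> N then (-1) ^ (r + 1) / of_nat r else 0 :: rat)"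
    for k l r :: nat
  \<comment> \<open>r starts at 1 because (1 + w)^(ij) - 1 has no constant term;
    \<open>linear_coeff_monomial\<close> relies on this.\<close>
  define T where "T = {..N} \<times> {..N} \<times> {1..?M}"
  have fin: "finite T" by (simp add: T_def)
  have difference: "(1 + u) ^ i * (1 + v) ^ j - (1 + v) ^ j * (1 + u) ^ i =
      (\<Sum>(k, l, r)\<in>T. s (of_nat (j choose k) * of_nat (i choose l) * of_nat (i * j choose r)) *
         (v ^ k * u ^ l * w ^ r))"
    if "i \<le> N" "j \<le> N" for i j
  proof -
    have "(1 + u) ^ i * (1 + v) ^ j = (1 + v) ^ j * (1 + u) ^ i * (1 + w) ^ (i * j)"
      by (rule class_two_power_commute) (use assms in \<open>auto simp: algebra_simps\<close>)
    then have "(1 + u) ^ i * (1 + v) ^ j - (1 + v) ^ j * (1 + u) ^ i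
        = (1 + v) ^ j * (1 + u) ^ i * ((1 + w) ^ (i * j) - 1)"
      by (simp add: algebra_simps)
    also have "\<dots> = (\<Sum>k\<le>N. s (of_nat (j choose k)) * v ^ k) * (\<Sum>l\<le>N. s (of_nat (i choose l)) * u ^ l) *
        (\<Sum>r=1..?M. s (of_nat (i * j choose r)) * w ^ r)"
    proof -
      have "(1 + w) ^ (i * j) = (\<Sum>r\<in>{..?M}. s (of_nat (i * j choose r)) * w ^ r)"
        using that by (simp add: power_one_plus[of "i * j" ?M] mult_le_mono)
      also have "{..?M} = insert 0 {1..?M}" by auto
      finally have "(1 + w) ^ (i * j) - 1 = (\<Sum>r=1..?M. s (of_nat (i * j choose r)) * w ^ r)" by simp
      then show ?thesis
        using that by (simp add: power_one_plus[of j N] power_one_plus[of i N])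
    qed
    also have "\<dots>
      = (\<Sum>k\<le>N. \<Sum>l\<le>N. \<Sum>r=1..?M. (s (of_nat (j choose k)) * v ^ k) *
           (s (of_nat (i choose l)) * u ^ l) * (s (of_nat (i * j choose r)) * w ^ r))"
      by (subst sum_product) (simp only: sum_distrib_right, simp only: sum_distrib_left)
    also have "\<dots> = (\<Sum>(k, l, r)\<in>T. s (of_nat (j choose k) * of_nat (i choose l) * of_nat (i * j choose r)) *
         (v ^ k * u ^ l * w ^ r))"
      unfolding T_def sum.cartesian_product[symmetric]
      by (intro sum.cong refl) (simp only: s_mult_mult)
    finally show ?thesis .
  qed
  have log_combination: "truncated_log N x = (\<Sum>i\<le>N. s (c i) * (1 + x) ^ i)" for x
    by (rule truncated_log_power_combination) (rule c)
  have "truncated_log N u * truncated_log N v - truncated_log N v * truncated_log N u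
    = (\<Sum>i\<le>N. \<Sum>j\<le>N. s (c i * c j) * ((1 + u) ^ i * (1 + v) ^ j - (1 + v) ^ j * (1 + u) ^ i))"
  proof -
    have "(\<Sum>j\<le>N. s (c j) * (1 + v) ^ j) * (\<Sum>i\<le>N. s (c i) * (1 + u) ^ i)
      = (\<Sum>i\<le>N. \<Sum>j\<le>N. s (c i * c j) * ((1 + v) ^ j * (1 + u) ^ i))"
      unfolding sum_product
      by (subst sum.swap) (simp add: s_mult_mult mult.commute)
    moreover have "(\<Sum>i\<le>N. s (c i) * (1 + u) ^ i) * (\<Sum>j\<le>N. s (c j) * (1 + v) ^ j)
      = (\<Sum>i\<le>N. \<Sum>j\<le>N. s (c i * c j) * ((1 + u) ^ i * (1 + v) ^ j))"
      unfolding sum_product by (simp add: s_mult_mult)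
    ultimately show ?thesis
      unfolding log_combination by (simp add: right_diff_distrib sum_subtractf)
  qed
  also have "\<dots> = (\<Sum>i\<le>N. \<Sum>j\<le>N. \<Sum>(k, l, r)\<in>T. s (c i * c j *
      (of_nat (j choose k) * of_nat (i choose l) * of_nat (i * j choose r))) * (v ^ k * u ^ l * w ^ r))"
    by (intro sum.cong refl) (simp add: difference sum_distrib_left s_mult_left case_prod_unfold)
  also have "\<dots> = (\<Sum>(k, l, r)\<in>T. s (m k l r) * (v ^ k * u ^ l * w ^ r))"
    unfolding m_def s_sum sum_distrib_right case_prod_unfold
    by (subst sum.swap, subst sum.swap, rule refl)
  finally have commutator: "truncated_log N u * truncated_log N v - truncated_log N v * truncated_log N u
    = (\<Sum>(k, l, r)\<in>T. s (m k l r) * (v ^ k * u ^ l * w ^ r))" .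
  have log_w: "truncated_log N w = (\<Sum>(k, l, r)\<in>T. s (h k l r) * (v ^ k * u ^ l * w ^ r))"
  proof -
    have "truncated_log N w = (\<Sum>r\<in>{1..N}. s (h 0 0 r) * (v ^ 0 * u ^ 0 * w ^ r))"
      unfolding truncated_log_def h_def by simp
    also have "\<dots> = (\<Sum>(k, l, r)\<in>(\<lambda>r. (0, 0, r)) ` {1..N}. s (h k l r) * (v ^ k * u ^ l * w ^ r))"
      by (subst sum.reindex) (auto simp: inj_on_def)
    also have "\<dots> = (\<Sum>(k, l, r)\<in>T. s (h k l r) * (v ^ k * u ^ l * w ^ r))"
      by (rule sum.mono_neutral_left[OF fin]) (auto simp: T_def h_def image_def split: if_splits intro: order_trans[OF _ le_square])
    finally show ?thesis .
  qed
  have "truncated_log N u * truncated_log N v - truncated_log N v * truncated_log N u - truncated_log N w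
    = (\<Sum>(k, l, r)\<in>T. s (m k l r - h k l r) * (v ^ k * u ^ l * w ^ r))"
  proof -
    have "s (x - y) = s x - s y" for x y using s_add[of "x - y" y] by simp
    then show ?thesis
      unfolding commutator log_w by (simp add: left_diff_distrib case_prod_unfold flip: sum_subtractf)
  qed
  \<comment> \<open>Up to total degree N the coefficients agree; a monomial of higher degree lies in
    \<open>I (Suc N)\<close> anyway.\<close>
  also have "\<dots> \<in> I (Suc N)"
  proof (rule sum_I, clarify)
    fix k l r assume "(k, l, r) \<in> T"
    then have r: "1 \<le> r" by (auto simp: T_def)
    show "s (m k l r - h k l r) * (v ^ k * u ^ l * w ^ r) \<in> I (Suc N)"
    proof (cases "k + l + r \<le> N")
      case True
      with r have "m k l r = h k l r"
        unfolding m_def h_def by (simp add: linear_coeff_monomial[OF c])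
      then show ?thesis by simp
    next
      case False
      have "v ^ k * u ^ l * w ^ r \<in> I (k + l + r)"
        by (intro mult_I power_I u v w)
      with False I_antimono[of "Suc N" "k + l + r"] show ?thesis by (intro scale_I) auto
    qed
  qed
  finally show ?thesis .
qed

end

lemma (in filtered_rational_algebra) truncated_log_I: "u \<in> I 1 \<Longrightarrow> truncated_log N u \<in> I 1"
  unfolding truncated_log_def
proof (intro sum_I scale_I)
  fix k assume "u \<in> I 1" "k \<in> {1..N}"
  then show "u ^ k \<in> I 1" using power_I[of u k] I_antimono[of 1 k] by auto
qed

text \<open>The tail contains only powers above n. This gives both the compatibility of the levels
  of a logarithm and the convergence of the series.\<close>

lemma (in filtered_rational_algebra) truncated_log_diff_I:
  assumes "u \<in> I 1" "n \<le> N"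
  shows "truncated_log N u - truncated_log n u \<in> I n"
proof -
  have "{1..N} = {1..n} \<union> {n<..N}" "{1..n} \<inter> {n<..N} = {}" using assms(2) by auto
  then have "truncated_log N u - truncated_log n u = (\<Sum>k\<in>{n<..N}. s ((-1) ^ (k + 1) / of_nat k) * u ^ k)"
    unfolding truncated_log_def by (simp add: sum.union_disjoint)
  also have "\<dots> \<in> I n"
  proof (intro sum_I scale_I)
    fix k assume "k \<in> {n<..N}"
    then show "u ^ k \<in> I n" using power_I[OF assms(1), of k] I_antimono[of n k] by auto
  qed
  finally show ?thesis .
qed

section \<open>Free groups of varieties\<close>

lemma reduced_word_Nil [simp]: "reduced_word []"
  by (simp add: reduced_word_def)

lemma reduced_word_Cons:
  "reduced_word (l # w) \<longleftrightarrow> reduced_word w \<and> (w = [] \<or> \<not> (fst l = fst (hd w) \<and> snd l \<noteq> snd (hd w)))"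
  unfolding reduced_word_def by (cases w) (auto simp: case_prod_unfold)

lemma cons_letter_reduced: "reduced_word (l # w) \<Longrightarrow> cons_letter l w = l # w"
  by (cases l; cases w) (auto simp: reduced_word_Cons)

lemma reduced_word_cons_letter: "reduced_word w \<Longrightarrow> reduced_word (cons_letter l w)"
  by (cases l; cases w) (auto simp: reduced_word_Cons split: if_splits)

text \<open>Reducedness matters when w starts with the inverse letter: the rest of w must not start
  with \<open>(x, e)\<close>, or putting the inverse letter back would cancel again.\<close>

lemma cons_letter_cancel: "reduced_word w \<Longrightarrow> cons_letter (x, \<not> e) (cons_letter (x, e) w) = w"
  by (cases w; cases "tl w") (auto simp: reduced_word_Cons)

lemma set_cons_letter: "set (cons_letter l w) \<subseteq> insert l (set w)"
  by (cases l; cases w) (auto split: if_splits)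

lemma reduced_word_foldr_cons_letter: "reduced_word v \<Longrightarrow> reduced_word (foldr cons_letter u v)"
  by (induction u) (auto intro: reduced_word_cons_letter)

lemma set_foldr_cons_letter: "set (foldr cons_letter u v) \<subseteq> set u \<union> set v"
  using set_cons_letter by (induction u) fastforce+

lemma foldr_cons_letter_Nil: "reduced_word u \<Longrightarrow> foldr cons_letter u [] = u"
  by (induction u) (auto simp: cons_letter_reduced reduced_word_Cons)

text \<open>Van der Waerden's argument for associativity: a letter and its inverse act on reduced
  words as mutually inverse maps, so a cancellation may take place before or after acting on
  t.\<close>

lemma foldr_cons_letter_cons_letter:
  assumes "reduced_word t"
  shows "foldr cons_letter (cons_letter l v) t = cons_letter l (foldr cons_letter v t)"
proof (cases l)
  case (Pair x e)
  show ?thesis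
  proof (cases "\<exists>w. v = (x, \<not> e) # w")
    case True
    then obtain w where "v = (x, \<not> e) # w" by blast
    then show ?thesis
      using cons_letter_cancel[OF reduced_word_foldr_cons_letter[OF assms], of x "\<not> e" w]
      by (simp add: Pair)
  next
    case False
    then have "cons_letter l v = l # v" by (cases v) (auto simp: Pair split: if_splits)
    then show ?thesis by simp
  qed
qed

lemma foldr_cons_letter_assoc:
  "reduced_word t \<Longrightarrow>
    foldr cons_letter (foldr cons_letter u v) t = foldr cons_letter u (foldr cons_letter v t)"
  by (induction u) (simp_all add: foldr_cons_letter_cons_letter)

lemma foldr_cons_letter_inverse:
  "reduced_word t \<Longrightarrow>
    foldr cons_letter (rev (map (\<lambda>(x, e). (x, \<not> e)) u)) (foldr cons_letter u t) = t"
proof (induction u)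
  case (Cons l u)
  then show ?case
    using cons_letter_cancel[OF reduced_word_foldr_cons_letter[OF Cons.prems], of "fst l" "snd l" u]
    by (simp add: case_prod_unfold)
qed (simp add: reduced_word_def)

lemma free_group_simps [simp]:
  "u \<in> carrier (free_group X) \<longleftrightarrow> reduced_word u \<and> fst ` set u \<subseteq> X"
  "u \<otimes>\<^bsub>free_group X\<^esub> v = foldr cons_letter u v" "\<one>\<^bsub>free_group X\<^esub> = []"
  by (simp_all add: free_group_def)

lemma group_free_group: "group (free_group X)"
proof (rule groupI)
  fix u v assume "u \<in> carrier (free_group X)" "v \<in> carrier (free_group X)"
  then show "u \<otimes>\<^bsub>free_group X\<^esub> v \<in> carrier (free_group X)"
    using set_foldr_cons_letter[of u v] by (fastforce intro: reduced_word_foldr_cons_letter)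
next
  fix u assume u: "u \<in> carrier (free_group X)"
  define v where "v = rev (map (\<lambda>(x, e). (x, \<not> e)) u)"
  have "fst ` set v = fst ` set u" by (force simp: v_def image_image case_prod_unfold)
  then have "foldr cons_letter v [] \<in> carrier (free_group X)"
    using set_foldr_cons_letter[of v "[]"] u
    by (auto intro!: reduced_word_foldr_cons_letter)
  moreover have "foldr cons_letter (foldr cons_letter v []) u = []"
    using u foldr_cons_letter_inverse[of "[]" u]
    by (simp add: foldr_cons_letter_assoc foldr_cons_letter_Nil v_def reduced_word_def)
  ultimately show "\<exists>y\<in>carrier (free_group X). y \<otimes>\<^bsub>free_group X\<^esub> u = \<one>\<^bsub>free_group X\<^esub>"
    unfolding free_group_simps(2,3) by blast
qed (auto simp: foldr_cons_letter_assoc reduced_word_def)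

section \<open>Word values, verbal subgroups and the universal property\<close>

lemma word_value_simps [simp]:
  "word_value H f [] = \<one>\<^bsub>H\<^esub>"
  "word_value H f (l # w) = (if snd l then inv\<^bsub>H\<^esub> f (fst l) else f (fst l)) \<otimes>\<^bsub>H\<^esub> word_value H f w"
  by (simp_all add: word_value_def case_prod_unfold)

lemma word_value_closed:
  "group H \<Longrightarrow> f ` fst ` set w \<subseteq> carrier H \<Longrightarrow> word_value H f w \<in> carrier H"
  by (induction w)
    (auto simp: group.inv_closed monoid.one_closed monoid.m_closed[OF group.is_monoid] group.is_monoid)

lemma word_value_cons_letter:
  assumes "group H" "f ` fst ` set (l # w) \<subseteq> carrier H"
  shows "word_value H f (cons_letter l w) = word_value H f (l # w)"
proof -
  interpret group H by fact
  have tl: "word_value H f (tl w) \<in> carrier H"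
    using assms by (cases w) (auto intro!: word_value_closed monoid.one_closed)
  with assms show ?thesis
    by (cases l; cases w) (auto simp flip: m_assoc)
qed

lemma word_value_foldr_cons_letter:
  assumes "group H" "f ` fst ` (set u \<union> set v) \<subseteq> carrier H"
  shows "word_value H f (foldr cons_letter u v) = word_value H f u \<otimes>\<^bsub>H\<^esub> word_value H f v"
  using assms(2)
proof (induction u)
  case Nil
  then show ?case using assms(1) by (simp add: group.is_monoid word_value_closed)
next
  case (Cons l u)
  interpret group H by fact
  have "f ` fst ` set (foldr cons_letter u v) \<subseteq> carrier H"
    using Cons.prems set_foldr_cons_letter[of u v] by fastforce
  then show ?case
    using Cons word_value_closed[OF assms(1), of f u] word_value_closed[OF assms(1), of f v]
    by (auto simp: word_value_cons_letter[OF assms(1)] m_assoc image_Un)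
qed

lemma word_value_hom:
  "group H \<Longrightarrow> f ` X \<subseteq> carrier H \<Longrightarrow> word_value H f \<in> hom (free_group X) H"
  by (rule homI) (force intro!: word_value_closed word_value_foldr_cons_letter)+

lemma hom_word_value:
  assumes "group H" "group K" "\<phi> \<in> hom H K" "f ` fst ` set w \<subseteq> carrier H"
  shows "\<phi> (word_value H f w) = word_value K (\<phi> \<circ> f) w"
proof -
  interpret group_hom H K \<phi> using assms by (simp add: group_hom_def group_hom_axioms_def)
  show ?thesis
    using assms(4)
    by (induction w) (auto simp: word_value_closed[OF assms(1)])
qed

lemma conjugation_hom:
  assumes "group H" "g \<in> carrier H"
  shows "(\<lambda>h. g \<otimes>\<^bsub>H\<^esub> h \<otimes>\<^bsub>H\<^esub> inv\<^bsub>H\<^esub> g) \<in> hom H H"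
proof -
  interpret group H by fact
  show ?thesis
  proof (rule homI)
    fix x y assume xy: "x \<in> carrier H" "y \<in> carrier H"
    have "g \<otimes>\<^bsub>H\<^esub> x \<otimes>\<^bsub>H\<^esub> inv\<^bsub>H\<^esub> g \<otimes>\<^bsub>H\<^esub> (g \<otimes>\<^bsub>H\<^esub> y \<otimes>\<^bsub>H\<^esub> inv\<^bsub>H\<^esub> g)
       = g \<otimes>\<^bsub>H\<^esub> x \<otimes>\<^bsub>H\<^esub> (inv\<^bsub>H\<^esub> g \<otimes>\<^bsub>H\<^esub> g) \<otimes>\<^bsub>H\<^esub> y \<otimes>\<^bsub>H\<^esub> inv\<^bsub>H\<^esub> g"
      using xy assms by (simp only: m_assoc m_closed inv_closed)
    then show "g \<otimes>\<^bsub>H\<^esub> (x \<otimes>\<^bsub>H\<^esub> y) \<otimes>\<^bsub>H\<^esub> inv\<^bsub>H\<^esub> g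
       = g \<otimes>\<^bsub>H\<^esub> x \<otimes>\<^bsub>H\<^esub> inv\<^bsub>H\<^esub> g \<otimes>\<^bsub>H\<^esub> (g \<otimes>\<^bsub>H\<^esub> y \<otimes>\<^bsub>H\<^esub> inv\<^bsub>H\<^esub> g)"
      using xy assms by (simp add: m_assoc)
  qed (use assms in auto)
qed

text \<open>Conjugation is an endomorphism, hence takes the value of a word to its value at the
  conjugated arguments; the generating set is closed under conjugation.\<close>

lemma normal_verbal_subgroup:
  assumes "group H"
  shows "verbal_subgroup W H \<lhd> H"
proof -
  interpret group H by fact
  show ?thesis
    unfolding verbal_subgroup_def
  proof (rule normal_generateI)
    show "{word_value H f w |f w. w \<in> W \<and> f \<in> UNIV \<rightarrow> carrier H} \<subseteq> carrier H"
      by (auto intro!: word_value_closed[OF assms])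
  next
    fix h g assume "h \<in> {word_value H f w |f w. w \<in> W \<and> f \<in> UNIV \<rightarrow> carrier H}" and g: "g \<in> carrier H"
    then obtain f w where w: "w \<in> W" "f \<in> UNIV \<rightarrow> carrier H" "h = word_value H f w" by blast
    then have "g \<otimes>\<^bsub>H\<^esub> h \<otimes>\<^bsub>H\<^esub> inv\<^bsub>H\<^esub> g
        = word_value H ((\<lambda>h. g \<otimes>\<^bsub>H\<^esub> h \<otimes>\<^bsub>H\<^esub> inv\<^bsub>H\<^esub> g) \<circ> f) w"
      by (subst hom_word_value[OF assms assms conjugation_hom[OF assms g], symmetric]) auto
    moreover have "(\<lambda>h. g \<otimes>\<^bsub>H\<^esub> h \<otimes>\<^bsub>H\<^esub> inv\<^bsub>H\<^esub> g) \<circ> f \<in> UNIV \<rightarrow> carrier H"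
      using w g by (simp add: Pi_iff)
    ultimately show "g \<otimes>\<^bsub>H\<^esub> h \<otimes>\<^bsub>H\<^esub> inv\<^bsub>H\<^esub> g \<in> {word_value H f w |f w. w \<in> W \<and> f \<in> UNIV \<rightarrow> carrier H}"
      using w by blast
  qed
qed

lemma word_value_generators:
  assumes "reduced_word w" "fst ` set w \<subseteq> X"
  shows "word_value (free_group X) (\<lambda>x. [(x, False)]) w = w"
proof -
  interpret group "free_group X" by (rule group_free_group)
  have inv: "inv\<^bsub>free_group X\<^esub> [(x, False)] = [(x, True)]" if "x \<in> X" for x
    by (rule inv_equality) (use that in \<open>auto simp: reduced_word_def\<close>)
  show ?thesis
    using assms by (induction w) (auto simp: inv reduced_word_Cons cons_letter_reduced split: prod.splits)
qed

lemma generate_word_value: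
  assumes "group H" "f ` X \<subseteq> carrier H" "fst ` set w \<subseteq> X"
  shows "word_value H f w \<in> generate H (f ` X)"
  using assms(3) by (induction w) (auto intro: generate.intros)

text \<open>Isolates what the refutation uses of relative freeness: a generating family whose
  members may be sent anywhere by an endomorphism. A family y instead of a subset of G allows for
  generators that coincide in the quotient.\<close>

lemma relatively_free_universal:
  fixes G :: "('a, 'b) monoid_scheme"
  assumes G: "group G" and free: "relatively_free G"
  obtains X :: "'a set" and y where "y \<in> X \<rightarrow> carrier G" "generate G (y ` X) = carrier G"
    "\<And>f. f \<in> X \<rightarrow> carrier G \<Longrightarrow> \<exists>\<phi>\<in>hom G G. \<forall>x\<in>X. \<phi> (y x) = f x"
proof -
  obtain W and X :: "'a set" where "G \<cong> variety_free_group W X"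
    using free unfolding relatively_free_def by blast
  then obtain h where h: "h \<in> iso G (variety_free_group W X)" by (auto simp: is_iso_def)
  define F where "F = free_group X"
  define V where "V = verbal_subgroup W F"
  define K where "K = F Mod V"
  define \<pi> where "\<pi> u = V #>\<^bsub>F\<^esub> u" for u
  define i where "i x = [(x, False)]" for x :: 'a
  interpret F: group F unfolding F_def by (rule group_free_group)
  interpret V: normal V F unfolding V_def by (rule normal_verbal_subgroup[OF F.is_group])
  interpret K: group K unfolding K_def by (rule V.factorgroup_is_group)
  interpret G: group G by fact
  have \<pi>_hom: "\<pi> \<in> hom F K" unfolding K_def \<pi>_def by (rule V.r_coset_hom_Mod)
  have K_carrier: "carrier K = \<pi> ` carrier F" unfolding K_def \<pi>_def by (rule carrier_FactGroup)
  have i: "i ` X \<subseteq> carrier F" by (auto simp: F_def i_def reduced_word_def)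
  have \<pi>_i: "\<pi> (i x) \<in> carrier K" if "x \<in> X" for x using i that K_carrier by blast
  have \<pi>_word: "\<pi> w = word_value K (\<pi> \<circ> i) w" if "w \<in> carrier F" for w
  proof -
    have "w = word_value F i w"
      using that word_value_generators[of w X] unfolding F_def i_def by simp
    then have "\<pi> w = \<pi> (word_value F i w)" by simp
    also have "\<dots> = word_value K (\<pi> \<circ> i) w"
      by (rule hom_word_value[OF F.is_group K.is_group \<pi>_hom]) (use that i in \<open>auto simp: F_def\<close>)
    finally show ?thesis .
  qed
  have endo: "\<exists>\<psi>\<in>hom K K. \<forall>x\<in>X. \<psi> (\<pi> (i x)) = f x" if f: "f \<in> X \<rightarrow> carrier K" for f
  proof -
    let ?\<Phi> = "word_value K f"
    have \<Phi>: "?\<Phi> \<in> hom F K" unfolding F_def by (rule word_value_hom) (use f K.is_group in auto)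
    interpret \<Phi>: group_hom F K ?\<Phi> using \<Phi> by unfold_locales
    have "V \<subseteq> kernel F K ?\<Phi>"
      unfolding V_def verbal_subgroup_def
    proof (rule F.generate_subgroup_incl[OF _ \<Phi>.subgroup_kernel], safe)
      fix w and g :: "nat \<Rightarrow> ('a \<times> bool) list" assume w: "w \<in> W" and g: "g \<in> UNIV \<rightarrow> carrier F"
      \<comment> \<open>The quotient K satisfies the laws in W: elements of K are lifted along
        \<open>\<pi>\<close> to F, where the word takes a value in V, and V becomes trivial in
        K.\<close>
      have "\<exists>r. r \<in> carrier F \<and> \<pi> r = ?\<Phi> (g n)" for n :: nat
        using hom_in_carrier[OF \<Phi>, of "g n"] g K_carrier by (auto simp: Pi_iff)
      then obtain r :: "nat \<Rightarrow> ('a \<times> bool) list" where r: "\<And>n. r n \<in> carrier F" "\<And>n. \<pi> (r n) = ?\<Phi> (g n)" by metis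
      have rw: "word_value F r w \<in> V"
        unfolding V_def verbal_subgroup_def using r w by (blast intro: generate.incl)
      have "?\<Phi> (word_value F g w) = word_value K (?\<Phi> \<circ> g) w"
        by (rule hom_word_value[OF F.is_group K.is_group \<Phi>]) (use g in auto)
      also have "?\<Phi> \<circ> g = \<pi> \<circ> r" using r by auto
      also have "word_value K (\<pi> \<circ> r) w = \<pi> (word_value F r w)"
        by (rule hom_word_value[OF F.is_group K.is_group \<pi>_hom, symmetric]) (use r in auto)
      also have "\<dots> = \<one>\<^bsub>K\<^esub>" using rw by (simp add: \<pi>_def K_def V.rcos_const)
      finally show "word_value F g w \<in> kernel F K ?\<Phi>"
        using g by (auto simp: kernel_def intro!: word_value_closed[OF F.is_group])
    qed
    then obtain \<psi> where "\<psi> \<in> hom (F Mod V) K" "\<And>u. u \<in> carrier F \<Longrightarrow> \<psi> (V #>\<^bsub>F\<^esub> u) = ?\<Phi> u"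
      using \<Phi>.FactGroup_universal_kernel[OF V.normal_axioms] by metis
    moreover have "?\<Phi> (i x) = f x" if "x \<in> X" for x
      using f that by (simp add: i_def Pi_iff)
    ultimately show ?thesis using i unfolding K_def \<pi>_def by (metis image_subset_iff)
  qed
  have h': "h \<in> iso G K" using h by (simp add: variety_free_group_def K_def F_def V_def)
  define k where "k = inv_into (carrier G) h"
  have k: "k \<in> iso K G" unfolding k_def by (rule G.iso_set_sym[OF h'])
  have kh: "k (h g) = g" if "g \<in> carrier G" for g
    using h' that unfolding k_def by (auto simp: iso_def bij_betw_def)
  have hk: "h (k g) = g" if "g \<in> carrier K" for g
    using h' that unfolding k_def iso_def bij_betw_def by (auto simp: f_inv_into_f)
  have k_hom: "k \<in> hom K G" and h_hom: "h \<in> hom G K" using k h' by (auto simp: iso_def)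
  interpret k: group_hom K G k using k_hom by unfold_locales
  show thesis
  proof (rule that)
    show y: "k \<circ> (\<pi> \<circ> i) \<in> X \<rightarrow> carrier G" using \<pi>_i hom_in_carrier[OF k_hom] by auto
    have "generate K ((\<pi> \<circ> i) ` X) = carrier K"
    proof
      show "generate K ((\<pi> \<circ> i) ` X) \<subseteq> carrier K"
        by (rule K.generate_incl) (use \<pi>_i in auto)
      show "carrier K \<subseteq> generate K ((\<pi> \<circ> i) ` X)"
        unfolding K_carrier
      proof safe
        fix w assume "w \<in> carrier F"
        then show "\<pi> w \<in> generate K ((\<pi> \<circ> i) ` X)"
          unfolding \<pi>_word[OF \<open>w \<in> carrier F\<close>]
          by (intro generate_word_value) (use \<pi>_i K.is_group in \<open>auto simp: F_def\<close>)
      qed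
    qed
    moreover have "k ` generate K ((\<pi> \<circ> i) ` X) = generate G (k ` (\<pi> \<circ> i) ` X)"
      by (rule k.generate_img[symmetric]) (use \<pi>_i in auto)
    moreover have "k ` carrier K = carrier G" using k by (auto simp: iso_def bij_betw_def)
    ultimately show "generate G ((k \<circ> (\<pi> \<circ> i)) ` X) = carrier G" by (simp add: image_comp)
  next
    fix f assume f: "f \<in> X \<rightarrow> carrier G"
    then have "h \<circ> f \<in> X \<rightarrow> carrier K" using hom_in_carrier[OF h_hom] by (simp add: Pi_iff)
    from endo[OF this] obtain \<psi> where \<psi>: "\<psi> \<in> hom K K" "\<And>x. x \<in> X \<Longrightarrow> \<psi> (\<pi> (i x)) = h (f x)" by auto
    have "k \<circ> (\<psi> \<circ> h) \<in> hom G G" using \<psi>(1) k_hom h_hom by (metis hom_compose)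
    moreover have "(k \<circ> (\<psi> \<circ> h)) ((k \<circ> (\<pi> \<circ> i)) x) = f x" if "x \<in> X" for x
      using that f by (simp add: hk[OF \<pi>_i] \<psi>(2) kh Pi_iff)
    ultimately show "\<exists>\<phi>\<in>hom G G. \<forall>x\<in>X. \<phi> ((k \<circ> (\<pi> \<circ> i)) x) = f x" by blast
  qed
qed

section \<open>A group of unitriangular matrices\<close>

text \<open>
  \<open>UT p q u v w\<close> is the unitriangular matrix with rows \<open>(1, p, q, w)\<close>, \<open>(0, 1, p, v)\<close>,
  \<open>(0, 0, 1, u)\<close>, \<open>(0, 0, 0, 1)\<close>; the addition is the matrix product.
\<close>

datatype ut = UT (e12: int) (e13: int) (e34: int) (e24: int) (e14: int)

text \<open>A nonabelian group in additive notation: the convolution product of finitely supported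
  functions is indexed by an additive monoid, so that \<open>ut \<Rightarrow>\<^sub>0 rat\<close> is
  the rational group algebra as a ring type.\<close>

instantiation ut :: group_add
begin

definition zero_ut :: ut where "0 = UT 0 0 0 0 0"

definition plus_ut :: "ut \<Rightarrow> ut \<Rightarrow> ut" where
  "g + h = UT (e12 g + e12 h) (e13 g + e13 h + e12 g * e12 h) (e34 g + e34 h)
     (e24 g + e24 h + e12 g * e34 h) (e14 g + e14 h + e12 g * e24 h + e13 g * e34 h)"

definition uminus_ut :: "ut \<Rightarrow> ut" where
  "- g = UT (- e12 g) (e12 g * e12 g - e13 g) (- e34 g) (e12 g * e34 g - e24 g)
     (e13 g * e34 g - e12 g * (e12 g * e34 g - e24 g) - e14 g)"

definition minus_ut :: "ut \<Rightarrow> ut \<Rightarrow> ut" where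
  "g - h = g + - (h :: ut)"

instance
  by standard (simp_all add: zero_ut_def plus_ut_def uminus_ut_def minus_ut_def algebra_simps)

end

instance ut :: countable
  by countable_datatype

lemma ut_coordinates [simp]:
  "e12 (g + h) = e12 g + e12 h" "e34 (g + h) = e34 g + e34 h"
  "e13 (g + h) = e13 g + e13 h + e12 g * e12 h"
  "e24 (g + h) = e24 g + e24 h + e12 g * e34 h"
  "e14 (g + h) = e14 g + e14 h + e12 g * e24 h + e13 g * e34 h"
  "e12 0 = 0" "e34 0 = 0" "e13 0 = 0" "e24 0 = 0" "e14 0 = 0"
  "e12 (- g) = - e12 g" "e34 (- g) = - e34 g" "e13 (- g) = e12 g * e12 g - e13 g"
  "e24 (- g) = e12 g * e34 g - e24 g"
  "e14 (- g) = e13 g * e34 g - e12 g * (e12 g * e34 g - e24 g) - e14 g"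
  by (simp_all add: zero_ut_def plus_ut_def uminus_ut_def)

lemma ut_minus_coordinates [simp]:
  "e12 (g - h) = e12 g - e12 h" "e34 (g - h) = e34 g - e34 h"
  "e13 (g - h) = e13 g + (e12 h * e12 h - e13 h) - e12 g * e12 h"
  "e24 (g - h) = e24 g + (e12 h * e34 h - e24 h) - e12 g * e34 h"
  "e14 (g - h) = e14 g + (e13 h * e34 h - e12 h * (e12 h * e34 h - e24 h) - e14 h)
     + e12 g * (e12 h * e34 h - e24 h) - e13 g * e34 h"
  by (simp_all add: minus_ut_def del: add_uminus_conv_diff)

lemma infinite_UNIV_ut: "infinite (UNIV :: ut set)"
proof -
  have "inj (\<lambda>n. UT n 0 0 0 0)" by (auto simp: inj_def)
  then show ?thesis using infinite_UNIV_int
    by (metis finite_imageD finite_subset subset_UNIV)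
qed

text \<open>The group of the theorem has natural numbers as elements. The matrix group is
  transported along this bijection, and calculations return to \<open>ut\<close> through
  \<open>dec\<close>.\<close>

definition enc :: "ut \<Rightarrow> nat" where "enc = to_nat_on UNIV"
definition dec :: "nat \<Rightarrow> ut" where "dec = from_nat_into UNIV"

lemma dec_enc [simp]: "dec (enc g) = g" and enc_dec [simp]: "enc (dec n) = n"
  by (simp_all add: enc_def dec_def infinite_UNIV_ut)

lemma enc_eq_iff [simp]: "enc g = enc h \<longleftrightarrow> g = h"
  by (metis dec_enc)

lemma dec_eq_iff [simp]: "dec m = dec n \<longleftrightarrow> m = n"
  by (metis enc_dec)

lemma inj_enc: "inj enc" by (simp add: inj_def)

definition UG :: "nat monoid" where
  "UG = \<lparr>carrier = UNIV, monoid.mult = (\<lambda>m n. enc (dec m + dec n)), one = enc 0\<rparr>"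

lemma UG_simps [simp]:
  "carrier UG = UNIV" "m \<otimes>\<^bsub>UG\<^esub> n = enc (dec m + dec n)" "\<one>\<^bsub>UG\<^esub> = enc 0"
  by (simp_all add: UG_def)

lemma group_UG: "group UG"
proof (rule groupI)
  fix x show "\<exists>y\<in>carrier UG. y \<otimes>\<^bsub>UG\<^esub> x = \<one>\<^bsub>UG\<^esub>"
    by (rule bexI[of _ "enc (- dec x)"]) auto
qed (auto simp: add.assoc)

interpretation UG: group UG by (rule group_UG)

lemma inv_UG [simp]: "inv\<^bsub>UG\<^esub> n = enc (- dec n)"
  by (rule UG.inv_equality) auto

lemma commutator_UG [simp]: "commutator UG m n = enc (- dec m + - dec n + dec m + dec n)"
  by (simp add: commutator_def)

text \<open>Under the stated conditions the mixed products in the group law drop out; otherwise the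
  entries acquire terms that are not linear in n.\<close>

lemma pow_UG_coordinates:
  "e12 (dec (x [^]\<^bsub>UG\<^esub> n)) = int n * e12 (dec x)"
  "e34 (dec (x [^]\<^bsub>UG\<^esub> n)) = int n * e34 (dec x)"
  "e12 (dec x) = 0 \<Longrightarrow> e13 (dec (x [^]\<^bsub>UG\<^esub> n)) = int n * e13 (dec x)"
  "e12 (dec x) = 0 \<Longrightarrow> e24 (dec (x [^]\<^bsub>UG\<^esub> n)) = int n * e24 (dec x)"
  "e12 (dec x) = 0 \<Longrightarrow> e13 (dec x) = 0 \<Longrightarrow> e14 (dec (x [^]\<^bsub>UG\<^esub> n)) = int n * e14 (dec x)"
proof -
  show 1: "e12 (dec (x [^]\<^bsub>UG\<^esub> n)) = int n * e12 (dec x)" for n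
    by (induction n) (auto simp: algebra_simps)
  show "e34 (dec (x [^]\<^bsub>UG\<^esub> n)) = int n * e34 (dec x)"
    by (induction n) (auto simp: algebra_simps)
  show 2: "e12 (dec x) = 0 \<Longrightarrow> e13 (dec (x [^]\<^bsub>UG\<^esub> n)) = int n * e13 (dec x)" for n
    by (induction n) (auto simp: algebra_simps)
  show "e12 (dec x) = 0 \<Longrightarrow> e24 (dec (x [^]\<^bsub>UG\<^esub> n)) = int n * e24 (dec x)"
    by (induction n) (auto simp: algebra_simps 1)
  show "e12 (dec x) = 0 \<Longrightarrow> e13 (dec x) = 0 \<Longrightarrow> e14 (dec (x [^]\<^bsub>UG\<^esub> n)) = int n * e14 (dec x)"
    by (induction n) (auto simp: algebra_simps 1 2)
qed

section \<open>Lower central series and isolators\<close>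

definition ut_series :: "nat \<Rightarrow> ut set" where
  "ut_series i = {g. (2 \<le> i \<longrightarrow> e12 g = 0 \<and> e13 g = 0 \<and> e34 g = 0) \<and>
     (3 \<le> i \<longrightarrow> e24 g = 0) \<and> (4 \<le> i \<longrightarrow> e14 g = 0)}"

lemma enc_in_image_iff [simp]: "n \<in> enc ` A \<longleftrightarrow> dec n \<in> A"
  by (metis dec_enc enc_dec image_iff)

lemma subgroup_ut_series: "subgroup (enc ` ut_series i) UG"
  by unfold_locales (auto simp: ut_series_def)

lemma normal_ut_series: "enc ` ut_series i \<lhd> UG"
  unfolding UG.normal_inv_iff using subgroup_ut_series
  by (auto simp: ut_series_def algebra_simps)

lemma ut_series_antimono: "i \<le> j \<Longrightarrow> ut_series j \<subseteq> ut_series i"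
  by (auto simp: ut_series_def)

lemma ut_series_4: "4 \<le> i \<Longrightarrow> ut_series i = {0}"
  by (auto simp: ut_series_def intro: ut.expand)

text \<open>Every element of the next term is a single commutator, so the set of commutators is
  already a subgroup and generation adds nothing.\<close>

lemma commutators_ut_series:
  assumes "1 \<le> i"
  shows "{commutator UG a b | a b. a \<in> enc ` ut_series i \<and> b \<in> carrier UG} = enc ` ut_series (Suc i)"
    (is "?C = _")
proof (intro Set.set_eqI iffI)
  fix n assume "n \<in> ?C"
  then show "n \<in> enc ` ut_series (Suc i)"
    using assms by (auto simp: ut_series_def algebra_simps)
next
  fix n assume n: "n \<in> enc ` ut_series (Suc i)"
  have "\<exists>a b. n = commutator UG (enc a) (enc b) \<and> a \<in> ut_series i"
  proof (cases "i = 1")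
    case True
    \<comment> \<open>The commutator of \<open>UT 1 0 0 0 0\<close> with \<open>UT 0 0 u v 0\<close>
      has entry u at (2,4) and v - u at (1,4); these are solved for u and v.\<close>
    with n have "n = commutator UG (enc (UT 1 0 0 0 0)) (enc (UT 0 0 (e24 (dec n)) (e14 (dec n) + e24 (dec n)) 0))"
      by (intro dec_eq_iff[THEN iffD1] ut.expand) (auto simp: ut_series_def)
    then show ?thesis using True by (force simp: ut_series_def)
  next
    case False
    show ?thesis
    proof (cases "i = 2")
      case True
      with n have "n = commutator UG (enc (UT 0 0 0 1 0)) (enc (UT (- e14 (dec n)) 0 0 0 0))"
        by (intro dec_eq_iff[THEN iffD1] ut.expand) (auto simp: ut_series_def)
      then show ?thesis using True by (force simp: ut_series_def)
    next
      case False
      with \<open>i \<noteq> 1\<close> assms n have "n = enc 0"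
        by (intro dec_eq_iff[THEN iffD1]) (simp add: ut_series_4)
      then show ?thesis by (intro exI[of _ 0]) (simp add: ut_series_def)
    qed
  qed
  then obtain a b where "n = commutator UG (enc a) (enc b)" "a \<in> ut_series i" by blast
  then show "n \<in> ?C" by (intro CollectI exI[of _ "enc a"] exI[of _ "enc b"] conjI) simp_all
qed

lemma generate_subgroup_self: "group G \<Longrightarrow> subgroup H G \<Longrightarrow> generate G H = H"
  by (meson generate.incl group.generate_subgroup_incl order_refl subsetI subset_antisym)

lemma lower_central_UG: "lower_central UG i = enc ` ut_series i"
proof (induction i rule: less_induct)
  case (less i)
  consider "i = 0" | "i = 1" | j where "i = Suc (Suc j)"
    by (metis One_nat_def not0_implies_Suc)
  then show ?case
  proof cases
    case 3
    with less have "lower_central UG (Suc j) = enc ` ut_series (Suc j)" by simp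
    with commutators_ut_series[of "Suc j"] 3 show ?thesis
      by (simp add: generate_subgroup_self group_UG subgroup_ut_series)
  qed (auto simp: ut_series_def)
qed

text \<open>Taking a power multiplies the coordinates of the i-th factor by m. For i = 1 the entry
  e12 has to be cleared before e13, which is additive only afterwards. The lemma serves twice: for
  torsion-free factors and for identifying the isolators.\<close>

lemma pow_mem_ut_series:
  fixes m :: nat
  assumes "1 \<le> i" "1 \<le> m" "x [^]\<^bsub>UG\<^esub> m \<in> enc ` ut_series (Suc i)" "x \<in> enc ` ut_series i"
  shows "x \<in> enc ` ut_series (Suc i)"
proof -
  have root: "int m * k = 0 \<Longrightarrow> k = 0" for k using assms(2) by simp
  define g where "g = dec x"
  define h where "h = dec (x [^]\<^bsub>UG\<^esub> m)"
  have gh: "h \<in> ut_series (Suc i)" "g \<in> ut_series i"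
    using assms(3,4) by (simp_all add: g_def h_def)
  have pow: "e12 h = int m * e12 g" "e34 h = int m * e34 g"
    "e12 g = 0 \<Longrightarrow> e13 h = int m * e13 g" "e12 g = 0 \<Longrightarrow> e24 h = int m * e24 g"
    "e12 g = 0 \<Longrightarrow> e13 g = 0 \<Longrightarrow> e14 h = int m * e14 g"
    unfolding g_def h_def by (fact pow_UG_coordinates)+
  consider "i = 1" | "i = 2" | "i = 3" | "4 \<le> i" using assms(1) by linarith
  then have "g \<in> ut_series (Suc i)"
  proof cases
    case 1
    with gh have "e12 h = 0" "e13 h = 0" "e34 h = 0" by (auto simp: ut_series_def)
    with pow root have "e12 g = 0" "e13 g = 0" "e34 g = 0" by metis+
    with 1 show ?thesis by (simp add: ut_series_def)
  next
    case 2
    with gh have "e24 h = 0" "e12 g = 0" "e13 g = 0" "e34 g = 0" by (auto simp: ut_series_def)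
    with 2 pow(4) root show ?thesis by (simp add: ut_series_def)
  next
    case 3
    with gh have "e14 h = 0" "e12 g = 0" "e13 g = 0" "e34 g = 0" "e24 g = 0" by (auto simp: ut_series_def)
    with 3 pow(5) root show ?thesis by (simp add: ut_series_def)
  qed (use gh in \<open>simp add: ut_series_4\<close>)
  then show ?thesis by (simp add: g_def)
qed

lemma isolator_UG_iff:
  "x \<in> isolator UG i \<longleftrightarrow> (\<exists>m::nat. m \<ge> 1 \<and> x [^]\<^bsub>UG\<^esub> m \<in> enc ` ut_series i)"
  unfolding isolator_def lower_central_UG UG_simps by blast

lemma ut_series_subset_isolator: "enc ` ut_series i \<subseteq> isolator UG i"
proof
  fix x assume "x \<in> enc ` ut_series i"
  then have "x [^]\<^bsub>UG\<^esub> (1::nat) \<in> enc ` ut_series i" 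
    by (simp only: One_nat_def UG.nat_pow_Suc UG.nat_pow_0 UG.l_one UG_simps dec_enc enc_dec add_0)
  then show "x \<in> isolator UG i" unfolding isolator_UG_iff by blast
qed

text \<open>An element with a power in term i + 1 also has one in term i, so it lies in term i by
  induction; there \<open>pow_mem_ut_series\<close> applies.\<close>

lemma isolator_UG: "1 \<le> i \<Longrightarrow> isolator UG i = enc ` ut_series i"
proof (induction i rule: dec_induct)
  case base
  have "enc ` ut_series 1 = UNIV" by (auto simp: ut_series_def)
  then show ?case using ut_series_subset_isolator[of 1] by (simp only: top_unique)
next
  case (step i)
  have "x \<in> enc ` ut_series (Suc i)" if "x \<in> isolator UG (Suc i)" for x
  proof -
    from that obtain m :: nat where m: "1 \<le> m" "x [^]\<^bsub>UG\<^esub> m \<in> enc ` ut_series (Suc i)"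
      unfolding isolator_UG_iff by blast
    moreover have "enc ` ut_series (Suc i) \<subseteq> enc ` ut_series i"
      by (intro image_mono ut_series_antimono) simp
    ultimately have "x \<in> isolator UG i" unfolding isolator_UG_iff by blast
    then show ?thesis
      using pow_mem_ut_series[OF step(1) m] unfolding step.IH by blast
  qed
  with ut_series_subset_isolator[of "Suc i"] show ?case by blast
qed

lemma torsion_free_FactGroup:
  assumes "N \<lhd> G"
    and root: "\<And>x m. x \<in> carrier G \<Longrightarrow> 1 \<le> (m::nat) \<Longrightarrow> x [^]\<^bsub>G\<^esub> m \<in> N \<Longrightarrow> x \<in> N"
  shows "torsion_free_group (G Mod N)"
proof -
  interpret N: normal N G by fact
  show ?thesis
    unfolding torsion_free_group_def
  proof (intro ballI allI impI)
    fix X m assume "X \<in> carrier (G Mod N)" and m: "1 \<le> (m::nat)" "X [^]\<^bsub>G Mod N\<^esub> m = \<one>\<^bsub>G Mod N\<^esub>"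
    then obtain x where x: "x \<in> carrier G" "X = N #>\<^bsub>G\<^esub> x" by (auto simp: carrier_FactGroup)
    with m have "N #>\<^bsub>G\<^esub> (x [^]\<^bsub>G\<^esub> m) = N" by (simp add: N.FactGroup_pow)
    then have "x [^]\<^bsub>G\<^esub> m \<in> N"
      using x N.rcos_self[OF N.nat_pow_closed N.subgroup_axioms, of x m] by simp
    then have "x \<in> N" by (rule root[OF x(1) m(1)])
    then show "X = \<one>\<^bsub>G Mod N\<^esub>"
      unfolding x(2) one_FactGroup by (rule N.rcos_const[OF N.is_group])
  qed
qed

lemma normal_ut_series_Suc: "enc ` ut_series (Suc n) \<lhd> UG\<lparr>carrier := enc ` ut_series n\<rparr>"
  by (rule UG.normal_restrict_supergroup[OF subgroup_ut_series normal_ut_series])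
    (rule image_mono, rule ut_series_antimono, simp)

lemma Magnus_UG: "Magnus_group UG"
  unfolding Magnus_group_def lower_central_UG
proof (intro conjI allI impI)
  fix i :: nat assume i: "1 \<le> i"
  let ?K = "UG\<lparr>carrier := enc ` ut_series i\<rparr>"
  have "x \<in> enc ` ut_series (Suc i)"
    if "x \<in> carrier ?K" "1 \<le> m" "x [^]\<^bsub>?K\<^esub> m \<in> enc ` ut_series (Suc i)" for x and m :: nat
  proof (rule pow_mem_ut_series[OF i that(2)])
    show "x [^]\<^bsub>UG\<^esub> m \<in> enc ` ut_series (Suc i)"
      using that(3) by (simp only: UG.nat_pow_consistent[symmetric])
    show "x \<in> enc ` ut_series i" using that(1) by simp
  qed
  then show "torsion_free_group (?K Mod enc ` ut_series (Suc i))"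
    by (rule torsion_free_FactGroup[OF normal_ut_series_Suc])
next
  have "enc ` ut_series 4 \<subseteq> enc ` ut_series i" for i
    by (rule image_mono) (auto simp: ut_series_def)
  then have "(\<Inter>i\<in>{1..}. enc ` ut_series i) = enc ` ut_series 4"
    by (intro equalityI INT_greatest INT_lower) auto
  then show "(\<Inter>i\<in>{1..}. enc ` ut_series i) = {\<one>\<^bsub>UG\<^esub>}" by (simp add: ut_series_4)
qed

lemma nilpotent_UG: "nilpotent_group UG"
  unfolding nilpotent_group_def by (rule exI[of _ 4]) (simp add: lower_central_UG ut_series_4)

lemma generated_by_UT:
  assumes "subgroup H UG"
    and "enc (UT 1 0 0 0 0) \<in> H" "enc (UT 0 1 0 0 0) \<in> H" "enc (UT 0 0 1 0 0) \<in> H"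
      "enc (UT 0 0 0 1 0) \<in> H" "enc (UT 0 0 0 0 1) \<in> H"
  shows "H = UNIV"
proof -
  have add: "enc (g + h) \<in> H" if "enc g \<in> H" "enc h \<in> H" for g h
    using subgroup.m_closed[OF assms(1) that] by simp
  have neg: "enc (- g) \<in> H" if "enc g \<in> H" for g
    using subgroup.m_inv_closed[OF assms(1) that] by simp
  have zero: "enc (UT 0 0 0 0 0) \<in> H"
    using subgroup.one_closed[OF assms(1)] by (simp add: zero_ut_def)
  have additive: "enc (f n) \<in> H"
    if f: "f 0 = UT 0 0 0 0 0" "enc (f 1) \<in> H" "\<And>m n. f (m + n) = f m + f n" for f :: "int \<Rightarrow> ut" and n
  proof (induction n rule: int_induct[of _ 0])
    case (step1 i)
    then show ?case using f add by auto
  next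
    case (step2 i)
    have "f i = f (i - 1) + f 1" using f(3)[of "i - 1" 1] by simp
    then have "f (i - 1) = f i + - f 1" by simp
    with add[OF step2(2) neg[OF f(2)]] show ?case by (simp only:)
  qed (use f zero in auto)
  have e14: "enc (UT 0 0 0 0 n) \<in> H" and e24: "enc (UT 0 0 0 n 0) \<in> H" and e34: "enc (UT 0 0 n 0 0) \<in> H"
    and e13: "enc (UT 0 n 0 0 0) \<in> H" for n
    by (rule additive[of "\<lambda>n. UT 0 0 0 0 n"] additive[of "\<lambda>n. UT 0 0 0 n 0"]
        additive[of "\<lambda>n. UT 0 0 n 0 0"] additive[of "\<lambda>n. UT 0 n 0 0 0"];
        use assms in \<open>simp add: plus_ut_def\<close>)+
  have e12: "enc (UT n 0 0 0 0) \<in> H" for n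
  proof (induction n rule: int_induct[of _ 0])
    case (step1 i)
    \<comment> \<open>The product of the first two factors has an entry i at (1,3), which the last
      factor removes.\<close>
    have "UT (i + 1) 0 0 0 0 = UT i 0 0 0 0 + UT 1 0 0 0 0 + UT 0 (- i) 0 0 0" by (simp add: plus_ut_def)
    then show ?case using step1 assms(2) e13[of "- i"] add by simp
  next
    case (step2 i)
    have "UT (i - 1) 0 0 0 0 = UT i 0 0 0 0 + - UT 1 0 0 0 0 + UT 0 (i - 1) 0 0 0"
      by (simp add: plus_ut_def uminus_ut_def)
    with add[OF add[OF step2(2) neg[OF assms(2)]] e13] show ?case by (simp only:)
  qed (rule zero)
  have "enc g \<in> H" for g
  proof -
    \<comment> \<open>In this order every mixed product of entries is zero.\<close>
    have "g = UT 0 0 0 0 (e14 g) + UT 0 0 0 (e24 g) 0 + UT 0 0 (e34 g) 0 0 + UT 0 (e13 g) 0 0 0 + UT (e12 g) 0 0 0 0"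
      by (rule ut.expand) simp
    then show ?thesis by (rule ssubst) (intro add e14 e24 e34 e13 e12)
  qed
  then show ?thesis by (metis UNIV_eq_I enc_dec)
qed

lemma finitely_generated_UG: "finitely_generated_group UG"
  unfolding finitely_generated_group_def
proof (intro exI conjI)
  let ?S = "enc ` {UT 1 0 0 0 0, UT 0 1 0 0 0, UT 0 0 1 0 0, UT 0 0 0 1 0, UT 0 0 0 0 1}"
  show "finite ?S" by simp
  show "?S \<subseteq> carrier UG" by simp
  have "generate UG ?S = UNIV"
    by (rule generated_by_UT) (auto intro!: UG.generate_is_subgroup intro: generate.incl)
  then show "generate UG ?S = carrier UG" by simp
qed

section \<open>The commutator form and the failure of relative freeness\<close>

definition ut_form :: "ut \<Rightarrow> ut \<Rightarrow> int" where
  "ut_form g h = e12 g * e34 h - e12 h * e34 g"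

lemma additive_ut_minus:
  fixes \<Phi> :: "ut \<Rightarrow> ut"
  assumes add: "\<And>g h. \<Phi> (g + h) = \<Phi> g + \<Phi> h"
  shows "\<Phi> (- g) = - \<Phi> g"
proof -
  have "\<Phi> 0 + \<Phi> 0 = \<Phi> 0 + 0" using add[of 0 0] by simp
  then have "\<Phi> 0 = 0" by (simp only: add_left_cancel)
  moreover have "\<Phi> (- g) + \<Phi> g = \<Phi> 0" using add[of "- g" g] by simp
  ultimately show ?thesis by (simp add: eq_neg_iff_add_eq_0)
qed

text \<open>An endomorphism acts on \<open>\<gamma>\<^sub>2/\<gamma>\<^sub>3\<close>, which is infinite cyclic, as multiplication by an integer.\<close>

lemma ut_form_endomorphism:
  fixes \<Phi> :: "ut \<Rightarrow> ut"
  assumes add: "\<And>g h. \<Phi> (g + h) = \<Phi> g + \<Phi> h"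
  obtains d where "\<And>g h. ut_form (\<Phi> g) (\<Phi> h) = d * ut_form g h"
proof -
  define comm where "comm g h = - g + - h + g + h" for g h :: ut
  have \<Phi>_comm: "\<Phi> (comm g h) = comm (\<Phi> g) (\<Phi> h)" for g h
    unfolding comm_def add additive_ut_minus[of \<Phi>, OF add] ..
  have comm: "e12 (comm g h) = 0" "e13 (comm g h) = 0" "e34 (comm g h) = 0"
    "e24 (comm g h) = ut_form g h" for g h
    by (simp_all add: comm_def ut_form_def algebra_simps)
  \<comment> \<open>The second and third terms consist of single commutators, which makes their
    images under \<open>\<Phi>\<close> computable.\<close>
  have "UT 0 0 0 v w = comm (UT 1 0 0 0 0) (UT 0 0 v (w + v) 0)" for v w
    by (rule ut.expand) (simp add: comm_def)
  then have \<gamma>2: "e12 (\<Phi> (UT 0 0 0 v w)) = 0" "e34 (\<Phi> (UT 0 0 0 v w)) = 0" for v w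
    by (simp_all add: \<Phi>_comm comm)
  have "UT 0 0 0 0 w = comm (UT 0 0 0 1 0) (UT (- w) 0 0 0 0)" for w
    by (rule ut.expand) (simp add: comm_def)
  then have \<gamma>3: "e24 (\<Phi> (UT 0 0 0 0 w)) = 0" for w
    by (simp add: \<Phi>_comm comm ut_form_def \<gamma>2)
  define f where "f v = e24 (\<Phi> (UT 0 0 0 v 0))" for v
  have f_add: "f (v + v') = f v + f v'" for v v'
  proof -
    have "UT 0 0 0 (v + v') 0 = UT 0 0 0 v 0 + UT 0 0 0 v' 0" by (simp add: plus_ut_def)
    then show ?thesis by (simp add: f_def add \<gamma>2)
  qed
  have f: "f v = f 1 * v" for v
  proof (induction v rule: int_induct[of _ 0])
    case base
    show ?case using f_add[of 0 0] by simp
  next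
    case (step1 i)
    then show ?case using f_add[of i 1] by (simp add: algebra_simps)
  next
    case (step2 i)
    then show ?case using f_add[of "i - 1" 1] by (simp add: algebra_simps)
  qed
  show thesis
  proof (rule that)
    fix g h
    have "comm g h = UT 0 0 0 (ut_form g h) 0 + UT 0 0 0 0 (e14 (comm g h))"
      by (rule ut.expand) (simp add: comm)
    then have "\<Phi> (comm g h) = \<Phi> (UT 0 0 0 (ut_form g h) 0 + UT 0 0 0 0 (e14 (comm g h)))"
      by (rule arg_cong)
    then have "\<Phi> (comm g h) = \<Phi> (UT 0 0 0 (ut_form g h) 0) + \<Phi> (UT 0 0 0 0 (e14 (comm g h)))"
      by (simp only: add)
    then have "e24 (\<Phi> (comm g h)) = f (ut_form g h)" by (simp add: \<gamma>2 \<gamma>3 f_def)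
    then show "ut_form (\<Phi> g) (\<Phi> h) = f 1 * ut_form g h"
      using f[of "ut_form g h"] by (simp add: \<Phi>_comm comm)
  qed
qed

text \<open>By bilinearity some generators x, x' pair nontrivially, and two generators cannot
  suffice, so there is a third one z. Killing z while fixing x and x' forces the multiplier 1 and
  hence makes z orthogonal to x; sending z to x' then turns a zero pairing into a nonzero
  one.\<close>

lemma not_relatively_free_UG: "\<not> relatively_free UG"
proof
  assume free: "relatively_free UG"
  obtain X :: "nat set" and y where "y \<in> X \<rightarrow> carrier UG" and gen: "generate UG (y ` X) = carrier UG"
    and univ: "\<And>f. f \<in> X \<rightarrow> carrier UG \<Longrightarrow> \<exists>\<phi>\<in>hom UG UG. \<forall>x\<in>X. \<phi> (y x) = f x"
    by (rule relatively_free_universal[OF group_UG free]) (rule that)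
  define Y where "Y x = dec (y x)" for x
  have gen_induct: "P g"
    if "\<And>x. x \<in> X \<Longrightarrow> P (Y x)" "P 0" "\<And>g h. P g \<Longrightarrow> P h \<Longrightarrow> P (g + h)" "\<And>g. P g \<Longrightarrow> P (- g)" for P g
  proof -
    have "subgroup {n. P (dec n)} UG"
      by (rule UG.subgroupI) (use that in \<open>auto intro: exI[of _ "enc 0"]\<close>)
    moreover have "y ` X \<subseteq> {n. P (dec n)}" using that(1) by (auto simp: Y_def)
    ultimately have "carrier UG \<subseteq> {n. P (dec n)}"
      using UG.generate_subgroup_incl gen by metis
    then have "enc g \<in> {n. P (dec n)}" by (simp only: UG_simps subset_iff UNIV_I simp_thms)
    then show ?thesis by simp
  qed
  have endo: "\<exists>\<Phi>. (\<forall>g h. \<Phi> (g + h) = \<Phi> g + \<Phi> h) \<and> (\<forall>x\<in>X. \<Phi> (Y x) = f x)" for f :: "nat \<Rightarrow> ut"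
  proof -
    obtain \<phi> where \<phi>: "\<phi> \<in> hom UG UG" "\<And>x. x \<in> X \<Longrightarrow> \<phi> (y x) = enc (f x)"
      using univ[of "enc \<circ> f"] by auto
    have "\<phi> (enc (g + h)) = enc (dec (\<phi> (enc g)) + dec (\<phi> (enc h)))" for g h
      using hom_mult[OF \<phi>(1), of "enc g" "enc h"] by simp
    then show ?thesis
      using \<phi>(2) by (intro exI[of _ "\<lambda>g. dec (\<phi> (enc g))"]) (simp add: Y_def)
  qed
  have "\<exists>x\<in>X. \<exists>x'\<in>X. ut_form (Y x) (Y x') \<noteq> 0"
  proof (rule ccontr)
    assume "\<not> ?thesis"
    then have *: "x \<in> X \<Longrightarrow> x' \<in> X \<Longrightarrow> ut_form (Y x) (Y x') = 0" for x x' by blast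
    have "x' \<in> X \<Longrightarrow> ut_form g (Y x') = 0" for g x'
      by (rule gen_induct[of "\<lambda>g. ut_form g (Y x') = 0"]) (use * in \<open>auto simp: ut_form_def algebra_simps\<close>)
    then have "ut_form g h = 0" for g h
      by (rule gen_induct[of "\<lambda>h. ut_form g h = 0"]) (auto simp: ut_form_def algebra_simps)
    from this[of "UT 1 0 0 0 0" "UT 0 0 1 0 0"] show False by (simp add: ut_form_def)
  qed
  then obtain x x' where x: "x \<in> X" "x' \<in> X" "ut_form (Y x) (Y x') \<noteq> 0" by blast
  have z: "\<exists>z\<in>X. z \<noteq> x \<and> z \<noteq> x'"
  proof (rule ccontr)
    assume two: "\<not> ?thesis"
    \<comment> \<open>The entry e13 is not additive. Twice the (1,3) entry of the matrix logarithm
      is, and it supplies the third coordinate of the abelianisation.\<close>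
    define t where "t g = 2 * e13 g - e12 g * e12 g" for g
    have t_add: "t (g + h) = t g + t h" for g h by (simp add: t_def algebra_simps)
    have t_minus: "t (- g) = - t g" for g by (simp add: t_def algebra_simps)
    \<comment> \<open>The determinant with rows (e12, e34, t) taken at x, x' and g, expanded along
      the row of g. It vanishes on both generators, but at \<open>UT 0 1 0 0 0\<close> it is twice
      the pairing of x and x'.\<close>
    define k where "k g = (e34 (Y x) * t (Y x') - t (Y x) * e34 (Y x')) * e12 g
      + (t (Y x) * e12 (Y x') - e12 (Y x) * t (Y x')) * e34 g + ut_form (Y x) (Y x') * t g" for g
    have "k g = 0" for g
    proof (rule gen_induct[of "\<lambda>g. k g = 0"])
      fix z assume "z \<in> X"
      with two have "z = x \<or> z = x'" by blast
      then show "k (Y z) = 0" by (auto simp: k_def ut_form_def algebra_simps)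
    next
      show "k 0 = 0" by (simp add: k_def t_def)
      show "k (g + h) = 0" if "k g = 0" "k h = 0" for g h
      proof -
        have "k (g + h) = k g + k h" by (simp add: k_def t_add algebra_simps)
        with that show ?thesis by simp
      qed
      show "k (- g) = 0" if "k g = 0" for g
      proof -
        have "k (- g) = - k g" by (simp add: k_def t_minus algebra_simps)
        with that show ?thesis by simp
      qed
    qed
    from this[of "UT 0 1 0 0 0"] x show False by (simp add: k_def t_def)
  qed
  then obtain z where z: "z \<in> X" "z \<noteq> x" "z \<noteq> x'" by blast
  have "x \<noteq> x'" using x by (auto simp: ut_form_def)
  obtain \<Phi> where \<Phi>: "\<And>g h. \<Phi> (g + h) = \<Phi> g + \<Phi> h"
    "\<And>v. v \<in> X \<Longrightarrow> \<Phi> (Y v) = (if v = z then 0 else Y v)"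
    using endo[of "\<lambda>v. if v = z then 0 else Y v"] by blast
  obtain d where d: "\<And>g h. ut_form (\<Phi> g) (\<Phi> h) = d * ut_form g h"
    using ut_form_endomorphism[OF \<Phi>(1)] by blast
  have "d = 1" using d[of "Y x" "Y x'"] x z by (simp add: \<Phi>(2))
  moreover have "ut_form (Y x) 0 = 0" by (simp add: ut_form_def)
  ultimately have xz: "ut_form (Y x) (Y z) = 0" using d[of "Y x" "Y z"] x z by (simp add: \<Phi>(2))
  obtain \<Psi> where \<Psi>: "\<And>g h. \<Psi> (g + h) = \<Psi> g + \<Psi> h"
    "\<And>v. v \<in> X \<Longrightarrow> \<Psi> (Y v) = (if v = z then Y x' else Y v)"
    using endo[of "\<lambda>v. if v = z then Y x' else Y v"] by blast
  obtain d' where "\<And>g h. ut_form (\<Psi> g) (\<Psi> h) = d' * ut_form g h"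
    using ut_form_endomorphism[OF \<Psi>(1)] by blast
  from this[of "Y x" "Y z"] x z xz show False by (simp add: \<Psi>(2))
qed

section \<open>The graded Lie algebra\<close>

definition frag_eval :: "('x \<Rightarrow> rat) \<Rightarrow> ('x \<Rightarrow>\<^sub>0 int) \<Rightarrow> rat" where
  "frag_eval g t = (\<Sum>x\<in>Poly_Mapping.keys t. of_int (Poly_Mapping.lookup t x) * g x)"

lemma frag_eval_superset:
  assumes "finite S" "Poly_Mapping.keys t \<subseteq> S"
  shows "frag_eval g t = (\<Sum>x\<in>S. of_int (Poly_Mapping.lookup t x) * g x)"
  unfolding frag_eval_def using assms by (intro sum.mono_neutral_left) (auto simp: in_keys_iff)

lemma frag_eval_diff: "frag_eval g (s - t) = frag_eval g s - frag_eval g t"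
proof -
  let ?S = "Poly_Mapping.keys s \<union> Poly_Mapping.keys t"
  have "Poly_Mapping.keys (s - t) \<subseteq> ?S" by (rule keys_diff)
  then show ?thesis
    by (simp add: frag_eval_superset[of ?S] lookup_minus left_diff_distrib sum_subtractf)
qed

lemma frag_eval_0 [simp]: "frag_eval g 0 = 0"
  by (simp add: frag_eval_def)

lemma frag_eval_uminus: "frag_eval g (- t) = - frag_eval g t"
  using frag_eval_diff[of g 0 t] by simp

lemma frag_eval_add: "frag_eval g (s + t) = frag_eval g s + frag_eval g t"
  using frag_eval_diff[of g s "- t"] by (simp add: frag_eval_uminus)

lemma frag_eval_frag_of [simp]: "frag_eval g (frag_of x) = g x"
  by (simp add: frag_eval_def)

lemma frag_eval_cong:
  "(\<And>x. x \<in> Poly_Mapping.keys t \<Longrightarrow> g x = h x) \<Longrightarrow> frag_eval g t = frag_eval h t"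
  unfolding frag_eval_def by (intro sum.cong) auto

lemma frag_eval_frag_extend: "frag_eval g (frag_extend b t) = frag_eval (\<lambda>x. frag_eval g (b x)) t"
  using subset_UNIV[of "Poly_Mapping.keys t"]
  by (induction t rule: frag_induction) (auto simp: frag_extend_diff frag_eval_diff)

lemma frag_eval_scale: "frag_eval (\<lambda>x. c * g x) t = c * frag_eval g t"
  by (simp add: frag_eval_def sum_distrib_left mult.left_commute)

lemma frag_eval_minus_fun: "frag_eval (\<lambda>x. g x - h x) t = frag_eval g t - frag_eval h t"
  by (simp add: frag_eval_def sum_subtractf right_diff_distrib)

definition tensor_eval :: "('c \<Rightarrow> int) \<Rightarrow> (rat \<times> 'c \<Rightarrow>\<^sub>0 int) \<Rightarrow> rat" where
  "tensor_eval \<phi> = frag_eval (\<lambda>(q, a). q * of_int (\<phi> a))"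

lemma tensor_eval_frag_of [simp]: "tensor_eval \<phi> (frag_of (q, a)) = q * of_int (\<phi> a)"
  by (simp add: tensor_eval_def)

text \<open>A difference of two products of functionals is the shape that the commutator pairings of
  all degrees take; it passes from group elements to formal sums of tensor symbols.\<close>

lemma tensor_eval_bilinear:
  assumes s: "Poly_Mapping.keys s \<subseteq> UNIV \<times> A" and t: "Poly_Mapping.keys t \<subseteq> UNIV \<times> B"
    and \<kappa>: "\<And>a b. a \<in> A \<Longrightarrow> b \<in> B \<Longrightarrow> \<chi> (\<kappa> a b) = \<phi> a * \<psi> b - \<phi>' a * \<psi>' b"
  shows "tensor_eval \<chi> (frag_extend (\<lambda>(q, a). frag_extend (\<lambda>(r, b). frag_of (q * r, \<kappa> a b)) t) s)
    = tensor_eval \<phi> s * tensor_eval \<psi> t - tensor_eval \<phi>' s * tensor_eval \<psi>' t"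
proof -
  let ?E = "\<lambda>\<psi>. frag_eval (\<lambda>(r, b). r * of_int (\<psi> b)) t"
  have inner: "frag_eval (\<lambda>(r, a). r * of_int (\<chi> a)) (frag_extend (\<lambda>(r, b). frag_of (q * r, \<kappa> a b)) t)
     = ?E \<psi> * (q * of_int (\<phi> a)) - ?E \<psi>' * (q * of_int (\<phi>' a))" if "a \<in> A" for q a
  proof -
    have "frag_eval (\<lambda>(r, a). r * of_int (\<chi> a)) (frag_extend (\<lambda>(r, b). frag_of (q * r, \<kappa> a b)) t)
      = frag_eval (\<lambda>x. q * of_int (\<phi> a) * (case x of (r, b) \<Rightarrow> r * of_int (\<psi> b))
          - q * of_int (\<phi>' a) * (case x of (r, b) \<Rightarrow> r * of_int (\<psi>' b))) t"
      unfolding frag_eval_frag_extend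
    proof (rule frag_eval_cong)
      fix x assume "x \<in> Poly_Mapping.keys t"
      with t obtain r b where x: "x = (r, b)" "b \<in> B" by (cases x) auto
      show "frag_eval (\<lambda>(r, a). r * of_int (\<chi> a)) (case x of (r, b) \<Rightarrow> frag_of (q * r, \<kappa> a b))
        = q * of_int (\<phi> a) * (case x of (r, b) \<Rightarrow> r * of_int (\<psi> b))
          - q * of_int (\<phi>' a) * (case x of (r, b) \<Rightarrow> r * of_int (\<psi>' b))"
        by (simp add: x(1) \<kappa>[OF that x(2)] algebra_simps)
    qed
    then show ?thesis
      unfolding frag_eval_minus_fun frag_eval_scale by (simp only: mult.commute)
  qed
  have "tensor_eval \<chi> (frag_extend (\<lambda>(q, a). frag_extend (\<lambda>(r, b). frag_of (q * r, \<kappa> a b)) t) s)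
    = frag_eval (\<lambda>x. ?E \<psi> * (case x of (q, a) \<Rightarrow> q * of_int (\<phi> a))
        - ?E \<psi>' * (case x of (q, a) \<Rightarrow> q * of_int (\<phi>' a))) s"
    unfolding tensor_eval_def frag_eval_frag_extend[of _ _ s]
  proof (rule frag_eval_cong)
    fix x assume "x \<in> Poly_Mapping.keys s"
    with s obtain q a where x: "x = (q, a)" "a \<in> A" by (cases x) auto
    show "frag_eval (\<lambda>(q, a). q * of_int (\<chi> a)) (case x of (q, a) \<Rightarrow> frag_extend (\<lambda>(r, b). frag_of (q * r, \<kappa> a b)) t)
      = ?E \<psi> * (case x of (q, a) \<Rightarrow> q * of_int (\<phi> a)) - ?E \<psi>' * (case x of (q, a) \<Rightarrow> q * of_int (\<phi>' a))"
      unfolding x(1) prod.case by (rule inner[OF x(2)])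
  qed
  then show ?thesis
    unfolding frag_eval_minus_fun frag_eval_scale tensor_eval_def by (simp only: mult.commute)
qed

lemma tensor_eval_add: "tensor_eval \<phi> (s + t) = tensor_eval \<phi> s + tensor_eval \<phi> t"
  and tensor_eval_diff: "tensor_eval \<phi> (s - t) = tensor_eval \<phi> s - tensor_eval \<phi> t"
  and tensor_eval_uminus: "tensor_eval \<phi> (- t) = - tensor_eval \<phi> t"
  and tensor_eval_0 [simp]: "tensor_eval \<phi> 0 = 0"
  by (simp_all add: tensor_eval_def frag_eval_add frag_eval_diff frag_eval_uminus)

text \<open>A relation instead of a function: operations on cosets are unions over representatives,
  and what has to be carried along is that all representatives agree. Nonemptiness makes v
  unique.\<close>

definition tensor_value :: "('c, 'd) monoid_scheme \<Rightarrow> ('c \<Rightarrow> int) \<Rightarrow> (rat \<times> 'c \<Rightarrow>\<^sub>0 int) set \<Rightarrow> rat \<Rightarrow> bool" where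
  "tensor_value A \<phi> T v \<longleftrightarrow> T \<noteq> {} \<and>
     (\<forall>t\<in>T. Poly_Mapping.keys t \<subseteq> UNIV \<times> carrier A \<and> tensor_eval \<phi> t = v)"

lemma tensor_value_zero:
  assumes "tensor_value A \<phi> T v" and zero: "\<And>a. \<psi> a = 0"
  shows "tensor_value A \<psi> T 0"
proof -
  have "tensor_eval \<psi> t = 0" for t
    by (simp add: tensor_eval_def frag_eval_def case_prod_unfold zero)
  with assms(1) show ?thesis by (simp add: tensor_value_def)
qed

section \<open>Tensor products with the rationals\<close>

locale rat_tensor_group = group A for A :: "('c, 'd) monoid_scheme"
begin

lemma subgroup_tensor_relations: "subgroup (tensor_relations A) (tensor_free A)"
  unfolding tensor_relations_def
proof (rule group.generate_is_subgroup[OF group_free_Abelian_group], rule subsetI)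
  have "frag_of x - frag_of y - frag_of z \<in> carrier (tensor_free A)"
    if "snd x \<in> carrier A" "snd y \<in> carrier A" "snd z \<in> carrier A" for x y z :: "rat \<times> 'c"
    unfolding carrier_free_Abelian_group_iff
    by (intro order_trans[OF keys_diff] Un_least) (use that in \<open>auto simp: mem_Times_iff\<close>)
  then show "t \<in> carrier (tensor_free A)"
    if "t \<in> {frag_of (q + r, a) - frag_of (q, a) - frag_of (r, a) |q r a. a \<in> carrier A} \<union>
      {frag_of (q, a \<otimes>\<^bsub>A\<^esub> b) - frag_of (q, a) - frag_of (q, b) |q a b. a \<in> carrier A \<and> b \<in> carrier A}" for t
    using that by (elim UnE CollectE exE conjE) (simp_all only: snd_conv m_closed)
qed

lemma tensor_relations_keys:
  "t \<in> tensor_relations A \<Longrightarrow> Poly_Mapping.keys t \<subseteq> UNIV \<times> carrier A"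
  using subgroup.mem_carrier[OF subgroup_tensor_relations, of t] by simp

lemma tensor_relations_zero: "0 \<in> tensor_relations A"
  using subgroup.one_closed[OF subgroup_tensor_relations] by simp

lemma tensor_relations_add:
  "s \<in> tensor_relations A \<Longrightarrow> t \<in> tensor_relations A \<Longrightarrow> s + t \<in> tensor_relations A"
  using subgroup.m_closed[OF subgroup_tensor_relations] by simp

lemma tensor_relations_uminus: "t \<in> tensor_relations A \<Longrightarrow> - t \<in> tensor_relations A"
  using subgroup.m_inv_closed[OF subgroup_tensor_relations, of t] tensor_relations_keys[of t]
  by simp

lemma tensor_relations_diff:
  "s \<in> tensor_relations A \<Longrightarrow> t \<in> tensor_relations A \<Longrightarrow> s - t \<in> tensor_relations A"
  using tensor_relations_add[of s "- t"] tensor_relations_uminus by simp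

lemma tensor_relations_left:
  "a \<in> carrier A \<Longrightarrow> frag_of (q + r, a) - frag_of (q, a) - frag_of (r, a) \<in> tensor_relations A"
  unfolding tensor_relations_def by (rule generate.incl) blast

lemma tensor_relations_right:
  "a \<in> carrier A \<Longrightarrow> b \<in> carrier A \<Longrightarrow>
    frag_of (q, a \<otimes>\<^bsub>A\<^esub> b) - frag_of (q, a) - frag_of (q, b) \<in> tensor_relations A"
  unfolding tensor_relations_def by (rule generate.incl) blast

lemma frag_of_zero_tensor_relations: "a \<in> carrier A \<Longrightarrow> frag_of (0, a) \<in> tensor_relations A"
  using tensor_relations_uminus[OF tensor_relations_left[of a 0 0]] by simp

lemma tensor_eval_tensor_relations:
  assumes "\<And>a b. a \<in> carrier A \<Longrightarrow> b \<in> carrier A \<Longrightarrow> \<phi> (a \<otimes>\<^bsub>A\<^esub> b) = \<phi> a + \<phi> b"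
    and t: "t \<in> tensor_relations A"
  shows "tensor_eval \<phi> t = 0"
proof -
  have "tensor_relations A \<subseteq> {t \<in> carrier (tensor_free A). tensor_eval \<phi> t = 0}"
    unfolding tensor_relations_def
  proof (rule group.generate_subgroup_incl[OF group_free_Abelian_group subsetI])
    show "subgroup {t \<in> carrier (tensor_free A). tensor_eval \<phi> t = 0} (tensor_free A)"
      by (rule group.subgroupI[OF group_free_Abelian_group])
        (auto simp: tensor_eval_uminus tensor_eval_add dest!: subsetD[OF keys_add] intro: exI[of _ 0])
  next
    have "t \<in> carrier (tensor_free A)" if "t \<in> tensor_relations A" for t
      using that tensor_relations_keys by simp
    moreover have "tensor_eval \<phi> (frag_of (q + r, a) - frag_of (q, a) - frag_of (r, a)) = 0" for q r a
      by (simp only: tensor_eval_diff tensor_eval_frag_of) (simp add: algebra_simps)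
    moreover have "tensor_eval \<phi> (frag_of (q, a \<otimes>\<^bsub>A\<^esub> b) - frag_of (q, a) - frag_of (q, b)) = 0"
      if "a \<in> carrier A" "b \<in> carrier A" for q a b
      unfolding tensor_eval_diff tensor_eval_frag_of assms(1)[OF that] by (simp add: distrib_left)
    ultimately show "t \<in> {t \<in> carrier (tensor_free A). tensor_eval \<phi> t = 0}"
      if "t \<in> {frag_of (q + r, a) - frag_of (q, a) - frag_of (r, a) |q r a. a \<in> carrier A} \<union>
        {frag_of (q, a \<otimes>\<^bsub>A\<^esub> b) - frag_of (q, a) - frag_of (q, b) |q a b. a \<in> carrier A \<and> b \<in> carrier A}" for t
      using that
      by (elim UnE CollectE exE conjE)
        (simp_all only: tensor_relations_left tensor_relations_right mem_Collect_eq simp_thms)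
  qed
  with t show ?thesis by blast
qed

text \<open>Powers of a generator move into the rational factor, so a single symbol with second
  entry \<open>\<gamma> 1\<close> represents everything. Since c merely picks an exponent for each
  element, trivial groups are covered as well.\<close>

lemma tensor_cyclic:
  fixes \<gamma> :: "int \<Rightarrow> 'c" and c :: "'c \<Rightarrow> int"
  assumes \<gamma>: "\<And>i. \<gamma> i \<in> carrier A" "\<And>i j. \<gamma> (i + j) = \<gamma> i \<otimes>\<^bsub>A\<^esub> \<gamma> j"
    and c: "\<And>a. a \<in> carrier A \<Longrightarrow> a = \<gamma> (c a)"
    and t: "Poly_Mapping.keys t \<subseteq> UNIV \<times> carrier A"
  shows "t - frag_of (tensor_eval c t, \<gamma> 1) \<in> tensor_relations A"
proof -
  have power: "frag_of (q, \<gamma> i) - frag_of (q * of_int i, \<gamma> 1) \<in> tensor_relations A" for q i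
  proof (induction i rule: int_induct[of _ 0])
    case base
    have "frag_of (q, \<gamma> 0) \<in> tensor_relations A"
      using tensor_relations_uminus[OF tensor_relations_right[of "\<gamma> 0" "\<gamma> 0" q]] \<gamma>(1) \<gamma>(2)[of 0 0] by simp
    with frag_of_zero_tensor_relations[OF \<gamma>(1)[of 1]] show ?case by (simp add: tensor_relations_diff)
  next
    case (step1 i)
    have X: "frag_of (q, \<gamma> (i + 1)) - frag_of (q, \<gamma> i) - frag_of (q, \<gamma> 1) \<in> tensor_relations A"
      using tensor_relations_right[OF \<gamma>(1) \<gamma>(1), of q i 1] by (simp add: \<gamma>(2))
    have Y: "frag_of (q * of_int (i + 1), \<gamma> 1) - frag_of (q * of_int i, \<gamma> 1) - frag_of (q, \<gamma> 1) \<in> tensor_relations A"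
      using tensor_relations_left[OF \<gamma>(1), of "q * of_int i" q 1] by (simp add: algebra_simps)
    from tensor_relations_diff[OF tensor_relations_add[OF X step1(2)] Y]
    show ?case by (simp add: algebra_simps)
  next
    case (step2 i)
    have X: "frag_of (q, \<gamma> i) - frag_of (q, \<gamma> (i - 1)) - frag_of (q, \<gamma> 1) \<in> tensor_relations A"
      using tensor_relations_right[OF \<gamma>(1) \<gamma>(1), of q "i - 1" 1] by (simp flip: \<gamma>(2))
    have Y: "frag_of (q * of_int i, \<gamma> 1) - frag_of (q * of_int (i - 1), \<gamma> 1) - frag_of (q, \<gamma> 1) \<in> tensor_relations A"
      using tensor_relations_left[OF \<gamma>(1), of "q * of_int (i - 1)" q 1] by (simp add: algebra_simps)
    from tensor_relations_add[OF tensor_relations_diff[OF step2(2) X] Y]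
    show ?case by (simp add: algebra_simps)
  qed
  show ?thesis
    using t
  proof (induction t rule: frag_induction)
    case zero
    show ?case using tensor_relations_uminus[OF frag_of_zero_tensor_relations[OF \<gamma>(1)]] by simp
  next
    case (one x)
    then obtain q a where x: "x = (q, a)" "a \<in> carrier A" by (cases x) auto
    show ?case
      using power[of q "c a"] unfolding x(1) c[OF x(2), symmetric] tensor_eval_frag_of .
  next
    case (diff s t)
    let ?e = "tensor_eval c"
    from tensor_relations_add[OF tensor_relations_diff[OF diff] tensor_relations_left[OF \<gamma>(1)],
        of "?e s - ?e t" "?e t" 1]
    show ?case by (simp add: tensor_eval_diff algebra_simps)
  qed
qed

text \<open>For cyclic A one coordinate decides whether a formal sum is zero in the tensor product.
  Vanishing of brackets is proved in this way.\<close>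

lemma tensor_relations_cyclicI:
  fixes \<gamma> :: "int \<Rightarrow> 'c" and c :: "'c \<Rightarrow> int"
  assumes "\<And>i. \<gamma> i \<in> carrier A" "\<And>i j. \<gamma> (i + j) = \<gamma> i \<otimes>\<^bsub>A\<^esub> \<gamma> j"
    and "\<And>a. a \<in> carrier A \<Longrightarrow> a = \<gamma> (c a)"
    and "Poly_Mapping.keys t \<subseteq> UNIV \<times> carrier A" and "tensor_eval c t = 0"
  shows "t \<in> tensor_relations A"
  using tensor_relations_add[OF tensor_cyclic[OF assms(1-4)] frag_of_zero_tensor_relations[OF assms(1)[of 1]]]
  by (simp add: assms(5))

lemma comm_group_rat_tensor: "comm_group (rat_tensor A)"
  unfolding rat_tensor_def
  by (intro comm_group.abelian_FactGroup abelian_free_Abelian_group subgroup_tensor_relations)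

lemma tensor_class_relation: "t \<in> tensor_relations A \<Longrightarrow> tensor_class A t = tensor_relations A"
  by (rule group.coset_join2[OF group_free_Abelian_group _ subgroup_tensor_relations])
    (auto dest: tensor_relations_keys)

lemma mem_tensor_class: "s \<in> tensor_class A t \<longleftrightarrow> (\<exists>r\<in>tensor_relations A. s = r + t)"
  by (auto simp: r_coset_def)

context
  fixes \<phi> :: "'c \<Rightarrow> int"
  assumes additive: "\<And>a b. a \<in> carrier A \<Longrightarrow> b \<in> carrier A \<Longrightarrow> \<phi> (a \<otimes>\<^bsub>A\<^esub> b) = \<phi> a + \<phi> b"
begin

lemma tensor_value_class:
  assumes "Poly_Mapping.keys t \<subseteq> UNIV \<times> carrier A"
  shows "tensor_value A \<phi> (tensor_class A t) (tensor_eval \<phi> t)"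
  unfolding tensor_value_def
proof (intro conjI ballI)
  show "tensor_class A t \<noteq> {}" using tensor_relations_zero by (force simp: mem_tensor_class)
next
  fix s assume "s \<in> tensor_class A t"
  then obtain r where r: "r \<in> tensor_relations A" "s = r + t" by (auto simp: mem_tensor_class)
  show "Poly_Mapping.keys s \<subseteq> UNIV \<times> carrier A"
    unfolding r(2) using tensor_relations_keys[OF r(1)] assms by (intro order_trans[OF keys_add]) auto
  show "tensor_eval \<phi> s = tensor_eval \<phi> t"
    using tensor_eval_tensor_relations[OF additive r(1)] by (simp add: r(2) tensor_eval_add)
qed

lemma tensor_value_exists:
  assumes "T \<in> carrier (rat_tensor A)"
  obtains v where "tensor_value A \<phi> T v"
proof -
  obtain t where "Poly_Mapping.keys t \<subseteq> UNIV \<times> carrier A" "T = tensor_class A t"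
    using assms unfolding rat_tensor_def carrier_FactGroup by auto
  then show thesis using tensor_value_class that by blast
qed

lemma tensor_value_scale:
  assumes "tensor_value A \<phi> T v"
  shows "tensor_value A \<phi> (tensor_scale A q T) (q * v)"
proof -
  let ?s = "frag_extend (\<lambda>(r, a). frag_of (q * r, a))"
  have "tensor_value A \<phi> (tensor_class A (?s t)) (q * v)" if "t \<in> T" for t
  proof -
    have t: "Poly_Mapping.keys t \<subseteq> UNIV \<times> carrier A" "tensor_eval \<phi> t = v"
      using assms that by (auto simp: tensor_value_def)
    have "Poly_Mapping.keys (?s t) \<subseteq> UNIV \<times> carrier A"
      using t(1) by (intro order_trans[OF keys_frag_extend]) auto
    moreover have "tensor_eval \<phi> (?s t) = q * v"
      unfolding t(2)[symmetric] tensor_eval_def frag_eval_frag_extend frag_eval_scale[symmetric]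
      by (intro frag_eval_cong) auto
    ultimately show ?thesis using tensor_value_class by metis
  qed
  moreover have "T \<noteq> {}" using assms by (simp add: tensor_value_def)
  ultimately show ?thesis unfolding tensor_scale_def tensor_value_def by blast
qed

end

lemma tensor_value_mult:
  assumes "tensor_value A \<phi> S v" "tensor_value A \<phi> T w"
  shows "tensor_value A \<phi> (S \<otimes>\<^bsub>rat_tensor A\<^esub> T) (v + w)"
  unfolding tensor_value_def
proof (intro conjI ballI)
  show "S \<otimes>\<^bsub>rat_tensor A\<^esub> T \<noteq> {}"
    using assms by (auto simp: tensor_value_def rat_tensor_def set_mult_def)
next
  fix x assume "x \<in> S \<otimes>\<^bsub>rat_tensor A\<^esub> T"
  then obtain s t where x: "x = s + t" "s \<in> S" "t \<in> T"
    by (auto simp: rat_tensor_def set_mult_def)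
  with assms show "tensor_eval \<phi> x = v + w" by (simp add: tensor_value_def tensor_eval_add)
  show "Poly_Mapping.keys x \<subseteq> UNIV \<times> carrier A"
    unfolding x(1) by (rule order_trans[OF keys_add]) (use assms x in \<open>auto simp: tensor_value_def\<close>)
qed

lemma tensor_scale_zero:
  assumes "T \<in> carrier (rat_tensor A)"
  shows "tensor_scale A 0 T = \<one>\<^bsub>rat_tensor A\<^esub>"
proof -
  obtain t where t: "Poly_Mapping.keys t \<subseteq> UNIV \<times> carrier A" "T = tensor_class A t"
    using assms unfolding rat_tensor_def carrier_FactGroup by auto
  have zero: "frag_extend (\<lambda>(r, a). frag_of (0 * r, a)) s \<in> tensor_relations A"
    if "Poly_Mapping.keys s \<subseteq> UNIV \<times> carrier A" for s :: "rat \<times> 'c \<Rightarrow>\<^sub>0 int"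
    using that
    by (induction s rule: frag_induction)
      (auto simp: tensor_relations_zero frag_of_zero_tensor_relations frag_extend_diff tensor_relations_diff)
  have "Poly_Mapping.keys s \<subseteq> UNIV \<times> carrier A" if "s \<in> T" for s
  proof -
    obtain r where r: "r \<in> tensor_relations A" "s = r + t" using \<open>s \<in> T\<close> by (auto simp: t(2) mem_tensor_class)
    show ?thesis
      unfolding r(2) by (rule order_trans[OF keys_add]) (use t(1) tensor_relations_keys[OF r(1)] in auto)
  qed
  then have "tensor_class A (frag_extend (\<lambda>(r, a). frag_of (0 * r, a)) s) = tensor_relations A" if "s \<in> T" for s
    using that zero tensor_class_relation by blast
  moreover have "t \<in> T" using tensor_relations_zero by (force simp: t(2) mem_tensor_class)
  ultimately show ?thesis unfolding tensor_scale_def rat_tensor_def one_FactGroup by blast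
qed

end

section \<open>Factors of the series and their commutator pairings\<close>

definition ut_coset :: "nat \<Rightarrow> ut \<Rightarrow> nat set" where
  "ut_coset n g = (\<lambda>h. enc (h + g)) ` ut_series (Suc n)"

lemma r_coset_UG:
  "enc ` ut_series (Suc n) #>\<^bsub>UG\<^esub> x = ut_coset n (dec x)"
  "enc ` ut_series (Suc n) #>\<^bsub>UG\<lparr>carrier := S\<rparr>\<^esub> x = ut_coset n (dec x)"
  by (auto simp: r_coset_def ut_coset_def)

lemma isolator_quotient_UG:
  "1 \<le> n \<Longrightarrow> isolator_quotient UG n = UG\<lparr>carrier := enc ` ut_series n\<rparr> Mod enc ` ut_series (Suc n)"
  by (simp add: isolator_quotient_def isolator_UG)

lemma group_isolator_quotient_UG: "1 \<le> n \<Longrightarrow> group (isolator_quotient UG n)"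
  unfolding isolator_quotient_UG by (rule normal.factorgroup_is_group[OF normal_ut_series_Suc])

lemma carrier_isolator_quotient_UG:
  "1 \<le> n \<Longrightarrow> carrier (isolator_quotient UG n) = ut_coset n ` ut_series n"
  by (simp add: isolator_quotient_UG carrier_FactGroup r_coset_UG image_image)

lemma mult_isolator_quotient_UG:
  assumes "1 \<le> n" "g \<in> ut_series n" "h \<in> ut_series n"
  shows "ut_coset n g \<otimes>\<^bsub>isolator_quotient UG n\<^esub> ut_coset n h = ut_coset n (g + h)"
  using normal.rcos_sum[OF normal_ut_series_Suc, of "enc g" n "enc h"] assms
  by (simp add: isolator_quotient_UG r_coset_UG)

lemma ut_coset_eqI:
  assumes "g - h \<in> ut_series (Suc n)"
  shows "ut_coset n g = ut_coset n h"
proof -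
  have "enc ((g - h) + h) \<in> ut_coset n h" unfolding ut_coset_def by (rule imageI) (rule assms)
  then have "enc g \<in> ut_coset n h" by simp
  then have "enc ` ut_series (Suc n) #>\<^bsub>UG\<^esub> enc h = enc ` ut_series (Suc n) #>\<^bsub>UG\<^esub> enc g"
    by (intro UG.repr_independence subgroup_ut_series) (simp_all add: r_coset_UG)
  then show ?thesis by (simp add: r_coset_UG)
qed

definition coset_coordinate :: "(ut \<Rightarrow> int) \<Rightarrow> nat set \<Rightarrow> int" where
  "coset_coordinate \<pi> A = \<pi> (dec (SOME a. a \<in> A))"

text \<open>What makes \<open>coset_coordinate \<pi>\<close> independent of the chosen
  representative and additive on the factor of degree n.\<close>

definition series_coordinate :: "nat \<Rightarrow> (ut \<Rightarrow> int) \<Rightarrow> bool" where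
  "series_coordinate n \<pi> \<longleftrightarrow> (\<forall>g\<in>ut_series n. \<forall>h\<in>ut_series n. \<pi> (h + g) = \<pi> h + \<pi> g) \<and>
     (\<forall>h\<in>ut_series (Suc n). \<pi> h = 0)"

lemma coset_coordinate:
  assumes "series_coordinate n \<pi>" "g \<in> ut_series n"
  shows "coset_coordinate \<pi> (ut_coset n g) = \<pi> g"
proof -
  have "enc (0 + g) \<in> ut_coset n g"
    unfolding ut_coset_def by (rule imageI) (simp add: ut_series_def)
  then have "(SOME a. a \<in> ut_coset n g) \<in> ut_coset n g" by (rule someI)
  then obtain h where h: "h \<in> ut_series (Suc n)" "(SOME a. a \<in> ut_coset n g) = enc (h + g)"
    unfolding ut_coset_def by blast
  then have "h \<in> ut_series n" using ut_series_antimono[of n "Suc n"] by auto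
  then show ?thesis using assms h(1) by (simp add: coset_coordinate_def h(2) series_coordinate_def)
qed

lemma coset_coordinate_mult:
  assumes "1 \<le> n" "series_coordinate n \<pi>"
    and "A \<in> carrier (isolator_quotient UG n)" "B \<in> carrier (isolator_quotient UG n)"
  shows "coset_coordinate \<pi> (A \<otimes>\<^bsub>isolator_quotient UG n\<^esub> B) = coset_coordinate \<pi> A + coset_coordinate \<pi> B"
proof -
  obtain g h where gh: "A = ut_coset n g" "B = ut_coset n h" "g \<in> ut_series n" "h \<in> ut_series n"
    using assms(3,4) unfolding carrier_isolator_quotient_UG[OF assms(1)] by blast
  then have "g + h \<in> ut_series n" by (auto simp: ut_series_def)
  with gh assms(1,2) show ?thesis
    by (simp add: mult_isolator_quotient_UG coset_coordinate[OF assms(2)]) (simp add: series_coordinate_def)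
qed

text \<open>Brackets land in degree at least 2, where the factors are cyclic: infinite in degrees 2
  and 3, trivial from degree 4 on. The value in degree 1 is a default.\<close>

definition last_coordinate :: "nat \<Rightarrow> ut \<Rightarrow> int" where
  "last_coordinate n = (if n = 2 then e24 else if n = 3 then e14 else (\<lambda>_. 0))"

definition series_generator :: "nat \<Rightarrow> int \<Rightarrow> ut" where
  "series_generator n k = (if n = 2 then UT 0 0 0 k 0 else if n = 3 then UT 0 0 0 0 k else 0)"

lemma less_four_cases: "2 \<le> (n::nat) \<Longrightarrow> (n = 2 \<Longrightarrow> P) \<Longrightarrow> (n = 3 \<Longrightarrow> P) \<Longrightarrow> (4 \<le> n \<Longrightarrow> P) \<Longrightarrow> P"
  by linarith

lemma series_coordinate_last: "2 \<le> n \<Longrightarrow> series_coordinate n (last_coordinate n)"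
  by (erule less_four_cases) (auto simp: series_coordinate_def last_coordinate_def ut_series_def)

lemma series_generator_mem: "2 \<le> n \<Longrightarrow> series_generator n k \<in> ut_series n"
  by (erule less_four_cases) (auto simp: series_generator_def ut_series_def)

lemma series_generator_add: "series_generator n (k + l) = series_generator n k + series_generator n l"
  by (auto simp: series_generator_def plus_ut_def zero_ut_def)

lemma ut_coset_last_coordinate_eqI:
  assumes "2 \<le> n" "g \<in> ut_series n" "h \<in> ut_series n" "last_coordinate n g = last_coordinate n h"
  shows "ut_coset n g = ut_coset n h"
  by (rule ut_coset_eqI, rule less_four_cases[OF assms(1)])
    (use assms in \<open>auto simp: last_coordinate_def ut_series_def\<close>)

lemma ut_coset_generator:
  assumes "2 \<le> n" "g \<in> ut_series n"
  shows "ut_coset n g = ut_coset n (series_generator n (last_coordinate n g))"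
proof (rule ut_coset_last_coordinate_eqI[OF assms series_generator_mem[OF assms(1)]])
  show "last_coordinate n g = last_coordinate n (series_generator n (last_coordinate n g))"
    by (rule less_four_cases[OF assms(1)]) (auto simp: series_generator_def last_coordinate_def)
qed

text \<open>
  The commutator pairing of degrees \<open>i\<close> and \<open>j\<close> is the bilinear form
  \<open>left1 \<otimes> right1 - left2 \<otimes> right2\<close>.
\<close>

definition left1 :: "nat \<Rightarrow> ut \<Rightarrow> int" where
  "left1 i = (if i = 1 then e12 else if i = 2 then e24 else (\<lambda>_. 0))"

definition left2 :: "nat \<Rightarrow> ut \<Rightarrow> int" where
  "left2 i = (if i = 1 then e34 else if i = 2 then e24 else (\<lambda>_. 0))"

text \<open>The dependence on j sits in the right factors alone. An element whose left coordinates
  vanish in each degree i is then orthogonal to every degree j at once.\<close>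

definition right1 :: "nat \<Rightarrow> nat \<Rightarrow> ut \<Rightarrow> int" where
  "right1 i j = (if i = 1 \<and> j = 1 then e34 else if i = 1 \<and> j = 2 then e24 else (\<lambda>_. 0))"

definition right2 :: "nat \<Rightarrow> nat \<Rightarrow> ut \<Rightarrow> int" where
  "right2 i j = (if i = 1 \<and> j = 1 then e12 else if i = 2 \<and> j = 1 then e12 else (\<lambda>_. 0))"

lemma series_coordinate_left_right:
  assumes "1 \<le> i" "1 \<le> j"
  shows "series_coordinate i (left1 i)" "series_coordinate i (left2 i)"
    "series_coordinate j (right1 i j)" "series_coordinate j (right2 i j)"
  using assms
  by (auto simp: series_coordinate_def left1_def left2_def right1_def right2_def ut_series_def)

text \<open>For i + j >= 4 both sides vanish. The entry e13 occurs in none of the pairings: its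
  product with e34 contributes to degree 3, while the bracket of two elements of degree 1 is read
  off in degree 2.\<close>

lemma commutator_ut_series:
  assumes ij: "1 \<le> i" "1 \<le> j" and g: "g \<in> ut_series i" and h: "h \<in> ut_series j"
  shows "- g + - h + g + h \<in> ut_series (i + j)"
    and "last_coordinate (i + j) (- g + - h + g + h) = left1 i g * right1 i j h - left2 i g * right2 i j h"
proof -
  consider "i = 1" "j = 1" | "i = 1" "j = 2" | "i = 2" "j = 1" | "4 \<le> i + j" "i = 1" "3 \<le> j"
    | "4 \<le> i + j" "i = 2" "2 \<le> j" | "4 \<le> i + j" "3 \<le> i" "1 \<le> j"
    using ij by linarith
  note * = this
  show "- g + - h + g + h \<in> ut_series (i + j)"
    using * by cases (use g h in \<open>auto simp: ut_series_def algebra_simps\<close>)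
  show "last_coordinate (i + j) (- g + - h + g + h) = left1 i g * right1 i j h - left2 i g * right2 i j h"
    using * by cases (use g h in \<open>auto simp: ut_series_def algebra_simps last_coordinate_def
        left1_def left2_def right1_def right2_def\<close>)
qed

text \<open>The union over representatives collapses because the commutator modulo the next term
  depends only on coordinates that are constant on cosets.\<close>

lemma coset_commutator_UG:
  assumes ij: "1 \<le> i" "1 \<le> j" and g: "g \<in> ut_series i" and h: "h \<in> ut_series j"
  shows "coset_commutator UG i j (ut_coset i g) (ut_coset j h) = ut_coset (i + j) (- g + - h + g + h)"
proof -
  have "isolator UG (Suc (i + j)) #>\<^bsub>UG\<^esub> commutator UG a b = ut_coset (i + j) (- g + - h + g + h)"
    if ab: "a \<in> ut_coset i g" "b \<in> ut_coset j h" for a b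
  proof -
    obtain g' h' where a: "a = enc (g' + g)" "g' \<in> ut_series (Suc i)"
      and b: "b = enc (h' + h)" "h' \<in> ut_series (Suc j)"
      using ab unfolding ut_coset_def by blast
    have g': "g' \<in> ut_series i" and h': "h' \<in> ut_series j"
      using a b ut_series_antimono[of i "Suc i"] ut_series_antimono[of j "Suc j"] by auto
    then have sums: "g' + g \<in> ut_series i" "h' + h \<in> ut_series j"
      using g h by (auto simp: ut_series_def)
    have "left1 i (g' + g) = left1 i g" "left2 i (g' + g) = left2 i g"
      "right1 i j (h' + h) = right1 i j h" "right2 i j (h' + h) = right2 i j h"
      using series_coordinate_left_right[OF ij] a(2) b(2) g' h' g h by (simp_all add: series_coordinate_def)
    then have "ut_coset (i + j) (- (g' + g) + - (h' + h) + (g' + g) + (h' + h))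
      = ut_coset (i + j) (- g + - h + g + h)"
      using ij commutator_ut_series[OF ij sums] commutator_ut_series[OF ij g h]
      by (intro ut_coset_last_coordinate_eqI) (simp_all only:)
    moreover have "isolator UG (Suc (i + j)) = enc ` ut_series (Suc (i + j))" by (rule isolator_UG) simp
    ultimately show ?thesis by (simp only: r_coset_UG commutator_UG a(1) b(1) dec_enc)
  qed
  moreover have "ut_coset n x \<noteq> {}" for n x
  proof -
    have "0 \<in> ut_series (Suc n)" by (simp add: ut_series_def)
    then show ?thesis unfolding ut_coset_def by blast
  qed
  ultimately show ?thesis unfolding coset_commutator_def by (simp add: SUP_eq_const)
qed

text \<open>The target factor is cyclic, so one coordinate decides, and by bilinearity that
  coordinate is a combination of the left values of S. The assumption on T provides representatives
  supported in the factor of degree j.\<close>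

lemma homogeneous_bracket_vanishes:
  assumes ij: "1 \<le> i" "1 \<le> j"
    and left: "tensor_value (isolator_quotient UG i) (coset_coordinate (left1 i)) S 0"
      "tensor_value (isolator_quotient UG i) (coset_coordinate (left2 i)) S 0"
    and right: "tensor_value (isolator_quotient UG j) \<phi> T v"
  shows "homogeneous_bracket UG i j S T = \<one>\<^bsub>rat_tensor (isolator_quotient UG (i + j))\<^esub>"
proof -
  let ?n = "i + j"
  let ?A = "isolator_quotient UG ?n"
  have n: "1 \<le> ?n" "2 \<le> ?n" using ij by simp_all
  interpret A: rat_tensor_group ?A
    using group_isolator_quotient_UG[OF n(1)] by (simp add: rat_tensor_group_def)
  let ?\<beta> = "\<lambda>s t. frag_extend (\<lambda>(q, A). frag_extend (\<lambda>(r, B). frag_of (q * r, coset_commutator UG i j A B)) t) s"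
  have "tensor_class ?A (?\<beta> s t) = tensor_relations ?A" if s: "s \<in> S" and t: "t \<in> T" for s t
  proof (rule A.tensor_class_relation, rule A.tensor_relations_cyclicI)
    have ks: "Poly_Mapping.keys s \<subseteq> UNIV \<times> carrier (isolator_quotient UG i)"
      and es: "tensor_eval (coset_coordinate (left1 i)) s = 0" "tensor_eval (coset_coordinate (left2 i)) s = 0"
      and kt: "Poly_Mapping.keys t \<subseteq> UNIV \<times> carrier (isolator_quotient UG j)"
      using left right s t by (auto simp: tensor_value_def)
    have comm: "coset_commutator UG i j a b \<in> carrier ?A"
      "coset_coordinate (last_coordinate ?n) (coset_commutator UG i j a b)
        = coset_coordinate (left1 i) a * coset_coordinate (right1 i j) b
          - coset_coordinate (left2 i) a * coset_coordinate (right2 i j) b"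
      if ab: "a \<in> carrier (isolator_quotient UG i)" "b \<in> carrier (isolator_quotient UG j)" for a b
    proof -
      obtain g h where gh: "a = ut_coset i g" "b = ut_coset j h" "g \<in> ut_series i" "h \<in> ut_series j"
        using ab ij by (auto simp: carrier_isolator_quotient_UG)
      note c = commutator_ut_series[OF ij gh(3,4)]
      show "coset_commutator UG i j a b \<in> carrier ?A"
        unfolding gh(1,2) coset_commutator_UG[OF ij gh(3,4)] carrier_isolator_quotient_UG[OF n(1)]
        by (rule imageI) (rule c(1))
      show "coset_coordinate (last_coordinate ?n) (coset_commutator UG i j a b)
        = coset_coordinate (left1 i) a * coset_coordinate (right1 i j) b
          - coset_coordinate (left2 i) a * coset_coordinate (right2 i j) b"
        unfolding gh(1,2) coset_commutator_UG[OF ij gh(3,4)]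
          coset_coordinate[OF series_coordinate_last[OF n(2)] c(1)] c(2)
          coset_coordinate[OF series_coordinate_left_right(1)[OF ij] gh(3)]
          coset_coordinate[OF series_coordinate_left_right(2)[OF ij] gh(3)]
          coset_coordinate[OF series_coordinate_left_right(3)[OF ij] gh(4)]
          coset_coordinate[OF series_coordinate_left_right(4)[OF ij] gh(4)] ..
    qed
    show "Poly_Mapping.keys (?\<beta> s t) \<subseteq> UNIV \<times> carrier ?A"
    proof (rule order_trans[OF keys_frag_extend], rule UN_least, clarsimp)
      fix q a q' a' assume "(q, a) \<in> Poly_Mapping.keys s"
        and *: "(q', a') \<in> Poly_Mapping.keys (frag_extend (\<lambda>(r, B). frag_of (q * r, coset_commutator UG i j a B)) t)"
      then have a: "a \<in> carrier (isolator_quotient UG i)" using ks by auto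
      have "Poly_Mapping.keys (frag_extend (\<lambda>(r, B). frag_of (q * r, coset_commutator UG i j a B)) t)
          \<subseteq> UNIV \<times> carrier ?A"
        by (rule order_trans[OF keys_frag_extend], rule UN_least) (use kt comm(1)[OF a] in auto)
      with * show "a' \<in> carrier ?A" by blast
    qed
    show "tensor_eval (coset_coordinate (last_coordinate ?n)) (?\<beta> s t) = 0"
      using tensor_eval_bilinear[of s _ t _ "coset_coordinate (last_coordinate ?n)", OF ks kt comm(2)] es by simp
  next
    show "ut_coset ?n (series_generator ?n k) \<in> carrier ?A" for k
      unfolding carrier_isolator_quotient_UG[OF n(1)] by (rule imageI) (rule series_generator_mem[OF n(2)])
    show "ut_coset ?n (series_generator ?n (k + l))
      = ut_coset ?n (series_generator ?n k) \<otimes>\<^bsub>?A\<^esub> ut_coset ?n (series_generator ?n l)" for k l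
      by (simp only: mult_isolator_quotient_UG[OF n(1) series_generator_mem[OF n(2)] series_generator_mem[OF n(2)]]
          series_generator_add)
    show "a = ut_coset ?n (series_generator ?n (coset_coordinate (last_coordinate ?n) a))"
      if a: "a \<in> carrier ?A" for a
    proof -
      obtain g where g: "a = ut_coset ?n g" "g \<in> ut_series ?n"
        using a unfolding carrier_isolator_quotient_UG[OF n(1)] by blast
      show ?thesis
        unfolding g(1) coset_coordinate[OF series_coordinate_last[OF n(2)] g(2)]
        by (rule ut_coset_generator[OF n(2) g(2)])
    qed
  qed
  moreover have "S \<noteq> {}" "T \<noteq> {}" using left right by (auto simp: tensor_value_def)
  ultimately show ?thesis
    unfolding homogeneous_bracket_def rat_tensor_def one_FactGroup by (simp add: SUP_eq_const)
qed

section \<open>Linear systems and central combinations\<close>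

lemma underdetermined_system:
  fixes a :: "nat \<Rightarrow> 'k \<Rightarrow> 'f::field"
  assumes "finite K" "m < card K"
  shows "\<exists>\<alpha>. (\<exists>k\<in>K. \<alpha> k \<noteq> 0) \<and> (\<forall>i<m. (\<Sum>k\<in>K. a i k * \<alpha> k) = 0)"
  using assms
proof (induction m arbitrary: K a)
  case 0
  then have "K \<noteq> {}" by auto
  then show ?case by (intro exI[of _ "\<lambda>_. 1"]) auto
next
  case (Suc m)
  show ?case
  proof (cases "\<forall>k\<in>K. a m k = 0")
    case True
    obtain \<alpha> where "\<exists>k\<in>K. \<alpha> k \<noteq> 0" "\<forall>i<m. (\<Sum>k\<in>K. a i k * \<alpha> k) = 0"
      using Suc.IH[of K a] Suc.prems by auto
    with True show ?thesis by (intro exI[of _ \<alpha>]) (auto simp: less_Suc_eq)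
  next
    case False
    then obtain j where j: "j \<in> K" "a m j \<noteq> 0" by blast
    let ?J = "K - {j}"
    have J: "finite ?J" "m < card ?J" using Suc.prems j by (simp_all add: card_Diff_singleton)
    \<comment> \<open>Gaussian elimination: the pivot \<open>a m j\<close> removes the unknown j
      from the other m equations.\<close>
    obtain \<beta> where \<beta>: "\<exists>k\<in>?J. \<beta> k \<noteq> 0"
      "\<forall>i<m. (\<Sum>k\<in>?J. (a i k - a i j * a m k / a m j) * \<beta> k) = 0"
      using Suc.IH[OF J, of "\<lambda>i k. a i k - a i j * a m k / a m j"] by blast
    define b where "b = - (\<Sum>k\<in>?J. a m k * \<beta> k) / a m j"
    define \<alpha> where "\<alpha> = \<beta>(j := b)"
    have sum: "(\<Sum>k\<in>K. a i k * \<alpha> k) = a i j * b + (\<Sum>k\<in>?J. a i k * \<beta> k)" for i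
      unfolding sum.remove[OF Suc.prems(1) j(1)] by (simp add: \<alpha>_def)
    have "(\<Sum>k\<in>K. a i k * \<alpha> k) = 0" if "i < Suc m" for i
    proof (cases "i = m")
      case True
      then show ?thesis unfolding sum b_def using j by simp
    next
      case False
      with that \<beta> have "0 = (\<Sum>k\<in>?J. (a i k - a i j * a m k / a m j) * \<beta> k)" by simp
      also have "\<dots> = (\<Sum>k\<in>?J. a i k * \<beta> k) - (\<Sum>k\<in>?J. a i j / a m j * (a m k * \<beta> k))"
        by (simp add: left_diff_distrib sum_subtractf mult.assoc)
      also have "(\<Sum>k\<in>?J. a i j / a m j * (a m k * \<beta> k)) = - (a i j * b)"
        unfolding sum_distrib_left[symmetric] b_def by simp
      finally show ?thesis unfolding sum by (simp add: add.commute)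
    qed
    moreover have "\<exists>k\<in>K. \<alpha> k \<noteq> 0" using \<beta>(1) by (auto simp: \<alpha>_def)
    ultimately show ?thesis by blast
  qed
qed

text \<open>Four terms, one more than the codimension bound for the graded centre.\<close>

definition lie_combination :: "'v rat_lie_algebra \<Rightarrow> (nat \<Rightarrow> rat) \<Rightarrow> (nat \<Rightarrow> 'v) \<Rightarrow> 'v" where
  "lie_combination L \<alpha> x = lie_add L (lie_add L (lie_add L (lie_scale L (\<alpha> 0) (x 0))
     (lie_scale L (\<alpha> 1) (x 1))) (lie_scale L (\<alpha> 2) (x 2))) (lie_scale L (\<alpha> 3) (x 3))"

lemma rat_tensor_group_UG: "1 \<le> n \<Longrightarrow> rat_tensor_group (isolator_quotient UG n)"
  by (simp add: rat_tensor_group_def group_isolator_quotient_UG)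

lemma graded_component:
  assumes "x \<in> carrier (graded_lie_algebra UG)" "1 \<le> n"
  shows "x n \<in> carrier (rat_tensor (isolator_quotient UG n))"
proof -
  have "group (rat_tensor (isolator_quotient UG i))" if "i \<in> {1..}" for i
    using rat_tensor_group.comm_group_rat_tensor[OF rat_tensor_group_UG, of i] that
    by (auto simp: comm_group_def)
  then have carrier: "carrier (sum_group {1..} (\<lambda>i. rat_tensor (isolator_quotient UG i))) =
      {x \<in> \<Pi>\<^sub>E i\<in>{1..}. carrier (rat_tensor (isolator_quotient UG i)).
        finite {i \<in> {1..}. x i \<noteq> \<one>\<^bsub>rat_tensor (isolator_quotient UG i)\<^esub>}}"
    by (rule carrier_sum_group)
  have "x \<in> carrier (sum_group {1..} (\<lambda>i. rat_tensor (isolator_quotient UG i)))"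
    using assms(1) by (simp add: graded_lie_algebra_def Let_def)
  with assms(2) show ?thesis unfolding carrier by (auto simp: PiE_iff)
qed

lemma graded_value_exists:
  assumes "x \<in> carrier (graded_lie_algebra UG)" "1 \<le> n" "series_coordinate n \<pi>"
  shows "\<exists>v. tensor_value (isolator_quotient UG n) (coset_coordinate \<pi>) (x n) v"
  using rat_tensor_group.tensor_value_exists[OF rat_tensor_group_UG[OF assms(2)]
      coset_coordinate_mult[OF assms(2,3)] graded_component[OF assms(1,2)]]
  by blast

lemma graded_combination_value:
  fixes v :: "nat \<Rightarrow> rat"
  assumes n: "1 \<le> n" and \<pi>: "series_coordinate n \<pi>"
    and v: "\<And>k. k < 4 \<Longrightarrow> tensor_value (isolator_quotient UG n) (coset_coordinate \<pi>) (x k n) (v k)"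
  shows "tensor_value (isolator_quotient UG n) (coset_coordinate \<pi>)
    (lie_combination (graded_lie_algebra UG) \<alpha> x n) (\<Sum>k<4. v k * \<alpha> k)"
proof -
  note scale = rat_tensor_group.tensor_value_scale[OF rat_tensor_group_UG[OF n] coset_coordinate_mult[OF n \<pi>] v]
  note mult = rat_tensor_group.tensor_value_mult[OF rat_tensor_group_UG[OF n]]
  have "tensor_value (isolator_quotient UG n) (coset_coordinate \<pi>)
    (lie_combination (graded_lie_algebra UG) \<alpha> x n) (\<alpha> 0 * v 0 + \<alpha> 1 * v 1 + \<alpha> 2 * v 2 + \<alpha> 3 * v 3)"
    using mult[OF mult[OF mult[OF scale[of 0 "\<alpha> 0"] scale[of 1 "\<alpha> 1"]] scale[of 2 "\<alpha> 2"]] scale[of 3 "\<alpha> 3"]] n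
    by (simp add: lie_combination_def graded_lie_algebra_def Let_def)
  moreover have "{..<4::nat} = {0, 1, 2, 3}" by auto
  ultimately show ?thesis by (simp add: algebra_simps)
qed

lemma graded_bracket_vanishes:
  assumes w: "\<And>i. 1 \<le> i \<Longrightarrow> tensor_value (isolator_quotient UG i) (coset_coordinate (left1 i)) (w i) 0"
      "\<And>i. 1 \<le> i \<Longrightarrow> tensor_value (isolator_quotient UG i) (coset_coordinate (left2 i)) (w i) 0"
    and y: "y \<in> carrier (graded_lie_algebra UG)"
  shows "lie_bracket (graded_lie_algebra UG) w y = lie_zero (graded_lie_algebra UG)"
proof -
  have "finprod (rat_tensor (isolator_quotient UG n))
      (\<lambda>i. homogeneous_bracket UG i (n - i) (w i) (y (n - i))) {1..<n} = \<one>\<^bsub>rat_tensor (isolator_quotient UG n)\<^esub>"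
    if n: "n \<in> {1..}" for n
  proof (rule comm_monoid.finprod_one_eqI)
    show "comm_monoid (rat_tensor (isolator_quotient UG n))"
      using rat_tensor_group.comm_group_rat_tensor[OF rat_tensor_group_UG, of n] n
      by (simp add: comm_group_def)
    fix i assume "i \<in> {1..<n}"
    then have i: "1 \<le> i" "1 \<le> n - i" "i + (n - i) = n" by auto
    \<comment> \<open>The zero coordinate is a pretext for a \<open>tensor_value\<close> statement
      about this component of y: it certifies that the coset is nonempty and has representatives of
      the right support.\<close>
    have "series_coordinate (n - i) (\<lambda>_. 0)" by (simp add: series_coordinate_def)
    from graded_value_exists[OF y i(2) this] obtain v where
      v: "tensor_value (isolator_quotient UG (n - i)) (coset_coordinate (\<lambda>_. 0)) (y (n - i)) v" by blast
    from homogeneous_bracket_vanishes[OF i(1,2) w(1)[OF i(1)] w(2)[OF i(1)] v]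
    show "homogeneous_bracket UG i (n - i) (w i) (y (n - i)) = \<one>\<^bsub>rat_tensor (isolator_quotient UG n)\<^esub>"
      unfolding i(3) .
  qed
  then show ?thesis
    unfolding graded_lie_algebra_def Let_def by (simp cong: restrict_cong)
qed

text \<open>
  The centre of the graded algebra has codimension at most three: an element is central as soon as
  the coordinates \<open>e12\<close>, \<open>e34\<close> of its first and \<open>e24\<close> of its second component vanish.
\<close>

lemma graded_central_combination:
  assumes x: "\<And>k. k < 4 \<Longrightarrow> x k \<in> carrier (graded_lie_algebra UG)"
  obtains \<alpha> :: "nat \<Rightarrow> rat" and k where "k < 4" "\<alpha> k \<noteq> 0"
    "\<And>y. y \<in> carrier (graded_lie_algebra UG) \<Longrightarrow>
      lie_bracket (graded_lie_algebra UG) (lie_combination (graded_lie_algebra UG) \<alpha> x) y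
        = lie_zero (graded_lie_algebra UG)"
proof -
  define d where "d i = (if i = 2 then 2 else 1 :: nat)" for i :: nat
  define \<pi> where "\<pi> i = (if i = 0 then e12 else if i = 1 then e34 else e24)" for i :: nat
  have coordinate: "series_coordinate (d i) (\<pi> i)" if "i < 3" for i
    using that by (auto simp: series_coordinate_def d_def \<pi>_def ut_series_def)
  have d: "1 \<le> d i" for i by (simp add: d_def)
  have "\<exists>v. i < 3 \<longrightarrow> k < 4 \<longrightarrow>
      tensor_value (isolator_quotient UG (d i)) (coset_coordinate (\<pi> i)) (x k (d i)) v" for i k
    using graded_value_exists[OF x d coordinate] by blast
  then obtain v where v: "\<And>i k. i < 3 \<Longrightarrow> k < 4 \<Longrightarrow>
      tensor_value (isolator_quotient UG (d i)) (coset_coordinate (\<pi> i)) (x k (d i)) (v i k)"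
    by metis
  obtain \<alpha> where \<alpha>: "\<exists>k\<in>{..<4::nat}. \<alpha> k \<noteq> 0" "\<forall>i<3. (\<Sum>k\<in>{..<4}. v i k * \<alpha> k) = 0"
    using underdetermined_system[of "{..<4::nat}" 3 v] by auto
  define w where "w = lie_combination (graded_lie_algebra UG) \<alpha> x"
  have w: "tensor_value (isolator_quotient UG (d i)) (coset_coordinate (\<pi> i)) (w (d i)) 0" if "i < 3" for i
  proof -
    have "tensor_value (isolator_quotient UG (d i)) (coset_coordinate (\<pi> i)) (w (d i)) (\<Sum>k<4. v i k * \<alpha> k)"
      unfolding w_def by (rule graded_combination_value[OF d coordinate[OF that]]) (rule v[OF that])
    with \<alpha>(2) that show ?thesis by simp
  qed
  \<comment> \<open>From degree 3 on the left coordinates are the zero function.\<close>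
  have w0: "tensor_value (isolator_quotient UG n) (coset_coordinate (\<lambda>_. 0)) (w n) 0" if n: "1 \<le> n" for n
  proof -
    have c: "series_coordinate n (\<lambda>_. 0)" by (simp add: series_coordinate_def)
    have "tensor_value (isolator_quotient UG n) (coset_coordinate (\<lambda>_. 0)) (x k n) 0" if "k < 4" for k
      using graded_value_exists[OF x[OF that] n c] tensor_value_zero by (fastforce simp: coset_coordinate_def)
    then have "tensor_value (isolator_quotient UG n) (coset_coordinate (\<lambda>_. 0)) (w n) (\<Sum>k<4. 0 * \<alpha> k)"
      unfolding w_def by (rule graded_combination_value[OF n c])
    then show ?thesis by simp
  qed
  obtain k where k: "k < 4" "\<alpha> k \<noteq> 0" using \<alpha>(1) by auto
  from k show thesis
  proof (rule that)
    fix y assume y: "y \<in> carrier (graded_lie_algebra UG)"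
    have "tensor_value (isolator_quotient UG i) (coset_coordinate (left1 i)) (w i) 0"
      "tensor_value (isolator_quotient UG i) (coset_coordinate (left2 i)) (w i) 0" if "1 \<le> i" for i
      using w[of 0] w[of 1] w[of 2] w0[OF that] by (auto simp: left1_def left2_def d_def \<pi>_def)
    then show "lie_bracket (graded_lie_algebra UG) (lie_combination (graded_lie_algebra UG) \<alpha> x) y
        = lie_zero (graded_lie_algebra UG)"
      unfolding w_def[symmetric] using y by (rule graded_bracket_vanishes)
  qed
qed

lemma graded_scale_zero:
  assumes "x \<in> carrier (graded_lie_algebra UG)"
  shows "lie_scale (graded_lie_algebra UG) 0 x = lie_zero (graded_lie_algebra UG)"
proof -
  have "tensor_scale (isolator_quotient UG n) 0 (x n) = \<one>\<^bsub>rat_tensor (isolator_quotient UG n)\<^esub>"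
    if "n \<in> {1..}" for n
    using rat_tensor_group.tensor_scale_zero[OF rat_tensor_group_UG graded_component[OF assms]] that by simp
  then show ?thesis unfolding graded_lie_algebra_def Let_def by (simp cong: restrict_cong)
qed

section \<open>The group algebra and its completion\<close>

lemma poly_mapping_sum_singles:
  "x = (\<Sum>a\<in>Poly_Mapping.keys x. Poly_Mapping.single a (Poly_Mapping.lookup x a))"
  by (rule poly_mapping_eqI)
    (auto simp: lookup_sum lookup_single when_def in_keys_iff sum.delta' cong: if_cong)

lemma poly_mapping_single_induct [case_names zero add]:
  assumes "P 0" "\<And>x a q. P x \<Longrightarrow> P (Poly_Mapping.single a q + x)"
  shows "P (x :: 'a \<Rightarrow>\<^sub>0 'b::comm_monoid_add)"
proof -
  have "P (\<Sum>a\<in>A. Poly_Mapping.single a (Poly_Mapping.lookup x a))" for A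
    by (induction A rule: infinite_finite_induct) (simp_all add: assms)
  then show ?thesis using poly_mapping_sum_singles[of x] by metis
qed

definition functional :: "('g \<Rightarrow> rat) \<Rightarrow> ('g \<Rightarrow>\<^sub>0 rat) \<Rightarrow> rat" where
  "functional \<phi> x = (\<Sum>g\<in>Poly_Mapping.keys x. Poly_Mapping.lookup x g * \<phi> g)"

lemma functional_superset:
  assumes "finite S" "Poly_Mapping.keys x \<subseteq> S"
  shows "functional \<phi> x = (\<Sum>g\<in>S. Poly_Mapping.lookup x g * \<phi> g)"
  unfolding functional_def using assms by (intro sum.mono_neutral_left) (auto simp: in_keys_iff)

lemma functional_add: "functional \<phi> (x + y) = functional \<phi> x + functional \<phi> y"
proof -
  let ?S = "Poly_Mapping.keys x \<union> Poly_Mapping.keys y"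
  have "Poly_Mapping.keys (x + y) \<subseteq> ?S" by (rule keys_add)
  then show ?thesis
    by (simp add: functional_superset[of ?S] lookup_add distrib_right sum.distrib)
qed

lemma functional_0 [simp]: "functional \<phi> 0 = 0"
  by (simp add: functional_def)

lemma functional_sum: "functional \<phi> (\<Sum>i\<in>A. f i) = (\<Sum>i\<in>A. functional \<phi> (f i))"
  by (induction A rule: infinite_finite_induct) (simp_all add: functional_add)

lemma functional_uminus: "functional \<phi> (- x) = - functional \<phi> x"
  using functional_add[of \<phi> x "- x"] by simp

lemma functional_diff: "functional \<phi> (x - y) = functional \<phi> x - functional \<phi> y"
  using functional_add[of \<phi> x "- y"] functional_uminus[of \<phi> y] by simp

lemma functional_single [simp]: "functional \<phi> (Poly_Mapping.single g q) = q * \<phi> g"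
  by (simp add: functional_def)

lemma functional_mult:
  fixes x y :: "'g::monoid_add \<Rightarrow>\<^sub>0 rat"
  shows "functional \<phi> (x * y) = (\<Sum>g\<in>Poly_Mapping.keys x. \<Sum>h\<in>Poly_Mapping.keys y.
    Poly_Mapping.lookup x g * Poly_Mapping.lookup y h * \<phi> (g + h))"
proof -
  have "x * y = (\<Sum>g\<in>Poly_Mapping.keys x. \<Sum>h\<in>Poly_Mapping.keys y.
      Poly_Mapping.single (g + h) (Poly_Mapping.lookup x g * Poly_Mapping.lookup y h))"
    by (subst (1 2) poly_mapping_sum_singles) (simp add: sum_product mult_single)
  then show ?thesis by (simp add: functional_sum)
qed

lemma functional_mult_product:
  fixes x y :: "'g::monoid_add \<Rightarrow>\<^sub>0 rat"
  shows "(\<Sum>g\<in>Poly_Mapping.keys x. \<Sum>h\<in>Poly_Mapping.keys y.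
    Poly_Mapping.lookup x g * Poly_Mapping.lookup y h * (\<phi> g * \<psi> h)) = functional \<phi> x * functional \<psi> y"
  unfolding functional_def sum_product by (simp add: mult_ac)

definition matrix_entry :: "(ut \<Rightarrow> int) \<Rightarrow> (ut \<Rightarrow>\<^sub>0 rat) \<Rightarrow> rat" where
  "matrix_entry e = functional (\<lambda>g. of_int (e g))"

abbreviation "augmentation \<equiv> functional (\<lambda>_. 1)"

text \<open>The linear extension of the matrix representation to the group algebra is
  multiplicative; the augmentation takes the place of the diagonal entries.\<close>

lemma matrix_entry_mult:
  "augmentation (x * y) = augmentation x * augmentation y"
  "matrix_entry e12 (x * y) = matrix_entry e12 x * augmentation y + augmentation x * matrix_entry e12 y"
  "matrix_entry e34 (x * y) = matrix_entry e34 x * augmentation y + augmentation x * matrix_entry e34 y"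
  "matrix_entry e13 (x * y) = matrix_entry e13 x * augmentation y + augmentation x * matrix_entry e13 y
     + matrix_entry e12 x * matrix_entry e12 y"
  "matrix_entry e24 (x * y) = matrix_entry e24 x * augmentation y + augmentation x * matrix_entry e24 y
     + matrix_entry e12 x * matrix_entry e34 y"
  "matrix_entry e14 (x * y) = matrix_entry e14 x * augmentation y + augmentation x * matrix_entry e14 y
     + matrix_entry e12 x * matrix_entry e24 y + matrix_entry e13 x * matrix_entry e34 y"
  unfolding matrix_entry_def functional_mult functional_mult_product[symmetric]
  by (simp_all add: distrib_left sum.distrib mult_ac)

section \<open>The group algebra as a ring type\<close>

abbreviation "QG \<equiv> group_algebra UG"

text \<open>Moves the group algebra from a record over the encoded group to the type
  \<open>ut \<Rightarrow>\<^sub>0 rat\<close>, where the generic ring arguments on truncated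
  logarithms apply.\<close>

definition transport :: "(nat \<Rightarrow>\<^sub>0 rat) \<Rightarrow> (ut \<Rightarrow>\<^sub>0 rat)" where
  "transport = Poly_Mapping.map_key enc"

definition untransport :: "(ut \<Rightarrow>\<^sub>0 rat) \<Rightarrow> (nat \<Rightarrow>\<^sub>0 rat)" where
  "untransport = Poly_Mapping.map_key dec"

lemma inj_dec: "inj dec" by (simp add: inj_def)

lemma transport_untransport [simp]: "transport (untransport x) = x"
  and untransport_transport [simp]: "untransport (transport y) = y"
  unfolding transport_def untransport_def
  by (simp_all add: map_key_compose inj_enc inj_dec comp_def map_key_id)

lemma transport_add: "transport (x + y) = transport x + transport y"
  by (simp add: transport_def map_key_plus inj_enc)

lemma transport_0 [simp]: "transport 0 = 0"
  by (simp add: transport_def inj_enc)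

lemma transport_eq_iff: "transport x = transport y \<longleftrightarrow> x = y"
  by (metis untransport_transport)

lemma transport_uminus: "transport (- x) = - transport x"
  using transport_add[of x "- x"] by (simp add: eq_neg_iff_add_eq_0 add.commute)

lemma transport_diff: "transport (x - y) = transport x - transport y"
  using transport_add[of x "- y"] by (simp add: transport_uminus)

lemma transport_sum: "transport (\<Sum>i\<in>A. f i) = (\<Sum>i\<in>A. transport (f i))"
  by (induction A rule: infinite_finite_induct) (simp_all add: transport_add)

lemma transport_single [simp]: "transport (Poly_Mapping.single n q) = Poly_Mapping.single (dec n) q"
  using map_key_single[OF inj_enc, of "dec n" q] by (simp add: transport_def)

lemma QG_simps [simp]:
  "carrier QG = UNIV" "\<zero>\<^bsub>QG\<^esub> = 0" "x \<oplus>\<^bsub>QG\<^esub> y = x + y"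
  "\<one>\<^bsub>QG\<^esub> = Poly_Mapping.single (enc 0) 1"
  by (simp_all add: group_algebra_def)

lemma transport_mult: "transport (x \<otimes>\<^bsub>QG\<^esub> y) = transport x * transport y"
proof -
  have T: "transport x = (\<Sum>a\<in>Poly_Mapping.keys x. Poly_Mapping.single (dec a) (Poly_Mapping.lookup x a))" for x
    by (subst poly_mapping_sum_singles[of x]) (simp only: transport_sum transport_single)
  show ?thesis
    unfolding T[of x] T[of y] sum_product mult_single
    by (simp add: group_algebra_def transport_sum)
qed

lemma transport_one [simp]: "transport (Poly_Mapping.single (enc 0) 1) = 1"
  by simp

lemma transport_smult: "transport (q \<odot>\<^bsub>QG\<^esub> x) = Poly_Mapping.single 0 q * transport x"
proof -
  have "q \<odot>\<^bsub>QG\<^esub> x = Poly_Mapping.map ((*) q) x" by (simp add: group_algebra_def)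
  then have "transport (q \<odot>\<^bsub>QG\<^esub> x) = Poly_Mapping.map ((*) q) (transport x)"
    by (simp only: transport_def map_key_map[OF inj_enc])
  then show ?thesis by (simp only: mult_map_scale_conv_mult)
qed

text \<open>The laws are pulled back along the injective map \<open>transport\<close> from the ring
  type.\<close>

lemma ring_QG: "ring QG"
proof (rule ringI)
  show "abelian_group QG"
    by (rule abelian_groupI) (auto simp: add_ac intro: exI[of _ "- _"])
  show "monoid QG"
    by (rule monoidI) (auto simp: transport_mult mult.assoc simp flip: transport_eq_iff simp del: transport_single)
qed (auto simp: transport_mult transport_add algebra_simps simp flip: transport_eq_iff)

interpretation QG: ring QG by (rule ring_QG)

lemma a_inv_QG [simp]: "\<ominus>\<^bsub>QG\<^esub> x = - x"
  by (rule QG.minus_equality) auto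

lemma augmentation_ideal_UG: "augmentation_ideal UG = {x. augmentation (transport x) = 0}"
proof -
  have "(\<Sum>a\<in>Poly_Mapping.keys x. Poly_Mapping.lookup x a) = augmentation (transport x)" for x
    by (induction x rule: poly_mapping_single_induct)
      (use functional_add[of "\<lambda>_. 1"] in \<open>auto simp: transport_add functional_add functional_def[of "\<lambda>_. 1", simplified, symmetric]\<close>)
  then show ?thesis by (auto simp: augmentation_ideal_def)
qed

lemma ideal_augmentation_ideal: "ideal (augmentation_ideal UG) QG"
proof (rule idealI[OF ring_QG])
  show "subgroup (augmentation_ideal UG) (add_monoid QG)"
  proof (rule group.subgroupI[OF QG.a_group])
    have inv: "inv\<^bsub>add_monoid QG\<^esub> x = - x" for x
      using a_inv_QG[of x] unfolding a_inv_def .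
    show "inv\<^bsub>add_monoid QG\<^esub> x \<in> augmentation_ideal UG" if "x \<in> augmentation_ideal UG" for x
      unfolding inv using that by (simp add: augmentation_ideal_UG transport_uminus functional_uminus)
  qed (auto simp: augmentation_ideal_UG transport_add functional_add intro: exI[of _ 0])
qed (auto simp: augmentation_ideal_UG transport_mult matrix_entry_mult)

lemma ideal_augmentation_power: "ideal (augmentation_power UG n) QG"
  by (induction n) (simp_all only: augmentation_power.simps QG.oneideal QG.ideal_prod_is_ideal ideal_augmentation_ideal)

section \<open>Powers of the augmentation ideal\<close>

definition filtration :: "nat \<Rightarrow> (ut \<Rightarrow>\<^sub>0 rat) set" where
  "filtration n = transport ` augmentation_power UG n"

lemma transport_mem_filtration: "transport x \<in> filtration n \<longleftrightarrow> x \<in> augmentation_power UG n"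
  unfolding filtration_def by (metis image_iff transport_eq_iff)

lemma mem_filtration: "x \<in> filtration n \<longleftrightarrow> untransport x \<in> augmentation_power UG n"
  by (metis transport_mem_filtration transport_untransport)

lemma filtration_zero: "0 \<in> filtration n"
  using additive_subgroup.zero_closed[OF ideal.axioms(1)[OF ideal_augmentation_power]]
    transport_mem_filtration[of 0 n] by simp

lemma filtration_add: "x \<in> filtration n \<Longrightarrow> y \<in> filtration n \<Longrightarrow> x + y \<in> filtration n"
  using additive_subgroup.a_closed[OF ideal.axioms(1)[OF ideal_augmentation_power], of "untransport x" n "untransport y"]
  unfolding mem_filtration[of x] mem_filtration[of y]
  by (metis QG_simps(3) transport_add transport_mem_filtration transport_untransport)

lemma filtration_mult_left: "x \<in> filtration n \<Longrightarrow> y * x \<in> filtration n"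
  using ideal.I_l_closed[OF ideal_augmentation_power, of "untransport x" n "untransport y"]
  unfolding mem_filtration[of x]
  by (metis QG_simps(1) UNIV_I transport_mult transport_mem_filtration transport_untransport)

lemma filtration_mult_right: "x \<in> filtration n \<Longrightarrow> x * y \<in> filtration n"
  using ideal.I_r_closed[OF ideal_augmentation_power, of "untransport x" n "untransport y"]
  unfolding mem_filtration[of x]
  by (metis QG_simps(1) UNIV_I transport_mult transport_mem_filtration transport_untransport)

lemma filtration_Suc_induct [consumes 1, case_names mult add]:
  assumes "y \<in> filtration (Suc n)"
    and "\<And>i j. i \<in> filtration n \<Longrightarrow> augmentation j = 0 \<Longrightarrow> P (i * j)"
    and "\<And>x y. P x \<Longrightarrow> P y \<Longrightarrow> P (x + y)"
  shows "P y"
proof -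
  have "P (transport z)" if "z \<in> ideal_prod QG (augmentation_power UG n) (augmentation_ideal UG)" for z
    using that
    by (induction rule: ideal_prod.induct)
      (auto simp: transport_mult transport_add transport_mem_filtration augmentation_ideal_UG intro: assms(2,3))
  then show ?thesis using assms(1) by (auto simp: filtration_def)
qed

lemma filtration_Suc_mult:
  assumes "i \<in> filtration n" "augmentation j = 0"
  shows "i * j \<in> filtration (Suc n)"
proof -
  have "untransport i \<otimes>\<^bsub>QG\<^esub> untransport j \<in> augmentation_power UG (Suc n)"
    unfolding augmentation_power.simps
    by (rule ideal_prod.prod) (use assms in \<open>simp_all add: mem_filtration augmentation_ideal_UG\<close>)
  then have "transport (untransport i \<otimes>\<^bsub>QG\<^esub> untransport j) \<in> filtration (Suc n)"
    by (simp only: transport_mem_filtration)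
  then show ?thesis by (simp only: transport_mult transport_untransport)
qed

lemma filtration_0: "filtration 0 = UNIV"
  by (auto simp: mem_filtration)

lemma filtration_1: "x \<in> filtration 1 \<longleftrightarrow> augmentation x = 0"
proof
  assume "x \<in> filtration 1"
  then have "x \<in> filtration (Suc 0)" by simp
  then show "augmentation x = 0"
    by (induction rule: filtration_Suc_induct) (simp_all add: matrix_entry_mult functional_add)
next
  assume "augmentation x = 0"
  then show "x \<in> filtration 1" using filtration_Suc_mult[of 1 0 x] by (simp add: filtration_0)
qed

text \<open>Induction on n, because the powers are built by multiplying with the augmentation ideal
  on the right.\<close>

lemma filtration_mult: "x \<in> filtration m \<Longrightarrow> y \<in> filtration n \<Longrightarrow> x * y \<in> filtration (m + n)"
proof (induction n arbitrary: y)
  case (Suc n)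
  from Suc.prems(2) show ?case
  proof (induction rule: filtration_Suc_induct)
    case (mult i j)
    then show ?case
      using filtration_Suc_mult[of "x * i" "m + n" j] Suc.IH[OF Suc.prems(1), of i] by (simp add: mult.assoc)
  next
    case (add y z)
    then show ?case by (simp add: distrib_left filtration_add)
  qed
qed (simp add: filtration_mult_right)

lemma filtration_antimono: "m \<le> n \<Longrightarrow> filtration n \<subseteq> filtration m"
proof (rule lift_Suc_antimono_le[of filtration])
  show "filtration (Suc n) \<subseteq> filtration n" for n
  proof
    fix y assume "y \<in> filtration (Suc n)"
    then show "y \<in> filtration n"
      by (induction rule: filtration_Suc_induct) (auto intro: filtration_mult_right filtration_add)
  qed
qed

lemma single_0_commute: "Poly_Mapping.single 0 q * x = x * Poly_Mapping.single (0 :: ut) (q :: rat)"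
  by (induction x rule: poly_mapping_single_induct)
    (simp_all add: distrib_left distrib_right mult_single mult.commute)

interpretation log: filtered_rational_algebra "\<lambda>q. Poly_Mapping.single (0 :: ut) (q :: rat)" filtration
proof unfold_locales
  show "Poly_Mapping.single 0 q * x = x * Poly_Mapping.single (0 :: ut) (q :: rat)" for q x
    by (rule single_0_commute)
  show "Poly_Mapping.single (0 :: ut) (q :: rat) * x \<in> filtration n" if "x \<in> filtration n" for q x n
    using that by (rule filtration_mult_left)
  show "filtration n \<subseteq> filtration m" if "m \<le> n" for m n
    using that by (rule filtration_antimono)
qed (simp_all add: single_add mult_single filtration_0 filtration_zero filtration_add filtration_mult)

lemma filtration_diff: "x \<in> filtration n \<Longrightarrow> y \<in> filtration n \<Longrightarrow> x - y \<in> filtration n"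
  using filtration_add[of x n "- y"] filtration_mult_left[of y n "- 1"] by simp

text \<open>Elements of the augmentation ideal act as strictly upper triangular matrices, so a
  product of four of them acts as zero. The induction records that the n-th power has lost its first
  n diagonals.\<close>

lemma filtration_4:
  assumes "x \<in> filtration 4"
  shows "matrix_entry e14 x = 0"
proof -
  have "(1 \<le> n \<longrightarrow> augmentation x = 0) \<and> (2 \<le> n \<longrightarrow> matrix_entry e12 x = 0 \<and> matrix_entry e34 x = 0) \<and>
    (3 \<le> n \<longrightarrow> matrix_entry e13 x = 0 \<and> matrix_entry e24 x = 0) \<and> (4 \<le> n \<longrightarrow> matrix_entry e14 x = 0)"
    if "x \<in> filtration n" for x n
    using that
  proof (induction n arbitrary: x)
    case (Suc n)
    from Suc.prems show ?case
    proof (induction rule: filtration_Suc_induct)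
      case (mult i j)
      from Suc.IH[OF mult(1)] mult(2) show ?case by (auto simp: matrix_entry_mult)
    next
      case (add x y)
      then show ?case by (auto simp: matrix_entry_def functional_add)
    qed
  qed simp
  from this[OF assms] show ?thesis by simp
qed

definition minus_one :: "ut \<Rightarrow> (ut \<Rightarrow>\<^sub>0 rat)" where
  "minus_one g = Poly_Mapping.single g 1 - 1"

lemma functional_one: "functional \<phi> 1 = \<phi> (0 :: ut)"
  using functional_single[of \<phi> 0 1] by simp

lemma minus_one_filtration: "minus_one g \<in> filtration 1"
  unfolding filtration_1 minus_one_def functional_diff functional_one functional_single by simp

lemma one_plus_minus_one: "1 + minus_one g = Poly_Mapping.single g 1"
  by (simp add: minus_one_def)

lemma minus_one_commute:
  assumes "g + h = h + g"
  shows "minus_one g * minus_one h = minus_one h * minus_one g"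
proof -
  have "Poly_Mapping.single g 1 * Poly_Mapping.single h 1 = Poly_Mapping.single h 1 * Poly_Mapping.single g (1::rat)"
    unfolding mult_single assms ..
  then show ?thesis by (simp add: minus_one_def left_diff_distrib right_diff_distrib)
qed

lemma log_minus_one_commutator:
  assumes "g + h = h + g + c" "c + g = g + c" "c + h = h + c"
  shows "log.truncated_log n (minus_one g) * log.truncated_log n (minus_one h)
    - log.truncated_log n (minus_one h) * log.truncated_log n (minus_one g)
    - log.truncated_log n (minus_one c) \<in> filtration n"
proof -
  have "(1 + minus_one g) * (1 + minus_one h) = (1 + minus_one h) * (1 + minus_one g) * (1 + minus_one c)"
    by (simp add: one_plus_minus_one mult_single assms(1))
  then have "log.truncated_log n (minus_one g) * log.truncated_log n (minus_one h)
    - log.truncated_log n (minus_one h) * log.truncated_log n (minus_one g)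
    - log.truncated_log n (minus_one c) \<in> filtration (Suc n)"
    using assms(2,3)
    by (intro log.truncated_log_commutator minus_one_filtration minus_one_commute) simp_all
  then show ?thesis using filtration_antimono[of n "Suc n"] by auto
qed

text \<open>The matrix of \<open>?w\<close> is the elementary matrix at (1,4), whose square is zero,
  so only the linear term of the series contributes.\<close>

lemma matrix_entry_log:
  "1 \<le> n \<Longrightarrow> matrix_entry e14 (log.truncated_log n (minus_one (UT 0 0 0 0 1))) = 1"
proof -
  let ?w = "minus_one (UT 0 0 0 0 1)"
  have w: "augmentation ?w = 0" "matrix_entry e12 ?w = 0" "matrix_entry e13 ?w = 0" "matrix_entry e14 ?w = 1"
    unfolding minus_one_def matrix_entry_def functional_diff functional_one functional_single
    by simp_all
  have scale: "matrix_entry e14 (Poly_Mapping.single 0 q * x) = q * matrix_entry e14 x" for q x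
    by (simp add: matrix_entry_mult) (simp add: matrix_entry_def)
  have "matrix_entry e14 (?w ^ k) = (if k = 1 then 1 else 0)" if "1 \<le> k" for k
  proof (cases k)
    case (Suc j)
    have "augmentation (?w ^ j) = (if j = 0 then 1 else 0)"
      by (cases j) (simp_all add: matrix_entry_mult w functional_one)
    then show ?thesis using Suc by (simp add: matrix_entry_mult w)
  qed (use that in simp)
  then have "matrix_entry e14 (log.truncated_log n ?w)
      = (\<Sum>k=1..n. (-1) ^ (k + 1) / of_nat k * (if k = 1 then 1 else 0))"
    unfolding log.truncated_log_def matrix_entry_def functional_sum
    unfolding matrix_entry_def[symmetric] scale by (intro sum.cong) auto
  also have "\<dots> = (\<Sum>k=1..n. if k = 1 then 1 else 0)" by (intro sum.cong) auto
  finally show "1 \<le> n \<Longrightarrow> ?thesis" by simp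
qed

section \<open>The inverse limit through representatives\<close>

definition coset_class :: "nat \<Rightarrow> (ut \<Rightarrow>\<^sub>0 rat) \<Rightarrow> (nat \<Rightarrow>\<^sub>0 rat) set" where
  "coset_class n t = augmentation_power UG n +>\<^bsub>QG\<^esub> untransport t"

lemma mem_coset_class: "a \<in> coset_class n t \<longleftrightarrow> transport a - t \<in> filtration n"
proof -
  interpret I: ideal "augmentation_power UG n" QG by (rule ideal_augmentation_power)
  have "transport (a + - untransport t) \<in> filtration n \<longleftrightarrow> a \<in> coset_class n t"
    unfolding transport_mem_filtration coset_class_def by (subst I.a_rcos_module) simp_all
  then show ?thesis by (simp add: transport_diff)
qed

lemma untransport_mem_coset_class: "untransport t \<in> coset_class n t"
  by (simp add: mem_coset_class filtration_zero)

lemma coset_class_eq_iff: "coset_class n s = coset_class n t \<longleftrightarrow> s - t \<in> filtration n"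
proof
  assume "coset_class n s = coset_class n t"
  then show "s - t \<in> filtration n"
    using untransport_mem_coset_class[of s n] by (simp add: mem_coset_class)
next
  assume st: "s - t \<in> filtration n"
  have "x - s \<in> filtration n \<longleftrightarrow> x - t \<in> filtration n" for x
    using filtration_add[OF _ st, of "x - s"] filtration_diff[OF _ st, of "x - t"] by auto
  then show "coset_class n s = coset_class n t" by (auto simp: mem_coset_class)
qed

lemma quotient_QG:
  "carrier (QG Quot augmentation_power UG n) = range (coset_class n)"
  "coset_class n s \<oplus>\<^bsub>QG Quot augmentation_power UG n\<^esub> coset_class n t = coset_class n (s + t)"
  "coset_class n s \<otimes>\<^bsub>QG Quot augmentation_power UG n\<^esub> coset_class n t = coset_class n (s * t)"
  "\<zero>\<^bsub>QG Quot augmentation_power UG n\<^esub> = coset_class n 0"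
proof -
  interpret I: ideal "augmentation_power UG n" QG by (rule ideal_augmentation_power)
  have un: "untransport (s + t) = untransport s + untransport t"
    "untransport (s * t) = untransport s \<otimes>\<^bsub>QG\<^esub> untransport t" "untransport 0 = 0" for s t
    by (simp_all add: transport_add transport_mult flip: transport_eq_iff)
  have "carrier (QG Quot augmentation_power UG n) = range (\<lambda>x. coset_class n (transport x))"
    by (auto simp: FactRing_def A_RCOSETS_def' coset_class_def)
  also have "\<dots> = range (coset_class n)"
    using range_composition[of "coset_class n" transport] surjI[of transport untransport] by simp
  finally show "carrier (QG Quot augmentation_power UG n) = range (coset_class n)" .
  show "coset_class n s \<oplus>\<^bsub>QG Quot augmentation_power UG n\<^esub> coset_class n t = coset_class n (s + t)"
    by (simp add: FactRing_def coset_class_def un I.a_rcos_sum)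
  show "coset_class n s \<otimes>\<^bsub>QG Quot augmentation_power UG n\<^esub> coset_class n t = coset_class n (s * t)"
    by (simp add: FactRing_def coset_class_def un I.rcoset_mult_add)
  show "\<zero>\<^bsub>QG Quot augmentation_power UG n\<^esub> = coset_class n 0"
    using QG.a_coset_join2[of 0 "augmentation_power UG n"] I.a_subgroup I.zero_closed
    by (simp add: FactRing_def coset_class_def un)
qed

abbreviation "completion \<equiv> completed_group_algebra UG"

text \<open>One representative per level stands for a point of the inverse limit; operations act on
  representatives, and equality means congruence modulo \<open>filtration n\<close> at each level
  n.\<close>

definition family :: "(nat \<Rightarrow> ut \<Rightarrow>\<^sub>0 rat) \<Rightarrow> nat \<Rightarrow> (nat \<Rightarrow>\<^sub>0 rat) set" where
  "family t = (\<lambda>n. coset_class n (t n))"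

definition coherent :: "(nat \<Rightarrow> ut \<Rightarrow>\<^sub>0 rat) \<Rightarrow> bool" where
  "coherent t \<longleftrightarrow> (\<forall>n. t (Suc n) - t n \<in> filtration n)"

lemma family_eq_iff: "family s = family t \<longleftrightarrow> (\<forall>n. s n - t n \<in> filtration n)"
  by (simp add: family_def fun_eq_iff coset_class_eq_iff)

lemma completion_simps:
  "family s \<oplus>\<^bsub>completion\<^esub> family t = family (\<lambda>n. s n + t n)"
  "family s \<otimes>\<^bsub>completion\<^esub> family t = family (\<lambda>n. s n * t n)"
  "\<zero>\<^bsub>completion\<^esub> = family (\<lambda>n. 0)"
  "q \<odot>\<^bsub>completion\<^esub> family t = family (\<lambda>n. Poly_Mapping.single 0 q * t n)"
proof -
  have "augmentation_power UG n +>\<^bsub>QG\<^esub> (q \<odot>\<^bsub>QG\<^esub> a) = coset_class n (Poly_Mapping.single 0 q * t n)"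
    if "a \<in> coset_class n (t n)" for n a
  proof -
    have "augmentation_power UG n +>\<^bsub>QG\<^esub> (q \<odot>\<^bsub>QG\<^esub> a) = coset_class n (Poly_Mapping.single 0 q * transport a)"
      unfolding coset_class_def transport_smult[symmetric] by simp
    moreover have "Poly_Mapping.single 0 q * (transport a - t n) \<in> filtration n"
      using that unfolding mem_coset_class by (rule filtration_mult_left)
    ultimately show ?thesis by (simp add: coset_class_eq_iff right_diff_distrib)
  qed
  moreover have "coset_class n (t n) \<noteq> {}" for n using untransport_mem_coset_class by blast
  ultimately show "q \<odot>\<^bsub>completion\<^esub> family t = family (\<lambda>n. Poly_Mapping.single 0 q * t n)"
    by (simp add: completed_group_algebra_def Let_def family_def fun_eq_iff SUP_eq_const)
qed (simp_all add: completed_group_algebra_def Let_def family_def fun_eq_iff quotient_QG)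

lemma coset_class_Suc_subset: "coset_class (Suc n) s \<subseteq> coset_class n t \<longleftrightarrow> s - t \<in> filtration n"
proof
  assume "coset_class (Suc n) s \<subseteq> coset_class n t"
  with untransport_mem_coset_class[of s "Suc n"] have "untransport s \<in> coset_class n t" by blast
  then show "s - t \<in> filtration n" by (simp add: mem_coset_class)
next
  assume st: "s - t \<in> filtration n"
  show "coset_class (Suc n) s \<subseteq> coset_class n t"
  proof
    fix a assume "a \<in> coset_class (Suc n) s"
    then have "transport a - s \<in> filtration n"
      using filtration_antimono[of n "Suc n"] by (auto simp: mem_coset_class)
    from filtration_add[OF this st] show "a \<in> coset_class n t" by (simp add: mem_coset_class)
  qed
qed

lemma carrier_completion: "carrier completion = family ` {t. coherent t}"
proof (intro equalityI subsetI)
  fix x assume "x \<in> carrier completion"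
  then have x: "x n \<in> range (coset_class n)" "x (Suc n) \<subseteq> x n" for n
    by (simp_all add: completed_group_algebra_def Let_def quotient_QG)
  have "\<exists>t. x n = coset_class n t" for n using x(1)[of n] by blast
  then obtain t where t: "\<And>n. x n = coset_class n (t n)" by metis
  have "coherent t"
    using x(2) unfolding coherent_def t coset_class_Suc_subset by blast
  moreover have "x = family t" unfolding family_def by (rule ext) (rule t)
  ultimately show "x \<in> family ` {t. coherent t}" by (intro image_eqI[of _ _ t]) simp_all
next
  fix x assume "x \<in> family ` {t. coherent t}"
  then obtain t where "x = family t" "coherent t" by (elim imageE CollectE)
  then show "x \<in> carrier completion"
    by (simp add: completed_group_algebra_def Let_def quotient_QG family_def coset_class_Suc_subset coherent_def)
qed

lemma coherent_add:
  assumes "coherent s" "coherent t"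
  shows "coherent (\<lambda>n. s n + t n)"
  unfolding coherent_def
proof
  fix n
  have "(s (Suc n) - s n) + (t (Suc n) - t n) \<in> filtration n"
    using assms by (intro filtration_add) (simp_all add: coherent_def)
  then show "s (Suc n) + t (Suc n) - (s n + t n) \<in> filtration n" by (simp add: algebra_simps)
qed

lemma coherent_uminus: "coherent t \<Longrightarrow> coherent (\<lambda>n. - t n)"
  unfolding coherent_def
proof
  fix n assume "\<forall>n. t (Suc n) - t n \<in> filtration n"
  then show "- t (Suc n) - - t n \<in> filtration n"
    using filtration_diff[OF filtration_zero, of "t (Suc n) - t n" n] by simp
qed

lemma coherent_mult:
  assumes "coherent s" "coherent t"
  shows "coherent (\<lambda>n. s n * t n)"
  unfolding coherent_def
proof
  fix n
  have "s (Suc n) * (t (Suc n) - t n) + (s (Suc n) - s n) * t n \<in> filtration n"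
  proof (rule filtration_add)
    show "s (Suc n) * (t (Suc n) - t n) \<in> filtration n"
      by (rule filtration_mult_left) (use assms(2) in \<open>simp add: coherent_def\<close>)
    show "(s (Suc n) - s n) * t n \<in> filtration n"
      by (rule filtration_mult_right) (use assms(1) in \<open>simp add: coherent_def\<close>)
  qed
  then show "s (Suc n) * t (Suc n) - s n * t n \<in> filtration n" by (simp add: algebra_simps)
qed

text \<open>The bracket subtracts by means of the additive inverse, which is given by description.
  Evaluating it on families requires the uniqueness of inverses.\<close>

lemma abelian_group_completion: "abelian_group completion"
proof (rule abelian_groupI)
  show "\<zero>\<^bsub>completion\<^esub> \<in> carrier completion"
    by (auto simp: completion_simps carrier_completion coherent_def filtration_zero intro!: imageI)
  show "x \<oplus>\<^bsub>completion\<^esub> y \<in> carrier completion" if "x \<in> carrier completion" "y \<in> carrier completion" for x y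
    using that coherent_add by (auto simp: carrier_completion completion_simps)
  show "\<exists>y\<in>carrier completion. y \<oplus>\<^bsub>completion\<^esub> x = \<zero>\<^bsub>completion\<^esub>" if x: "x \<in> carrier completion" for x
  proof -
    obtain t where t: "x = family t" "coherent t" using x unfolding carrier_completion by blast
    have "family (\<lambda>n. - t n) \<oplus>\<^bsub>completion\<^esub> x = \<zero>\<^bsub>completion\<^esub>"
      by (simp add: t(1) completion_simps)
    moreover have "family (\<lambda>n. - t n) \<in> carrier completion"
      unfolding carrier_completion using coherent_uminus[OF t(2)] by simp
    ultimately show ?thesis by blast
  qed
qed (auto simp: carrier_completion completion_simps add_ac)

lemma completion_minus:
  assumes "coherent s" "coherent t"
  shows "family s \<ominus>\<^bsub>completion\<^esub> family t = family (\<lambda>n. s n - t n)"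
proof -
  have "\<ominus>\<^bsub>completion\<^esub> family t = family (\<lambda>n. - t n)"
  proof (rule abelian_group.minus_equality[OF abelian_group_completion])
    show "family t \<in> carrier completion" "family (\<lambda>n. - t n) \<in> carrier completion"
      unfolding carrier_completion using assms(2) by (simp_all add: coherent_uminus)
  qed (simp add: completion_simps)
  then show ?thesis by (simp add: a_minus_def completion_simps)
qed

lemma lie_bracket_log:
  assumes "coherent s" "coherent t"
  shows "lie_bracket (log_lie_algebra UG) (family s) (family t) = family (\<lambda>n. s n * t n - t n * s n)"
  using completion_minus[OF coherent_mult[OF assms] coherent_mult[OF assms(2,1)]]
  by (simp add: log_lie_algebra_def Let_def completion_simps)

definition log_family :: "ut \<Rightarrow> nat \<Rightarrow> ut \<Rightarrow>\<^sub>0 rat" where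
  "log_family g n = log.truncated_log n (minus_one g)"

lemma coherent_log_family: "coherent (log_family g)"
  unfolding coherent_def log_family_def
  by (intro allI log.truncated_log_diff_I minus_one_filtration) simp

lemma transport_pow: "transport (x [^]\<^bsub>QG\<^esub> (k::nat)) = transport x ^ k"
  by (induction k) (simp_all add: transport_mult power_Suc2 del: power_Suc)

lemma transport_log_partial_sum: "transport (log_partial_sum UG (enc g) N) = log_family g N"
proof -
  have "transport (Poly_Mapping.single (enc g) 1 \<ominus>\<^bsub>QG\<^esub> \<one>\<^bsub>QG\<^esub>) = minus_one g"
    by (simp add: a_minus_def transport_diff minus_one_def)
  moreover have "transport (Poly_Mapping.single (enc g) 1 - \<one>\<^bsub>QG\<^esub>) = minus_one g"
    by (simp add: transport_diff minus_one_def)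
  ultimately show ?thesis
    by (simp only: log_partial_sum_def transport_sum transport_smult transport_pow log_family_def
        log.truncated_log_def)
qed

text \<open>At level n the partial sums are constant from N = n on, so the n-th truncation is the
  limit there, and an eventually constant sequence has only one limit.\<close>

lemma group_log_UG: "group_log UG (enc g) = family (log_family g)"
  unfolding group_log_def
proof (rule the_equality)
  have partial: "augmentation_power UG n +>\<^bsub>QG\<^esub> log_partial_sum UG (enc g) N = coset_class n (log_family g N)" for n N
    by (simp add: coset_class_def flip: transport_log_partial_sum)
  have const: "coset_class n (log_family g N) = family (log_family g) n" if "n \<le> N" for n N
    unfolding family_def coset_class_eq_iff unfolding log_family_def
    by (rule log.truncated_log_diff_I[OF minus_one_filtration that])
  have "untransport (log_family g n) \<in> augmentation_ideal UG" for n
    using log.truncated_log_I[OF minus_one_filtration, of n g]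
    by (simp add: augmentation_ideal_UG log_family_def filtration_1[unfolded One_nat_def])
  then have "family (log_family g) \<in> completed_augmentation_ideal UG"
    using coherent_log_family[of g]
    by (auto simp: completed_augmentation_ideal_def carrier_completion family_def coset_class_def)
  moreover have "eventually (\<lambda>N. augmentation_power UG n +>\<^bsub>QG\<^esub> log_partial_sum UG (enc g) N
      = family (log_family g) n) sequentially" for n
    unfolding partial eventually_sequentially using const by blast
  ultimately show "family (log_family g) \<in> completed_augmentation_ideal UG \<and>
    (\<forall>n. eventually (\<lambda>N. augmentation_power UG n +>\<^bsub>QG\<^esub> log_partial_sum UG (enc g) N
      = family (log_family g) n) sequentially)" by blast
  fix x assume "x \<in> completed_augmentation_ideal UG \<and>
    (\<forall>n. eventually (\<lambda>N. augmentation_power UG n +>\<^bsub>QG\<^esub> log_partial_sum UG (enc g) N = x n) sequentially)"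
  then have x: "eventually (\<lambda>N. coset_class n (log_family g N) = x n) sequentially" for n
    by (simp add: partial)
  show "x = family (log_family g)"
  proof
    fix n
    have "eventually (\<lambda>N. x n = family (log_family g) n) sequentially"
      using x[of n] eventually_ge_at_top[of n] by eventually_elim (simp add: const)
    then show "x n = family (log_family g) n" by simp
  qed
qed

lemma log_lie_simps:
  "lie_add (log_lie_algebra UG) (family s) (family t) = family (\<lambda>n. s n + t n)"
  "lie_scale (log_lie_algebra UG) q (family t) = family (\<lambda>n. Poly_Mapping.single 0 q * t n)"
  by (simp_all add: log_lie_algebra_def Let_def completion_simps)

lemma family_log_mem: "family (log_family g) \<in> carrier (log_lie_algebra UG)"
  unfolding group_log_UG[symmetric] by (simp add: log_lie_algebra_def Let_def rat_span.base)

lemma log_scale_mem: "x \<in> carrier (log_lie_algebra UG) \<Longrightarrow> lie_scale (log_lie_algebra UG) q x \<in> carrier (log_lie_algebra UG)"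
  and log_add_mem: "x \<in> carrier (log_lie_algebra UG) \<Longrightarrow> y \<in> carrier (log_lie_algebra UG) \<Longrightarrow>
    lie_add (log_lie_algebra UG) x y \<in> carrier (log_lie_algebra UG)"
  by (auto simp: log_lie_algebra_def Let_def intro: rat_span.intros)

section \<open>Comparison of the two Lie algebras\<close>

definition log_generator :: "nat \<Rightarrow> ut" where
  "log_generator k = (if k = 0 then UT 1 0 0 0 0 else if k = 1 then UT 0 0 1 0 0
     else if k = 2 then UT 0 0 0 1 0 else UT 0 1 0 0 0)"

abbreviation "central \<equiv> UT 0 0 0 0 1"

text \<open>Coefficients of the central logarithm in the brackets of the generators. At the pair 0,
  1, whose bracket is no such multiple, the value is a default.\<close>

definition structure_constant :: "nat \<Rightarrow> nat \<Rightarrow> rat" where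
  "structure_constant k j = (if k = 0 \<and> j = 2 \<or> k = 3 \<and> j = 1 then 1
     else if k = 2 \<and> j = 0 \<or> k = 1 \<and> j = 3 then -1 else 0)"

lemma minus_one_0 [simp]: "minus_one 0 = 0"
  by (simp add: minus_one_def)

lemma log_family_0 [simp]: "log_family 0 n = 0"
  unfolding log_family_def log.truncated_log_def by (intro sum.neutral) (auto simp: power_0_left)

lemma log_family_commutator:
  assumes "g + h = h + g + c" "c + g = g + c" "c + h = h + c"
  shows "log_family g n * log_family h n - log_family h n * log_family g n - log_family c n \<in> filtration n"
  using log_minus_one_commutator[OF assms] unfolding log_family_def .

text \<open>
  The pair of the first two generators is excluded: its commutator does not commute with them.
\<close>

lemma log_generator_commutator:
  assumes "k < 4" "j < 4" "{k, j} \<noteq> {0, 1}"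
  shows "log_family (log_generator k) n * log_family (log_generator j) n
    - log_family (log_generator j) n * log_family (log_generator k) n
    - Poly_Mapping.single 0 (structure_constant k j) * log_family central n \<in> filtration n"
proof -
  let ?g = log_generator
  let ?b = "\<lambda>k j. log_family (?g k) n * log_family (?g j) n - log_family (?g j) n * log_family (?g k) n"
  have c: "central + ?g i = ?g i + central" for i
    by (rule ut.expand) (simp add: log_generator_def)
  consider "(k, j) \<in> {(0, 2), (3, 1)}" | "(j, k) \<in> {(0, 2), (3, 1)}"
    | "k = j \<or> {k, j} = {0, 3} \<or> {k, j} = {1, 2} \<or> {k, j} = {2, 3}"
    using assms by (auto simp: less_Suc_eq numeral_eq_Suc doubleton_eq_iff)
  then show ?thesis
  proof cases
    case 1
    then have "?g k + ?g j = ?g j + ?g k + central"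
      by (intro ut.expand) (auto simp: log_generator_def)
    moreover have "structure_constant k j = 1" using 1 by (auto simp: structure_constant_def)
    ultimately show ?thesis using log_family_commutator[OF _ c c] by simp
  next
    case 2
    then have "?g j + ?g k = ?g k + ?g j + central"
      by (intro ut.expand) (auto simp: log_generator_def)
    then have "?b j k - log_family central n \<in> filtration n" by (rule log_family_commutator[OF _ c c])
    from filtration_diff[OF filtration_zero this]
    have "?b k j + log_family central n \<in> filtration n" by (simp add: algebra_simps)
    moreover have "structure_constant k j = - 1" using 2 by (auto simp: structure_constant_def)
    ultimately show ?thesis by (simp add: single_uminus)
  next
    case 3
    then have "?g k + ?g j = ?g j + ?g k + 0"
      by (intro ut.expand) (auto simp: log_generator_def doubleton_eq_iff)
    then have "?b k j - log_family 0 n \<in> filtration n" by (rule log_family_commutator) simp_all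
    moreover have "structure_constant k j = 0"
      using 3 by (auto simp: structure_constant_def doubleton_eq_iff)
    ultimately show ?thesis by simp
  qed
qed

text \<open>The assumption on \<open>\<alpha>\<close> removes the one bracket that the class two
  formula leaves out; all the others are multiples of the central logarithm and add up.\<close>

lemma log_combination_bracket:
  assumes j: "j < 4" and \<alpha>: "\<And>k. k < 4 \<Longrightarrow> {k, j} = {0, 1} \<Longrightarrow> \<alpha> k = 0"
  shows "lie_bracket (log_lie_algebra UG)
      (lie_combination (log_lie_algebra UG) \<alpha> (\<lambda>k. family (log_family (log_generator k))))
      (family (log_family (log_generator j)))
    = lie_scale (log_lie_algebra UG) (\<Sum>k<4. \<alpha> k * structure_constant k j) (family (log_family central))"
proof -
  let ?l = "\<lambda>k. log_family (log_generator k)"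
  let ?s = "\<lambda>q. Poly_Mapping.single (0::ut) (q::rat)"
  define w where "w n = (\<Sum>k<4. ?s (\<alpha> k) * ?l k n)" for n
  have four: "{..<4::nat} = {0, 1, 2, 3}" by auto
  have combination: "lie_combination (log_lie_algebra UG) \<alpha> (\<lambda>k. family (?l k)) = family w"
    by (simp add: lie_combination_def log_lie_simps w_def[abs_def] four add.assoc)
  have "coherent w"
    unfolding coherent_def
  proof
    fix n
    have "(\<Sum>k<4. ?s (\<alpha> k) * (?l k (Suc n) - ?l k n)) \<in> filtration n"
      using coherent_log_family by (intro log.sum_I filtration_mult_left) (simp add: coherent_def)
    then show "w (Suc n) - w n \<in> filtration n"
      by (simp add: w_def right_diff_distrib sum_subtractf)
  qed
  then have "lie_bracket (log_lie_algebra UG) (family w) (family (?l j)) = family (\<lambda>n. w n * ?l j n - ?l j n * w n)"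
    by (rule lie_bracket_log[OF _ coherent_log_family])
  also have "\<dots> = family (\<lambda>n. ?s (\<Sum>k<4. \<alpha> k * structure_constant k j) * log_family central n)"
    unfolding family_eq_iff
  proof
    fix n
    have "(\<Sum>k<4. ?s (\<alpha> k) * (?l k n * ?l j n - ?l j n * ?l k n - ?s (structure_constant k j) * log_family central n))
      \<in> filtration n"
    proof (rule log.sum_I)
      fix k assume k: "k \<in> {..<4::nat}"
      show "?s (\<alpha> k) * (?l k n * ?l j n - ?l j n * ?l k n - ?s (structure_constant k j) * log_family central n)
        \<in> filtration n"
      proof (cases "{k, j} = {0, 1}")
        case True
        then show ?thesis using \<alpha>[OF _ True] k by (simp add: filtration_zero)
      next
        case False
        then show ?thesis using k j by (intro filtration_mult_left log_generator_commutator) simp_all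
      qed
    qed
    also have "(\<Sum>k<4. ?s (\<alpha> k) * (?l k n * ?l j n - ?l j n * ?l k n - ?s (structure_constant k j) * log_family central n))
      = w n * ?l j n - ?l j n * w n - ?s (\<Sum>k<4. \<alpha> k * structure_constant k j) * log_family central n"
    proof -
      have "?l j n * w n = (\<Sum>k<4. ?s (\<alpha> k) * (?l j n * ?l k n))"
        unfolding w_def sum_distrib_left log.s_left_commute ..
      moreover have "w n * ?l j n = (\<Sum>k<4. ?s (\<alpha> k) * (?l k n * ?l j n))"
        unfolding w_def sum_distrib_right mult.assoc ..
      moreover have "?s (\<Sum>k<4. \<alpha> k * structure_constant k j) * log_family central n
        = (\<Sum>k<4. ?s (\<alpha> k) * (?s (structure_constant k j) * log_family central n))"
        unfolding log.s_sum log.s_mult_left sum_distrib_right ..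
      ultimately show ?thesis by (simp only: right_diff_distrib sum_subtractf)
    qed
    finally show "w n * ?l j n - ?l j n * w n - ?s (\<Sum>k<4. \<alpha> k * structure_constant k j) * log_family central n
      \<in> filtration n" .
  qed
  finally show ?thesis unfolding combination log_lie_simps .
qed

text \<open>Level 4 is the place to look: there the (1,4) entry is well defined on cosets, and it
  recovers the scalar.\<close>

lemma log_scale_central_inject:
  assumes "lie_scale (log_lie_algebra UG) q (family (log_family central))
    = lie_scale (log_lie_algebra UG) r (family (log_family central))"
  shows "q = r"
proof -
  let ?s = "\<lambda>q. Poly_Mapping.single (0::ut) (q::rat)"
  have "?s q * log_family central 4 - ?s r * log_family central 4 \<in> filtration 4"
    using assms unfolding log_lie_simps family_eq_iff by blast
  then have "matrix_entry e14 (?s q * log_family central 4 - ?s r * log_family central 4) = 0"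
    by (rule filtration_4)
  moreover have "matrix_entry e14 (?s q * log_family central 4) = q" for q
    using matrix_entry_log[of 4]
    by (simp add: matrix_entry_mult log_family_def) (simp add: matrix_entry_def)
  ultimately show ?thesis by (simp add: matrix_entry_def functional_diff)
qed

text \<open>Generator 2 detects coefficient 0, and generator 3 detects coefficient 1; neither
  belongs to the excluded pair. Once these two coefficients vanish, generators 0 and 1 become
  admissible and detect coefficients 2 and 3.\<close>

lemma log_combination_not_central:
  assumes "k < 4" "\<alpha> k \<noteq> 0"
  obtains j q where "j < 4" "q \<noteq> 0"
    "lie_bracket (log_lie_algebra UG)
      (lie_combination (log_lie_algebra UG) \<alpha> (\<lambda>k. family (log_family (log_generator k))))
      (family (log_family (log_generator j)))
    = lie_scale (log_lie_algebra UG) q (family (log_family central))"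
proof -
  have four: "{..<4::nat} = {0, 1, 2, 3}" by auto
  have "\<exists>j<4. (\<forall>k<4. {k, j} = {0, 1} \<longrightarrow> \<alpha> k = 0) \<and> (\<Sum>k<4. \<alpha> k * structure_constant k j) \<noteq> 0"
  proof -
    consider "\<alpha> 0 \<noteq> 0" | "\<alpha> 1 \<noteq> 0" | "\<alpha> 0 = 0" "\<alpha> 1 = 0" "\<alpha> 2 \<noteq> 0" | "\<alpha> 0 = 0" "\<alpha> 1 = 0" "\<alpha> 3 \<noteq> 0"
      using assms by (auto simp: less_Suc_eq numeral_eq_Suc)
    then show ?thesis
    proof cases
      case 1
      then show ?thesis
        by (intro exI[of _ 2]) (auto simp: four structure_constant_def doubleton_eq_iff)
    next
      case 2
      then show ?thesis
        by (intro exI[of _ 3]) (auto simp: four structure_constant_def doubleton_eq_iff)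
    next
      case 3
      then show ?thesis
        by (intro exI[of _ 0]) (auto simp: four structure_constant_def doubleton_eq_iff)
    next
      case 4
      then show ?thesis
        by (intro exI[of _ 1]) (auto simp: four structure_constant_def doubleton_eq_iff)
    qed
  qed
  then obtain j where j: "j < 4" "\<And>k. k < 4 \<Longrightarrow> {k, j} = {0, 1} \<Longrightarrow> \<alpha> k = 0"
    "(\<Sum>k<4. \<alpha> k * structure_constant k j) \<noteq> 0" by blast
  show thesis by (rule that[OF j(1,3) log_combination_bracket[OF j(1,2)]])
qed

lemma lie_iso_combination:
  assumes f: "f \<in> lie_iso L M"
    and x: "\<And>k. x k \<in> carrier L"
    and add: "\<And>y z. y \<in> carrier L \<Longrightarrow> z \<in> carrier L \<Longrightarrow> lie_add L y z \<in> carrier L"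
    and scale: "\<And>q y. y \<in> carrier L \<Longrightarrow> lie_scale L q y \<in> carrier L"
  shows "lie_combination L \<alpha> x \<in> carrier L"
    and "f (lie_combination L \<alpha> x) = lie_combination M \<alpha> (\<lambda>k. f (x k))"
  using f unfolding lie_iso_def lie_combination_def by (simp_all add: x add scale)

text \<open>The graded algebra yields a central combination of the images of the four logarithms.
  Its preimage, the same combination of the logarithms, has a bracket that is a nonzero multiple of
  the central logarithm, although f sends this bracket to zero.\<close>

lemma not_lie_isomorphic_UG: "\<not> lie_isomorphic (log_lie_algebra UG) (graded_lie_algebra UG)"
proof
  let ?L = "log_lie_algebra UG" and ?M = "graded_lie_algebra UG"
  assume "lie_isomorphic ?L ?M"
  then obtain f where f: "f \<in> lie_iso ?L ?M" unfolding lie_isomorphic_def by blast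
  then have bij: "bij_betw f (carrier ?L) (carrier ?M)"
    and scale: "\<And>q x. x \<in> carrier ?L \<Longrightarrow> f (lie_scale ?L q x) = lie_scale ?M q (f x)"
    and bracket: "\<And>x y. x \<in> carrier ?L \<Longrightarrow> y \<in> carrier ?L \<Longrightarrow> f (lie_bracket ?L x y) = lie_bracket ?M (f x) (f y)"
    by (simp_all add: lie_iso_def)
  have f_mem: "f x \<in> carrier ?M" if "x \<in> carrier ?L" for x using bij that by (rule bij_betwE[rule_format])
  define l where "l k = family (log_family (log_generator k))" for k
  define z where "z = family (log_family central)"
  have l: "l k \<in> carrier ?L" for k unfolding l_def by (rule family_log_mem)
  have z: "z \<in> carrier ?L" unfolding z_def by (rule family_log_mem)
  obtain \<alpha> :: "nat \<Rightarrow> rat" and k where k: "k < 4" "\<alpha> k \<noteq> 0"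
    and central: "\<And>y. y \<in> carrier ?M \<Longrightarrow>
      lie_bracket ?M (lie_combination ?M \<alpha> (\<lambda>k. f (l k))) y = lie_zero ?M"
    by (rule graded_central_combination[of "\<lambda>k. f (l k)"]) (auto intro: f_mem l)
  define w where "w = lie_combination ?L \<alpha> l"
  have w: "w \<in> carrier ?L" "f w = lie_combination ?M \<alpha> (\<lambda>k. f (l k))"
    unfolding w_def by (rule lie_iso_combination[OF f l log_add_mem log_scale_mem]; assumption)+
  obtain j q where j: "j < 4" and q: "q \<noteq> 0" "lie_bracket ?L w (l j) = lie_scale ?L q z"
    using log_combination_not_central[of k \<alpha>, OF k] unfolding w_def l_def[abs_def] z_def by blast
  have "f (lie_scale ?L q z) = lie_bracket ?M (f w) (f (l j))"
    using bracket[OF w(1) l[of j]] q(2) by simp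
  also have "\<dots> = lie_zero ?M" unfolding w(2) by (rule central[OF f_mem[OF l]])
  \<comment> \<open>Isomorphisms are specified by sums, scalings and brackets, so zero is written as
    a multiple of \<open>f z\<close> before it is pulled back.\<close>
  also have "\<dots> = lie_scale ?M 0 (f z)" by (rule graded_scale_zero[OF f_mem[OF z], symmetric])
  also have "\<dots> = f (lie_scale ?L 0 z)" by (rule scale[OF z, symmetric])
  finally have "lie_scale ?L q z = lie_scale ?L 0 z"
    using bij_betw_imp_inj_on[OF bij] log_scale_mem[OF z] by (meson inj_onD)
  then have "q = 0" unfolding z_def by (rule log_scale_central_inject)
  with q(1) show False by contradiction
qed

theorem mainTheorem5:
  shows "\<exists>G :: nat monoid. group G \<and> finitely_generated_group G \<and> Magnus_group G \<and>
    nilpotent_group G \<and> \<not> relatively_free G \<and>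
    \<not> lie_isomorphic (log_lie_algebra G) (graded_lie_algebra G)"
  using group_UG finitely_generated_UG Magnus_UG nilpotent_UG not_relatively_free_UG not_lie_isomorphic_UG
  by blast

end
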